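(* Let $p$ be an odd prime and let $\zeta_d$ denote a primitive $d$-th root of unity. Let $n\geq 2$, $m\geq 1$ be integers, let $r$ be an integer with $(r,p^n)=1$ such that $r$ has multiplicative order $p^s$ modulo $p^n$, where $1\leq s\leq \min\{n-1,m\}$, and consider the finite non-abelian split metacyclic $p$-group $$G=\langle a,b\mid a^{p^n}=b^{p^m}=1,\ bab^{-1}=a^r\rangle.$$ Then the Wedderburn decomposition of the rational group algebra $\mathbb{Q}G$ is as follows. \begin{enumerate} \item If $n-s\geq m$, then $$\mathbb{Q}G \cong \mathbb{Q} \bigoplus_{\lambda=1}^m (p^\lambda+p^{\lambda-1})\mathbb{Q}(\zeta_{p^\lambda}) \bigoplus_{\lambda=m+1}^{n-s}p^m \mathbb{Q}(\zeta_{p^\lambda}) \bigoplus_{t=1}^s p^{m-t}M_{p^t}(\mathbb{Q}(\zeta_{p^{n-s}})).$$ \item If $n-s<m$, write $m=(n-s)+k$. \begin{enumerate} \item If $k\leq s$, then \begin{align*} \mathbb{Q}G \cong & \mathbb{Q} \bigoplus_{\lambda=1}^{n-s} (p^\lambda+p^{\lambda-1})\mathbb{Q}(\zeta_{p^\lambda}) \bigoplus_{\lambda=n-s+1}^{m}p^{n-s} \mathbb{Q}(\zeta_{p^\lambda}) \bigoplus_{t=1}^{k-1} p^{n-s}M_{p^t}(\mathbb{Q}(\zeta_{p^{n-s}}))\\ &\bigoplus_{t=1}^{k-1}\bigoplus_{\lambda=n-s+1}^{m-t} (p^{n-s}-p^{n-s-1})M_{p^t}(\mathbb{Q}(\zeta_{p^{\lambda}}))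 \bigoplus_{t=k}^s p^{m-t}M_{p^t}(\mathbb{Q}(\zeta_{p^{n-s}})). \end{align*} \item If $k>s$, then \begin{align*} \mathbb{Q}G \cong & \mathbb{Q} \bigoplus_{\lambda=1}^{n-s} (p^\lambda+p^{\lambda-1})\mathbb{Q}(\zeta_{p^\lambda}) \bigoplus_{\lambda=n-s+1}^{m}p^{n-s} \mathbb{Q}(\zeta_{p^\lambda}) \bigoplus_{t=1}^s p^{n-s}M_{p^t}(\mathbb{Q}(\zeta_{p^{n-s}}))\\ &\bigoplus_{t=1}^s\bigoplus_{\lambda=n-s+1}^{m-t} (p^{n-s}-p^{n-s-1})M_{p^t}(\mathbb{Q}(\zeta_{p^{\lambda}})). \end{align*} \end{enumerate} \end{enumerate}
   Context: $\mathbb{Q}G$ is the rational group algebra of $G$. For a positive integer $c$ and an algebra $A$, the notation $c\,A$ inside a direct sum means the direct sum of $c$ copies of $A$. $M_q(D)$ denotes the ring of $q\times q$ matrices over $D$. Empty direct sums (when the lower index exceeds the upper) are zero. *)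

theory Defs
  imports Complex_Main "HOL-Computational_Algebra.Polynomial" "HOL-Algebra.QuotRing" "HOL-Algebra.Generated_Groups"
begin

definition mult_order :: "int \<Rightarrow> int \<Rightarrow> nat" where
  "mult_order m r = (LEAST k. k > 0 \<and> r ^ k mod m = 1 mod m)"

definition rat_group_algebra :: "('g, 'b) monoid_scheme \<Rightarrow> ('g \<Rightarrow> rat) ring" where
  "rat_group_algebra G =
     \<lparr> carrier = (carrier G \<rightarrow>\<^sub>E (UNIV :: rat set)),
       mult = (\<lambda>f h. \<lambda>x\<in>carrier G. \<Sum>y\<in>carrier G. f y * h (inv\<^bsub>G\<^esub> y \<otimes>\<^bsub>G\<^esub> x)),
       one = (\<lambda>x\<in>carrier G. if x = \<one>\<^bsub>G\<^esub> then 1 else 0),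
       zero = (\<lambda>x\<in>carrier G. 0),
       add = (\<lambda>f h. \<lambda>x\<in>carrier G. f x + h x) \<rparr>"

definition cyclotomic_field :: "nat \<Rightarrow> complex ring" where
  "cyclotomic_field d =
     \<lparr> carrier = {poly (map_poly of_rat q) (cis (2 * pi / real d)) | q. True},
       mult = (*), one = 1, zero = 0, add = (+) \<rparr>"

definition matrix_ring :: "nat \<Rightarrow> ('a, 'b) ring_scheme \<Rightarrow> (nat \<Rightarrow> nat \<Rightarrow> 'a) ring" where
  "matrix_ring q R =
     \<lparr> carrier = {A. (\<forall>i j. (i < q \<and> j < q \<longrightarrow> A i j \<in> carrier R) \<and>
                              (\<not> (i < q \<and> j < q) \<longrightarrow> A i j = \<zero>\<^bsub>R\<^esub>))},
       mult = (\<lambda>A B i j. if i < q \<and> j < q then (\<Oplus>\<^bsub>R\<^esub> k\<in>{..<q}. A i k \<otimes>\<^bsub>R\<^esub> B k j) else \<zero>\<^bsub>R\<^esub>),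
       one = (\<lambda>i j. if i < q \<and> j < q then (if i = j then \<one>\<^bsub>R\<^esub> else \<zero>\<^bsub>R\<^esub>) else \<zero>\<^bsub>R\<^esub>),
       zero = (\<lambda>i j. \<zero>\<^bsub>R\<^esub>),
       add = (\<lambda>A B i j. if i < q \<and> j < q then A i j \<oplus>\<^bsub>R\<^esub> B i j else \<zero>\<^bsub>R\<^esub>) \<rparr>"

definition ring_dsum :: "('a, 'b) ring_scheme list \<Rightarrow> (nat \<Rightarrow> 'a) ring" where
  "ring_dsum Rs =
     \<lparr> carrier = {f. (\<forall>i < length Rs. f i \<in> carrier (Rs ! i)) \<and> (\<forall>i \<ge> length Rs. f i = undefined)},
       mult = (\<lambda>f g i. if i < length Rs then f i \<otimes>\<^bsub>Rs ! i\<^esub> g i else undefined),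
       one = (\<lambda>i. if i < length Rs then \<one>\<^bsub>Rs ! i\<^esub> else undefined),
       zero = (\<lambda>i. if i < length Rs then \<zero>\<^bsub>Rs ! i\<^esub> else undefined),
       add = (\<lambda>f g i. if i < length Rs then f i \<oplus>\<^bsub>Rs ! i\<^esub> g i else undefined) \<rparr>"

text \<open>A Wedderburn-type decomposition described by a list of triples (c, q, d), each
  standing for c copies of M_q(Q(zeta_d)); fields Q(zeta_d) are the case q = 1.\<close>
definition wedderburn_sum :: "(nat \<times> nat \<times> nat) list \<Rightarrow> (nat \<Rightarrow> nat \<Rightarrow> nat \<Rightarrow> complex) ring" where
  "wedderburn_sum L =
     ring_dsum (concat (map (\<lambda>(c, q, d). replicate c (matrix_ring q (cyclotomic_field d))) L))"

definition decomp_case1 :: "nat \<Rightarrow> nat \<Rightarrow> nat \<Rightarrow> nat \<Rightarrow> (nat \<times> nat \<times> nat) list" where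
  "decomp_case1 p n m s =
     [(1, 1, 1)]
     @ map (\<lambda>l. (p ^ l + p ^ (l - 1), 1, p ^ l)) [1..<m + 1]
     @ map (\<lambda>l. (p ^ m, 1, p ^ l)) [m + 1..<n - s + 1]
     @ map (\<lambda>t. (p ^ (m - t), p ^ t, p ^ (n - s))) [1..<s + 1]"

definition decomp_case2a :: "nat \<Rightarrow> nat \<Rightarrow> nat \<Rightarrow> nat \<Rightarrow> nat \<Rightarrow> (nat \<times> nat \<times> nat) list" where
  "decomp_case2a p n m s k =
     [(1, 1, 1)]
     @ map (\<lambda>l. (p ^ l + p ^ (l - 1), 1, p ^ l)) [1..<n - s + 1]
     @ map (\<lambda>l. (p ^ (n - s), 1, p ^ l)) [n - s + 1..<m + 1]
     @ map (\<lambda>t. (p ^ (n - s), p ^ t, p ^ (n - s))) [1..<k]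
     @ concat (map (\<lambda>t. map (\<lambda>l. (p ^ (n - s) - p ^ (n - s - 1), p ^ t, p ^ l)) [n - s + 1..<m - t + 1]) [1..<k])
     @ map (\<lambda>t. (p ^ (m - t), p ^ t, p ^ (n - s))) [k..<s + 1]"

definition decomp_case2b :: "nat \<Rightarrow> nat \<Rightarrow> nat \<Rightarrow> nat \<Rightarrow> (nat \<times> nat \<times> nat) list" where
  "decomp_case2b p n m s =
     [(1, 1, 1)]
     @ map (\<lambda>l. (p ^ l + p ^ (l - 1), 1, p ^ l)) [1..<n - s + 1]
     @ map (\<lambda>l. (p ^ (n - s), 1, p ^ l)) [n - s + 1..<m + 1]
     @ map (\<lambda>t. (p ^ (n - s), p ^ t, p ^ (n - s))) [1..<s + 1]
     @ concat (map (\<lambda>t. map (\<lambda>l. (p ^ (n - s) - p ^ (n - s - 1), p ^ t, p ^ l)) [n - s + 1..<m - t + 1]) [1..<s + 1])"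

end

theory Submission
  imports Defs "HOL-Number_Theory.Cong"
begin

text \<open>Put \<open>N = n - s\<close> and \<open>\<zeta>\<^sub>l = exp (2 \<pi> i / p\<^sup>l)\<close>. The order hypothesis says that \<open>r - 1\<close> has
  \<open>p\<close>-adic valuation exactly \<open>N\<close>. Hence every complex irreducible character of \<open>G\<close> of degree \<open>p\<^sup>t\<close>
  vanishes off the subgroup generated by \<open>a ^ p\<^sup>t\<close> and \<open>b ^ p\<^sup>t\<close>, which acts by scalars \<open>\<omega>\<close>, \<open>\<eta>\<close>; here
  \<open>\<omega>\<close> is a \<open>p\<^sup>N\<close>-th root of unity, primitive if \<open>t \<ge> 1\<close>, and \<open>\<eta>\<close> is any \<open>p\<^bsup>m-t\<^esup>\<close>-th root of unity. Each
  of them is afforded by an explicit monomial representation over its character field \<open>\<rat>(\<omega>, \<eta>)\<close>, so no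
  Schur indices occur.

  Taking one representation per Galois class yields a ring homomorphism from \<open>\<rat>G\<close> into the asserted
  sum of matrix rings. It is injective: an element of the kernel is killed by all Galois conjugates
  of the chosen characters (this uses the irreducibility of the cyclotomic polynomial), hence by the
  regular character. The target has dimension at most \<open>p\<^bsup>n+m\<^esup>\<close> over \<open>\<rat>\<close>, so it is bijective.\<close>

section \<open>Cyclotomic fields of prime power conductor\<close>

text \<open>The obstacle is the field of definition. The obvious module for degree
  \<open>p ^ t\<close>, induced from the subgroup generated by \<open>a\<close> and
  \<open>b ^ p ^ t\<close>, lets \<open>a\<close> act by roots of unity of order
  \<open>p ^ (N + t)\<close>, which in general lie outside the character field. The cure is to
  replace such a root by an indeterminate X with X ^ q2 = v over the character field and to let
  \<open>b\<close> act through X -> X ^ (a power of \<open>r\<close>). What remains is an equation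
  saying that the scalar of \<open>b ^ p ^ t\<close> is a norm. It is solvable because the exponent
  of X in the norm, a geometric sum in powers of \<open>r\<close>, has the exact valuation given by
  lifting the exponent at an odd prime.

  The two scalars have p-power order, so the character field is generated by the one of larger
  order. Comparing \<open>N\<close> with \<open>m - t\<close> therefore decides which conductors
  occur in degree \<open>p ^ t\<close>, and this is the origin of the case distinction in the
  theorem. Galois automorphisms never occur as maps: conjugation is expressed through polynomials
  annihilating a root of unity.\<close>

lemma const_dvd_freshman:
  fixes f g :: "int poly"
  assumes "prime p"
  shows "[:int p:] dvd (f + g) ^ p - (f ^ p + g ^ p)"
proof -
  have p0: "p > 0" using assms prime_gt_0_nat by blast
  have "(f + g) ^ p = (\<Sum>k\<le>p. of_nat (p choose k) * f ^ k * g ^ (p - k))"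
    by (rule binomial_ring)
  also have "{..p} = insert 0 (insert p {0<..<p})" using p0 by auto
  also have "(\<Sum>k\<in>insert 0 (insert p {0<..<p}). of_nat (p choose k) * f ^ k * g ^ (p - k))
     = g ^ p + (f ^ p + (\<Sum>k\<in>{0<..<p}. of_nat (p choose k) * f ^ k * g ^ (p - k)))"
    using p0 by simp
  finally have "(f + g) ^ p - (f ^ p + g ^ p) = (\<Sum>k\<in>{0<..<p}. of_nat (p choose k) * f ^ k * g ^ (p - k))"
    by simp
  moreover have "[:int p:] dvd (\<Sum>k\<in>{0<..<p}. of_nat (p choose k) * f ^ k * g ^ (p - k))"
  proof (rule dvd_sum)
    fix k assume k: "k \<in> {0<..<p}"
    hence "p dvd p choose k" using dvd_choose_prime[of k p] assms p0 by auto
    hence "(of_nat p :: int poly) dvd of_nat (p choose k)" by (auto simp: dvd_def)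
    hence "[:int p:] dvd of_nat (p choose k)" by (simp add: of_nat_poly)
    thus "[:int p:] dvd of_nat (p choose k) * f ^ k * g ^ (p - k)" by simp
  qed
  ultimately show ?thesis by simp
qed

lemma power_cong_dvd:
  fixes a b d :: "'a :: comm_ring_1"
  assumes "d dvd a - b"
  shows "d dvd a ^ n - b ^ n"
  using assms by (simp add: power_diff_sumr2)

text \<open>Iterated Frobenius modulo \<open>p\<close>; oddness gives (-1) ^ p = -1. Congruence in
  Z[X] is written as divisibility by a constant polynomial. Evaluated at an integer, the result is
  used again for the residue of \<open>r\<close>.\<close>

lemma const_dvd_X_minus_one_power:
  assumes "prime p" "odd p"
  shows "[:int p:] dvd (monom 1 (p ^ l) - 1) - [:-1, 1:] ^ (p ^ l)"
proof (induction l)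
  case 0
  show ?case by (simp add: monom_altdef one_pCons)
next
  case (Suc l)
  let ?Y = "monom 1 (p ^ l) :: int poly"
  have 1: "[:int p:] dvd (?Y - 1) ^ p - ([:-1, 1:] ^ (p ^ l)) ^ p"
    by (rule power_cong_dvd[OF Suc])
  have "[:int p:] dvd (?Y + (-1)) ^ p - (?Y ^ p + (-1) ^ p)"
    by (rule const_dvd_freshman[OF assms(1)])
  hence 2: "[:int p:] dvd (?Y - 1) ^ p - (monom 1 (p ^ Suc l) - 1)"
    using \<open>odd p\<close> by (simp add: monom_power mult.commute)
  have "(monom 1 (p ^ Suc l) - 1) - [:-1, 1:] ^ (p ^ Suc l)
     = ((?Y - 1) ^ p - ([:-1, 1:] ^ (p ^ l)) ^ p) - ((?Y - 1) ^ p - (monom 1 (p ^ Suc l) - 1))"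
    by (simp add: power_mult[symmetric] mult.commute)
  thus ?case using 1 2 by (metis dvd_diff)
qed

text \<open>The Eisenstein argument without factorisation modulo \<open>p\<close>: a factor of a power of \<open>X - 1\<close> modulo
  \<open>p\<close> can only lose linear factors \<open>X - 1\<close>, so it is constant unless its value at \<open>1\<close> is divisible by \<open>p\<close>.\<close>
lemma degree_zero_if_coprime_at_one:
  fixes A B :: "int poly"
  assumes "prime p" and "lead_coeff A = 1" and "\<not> p dvd poly A 1"
  shows "lead_coeff B = 1 \<Longrightarrow> [:p:] dvd A * B - [:-1, 1:] ^ M \<Longrightarrow> degree A = 0"
proof (induction M arbitrary: B)
  case 0
  show ?case
  proof (rule ccontr)
    assume "degree A \<noteq> 0"
    moreover have nz: "A \<noteq> 0" "B \<noteq> 0" using assms(2) 0 by auto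
    ultimately have d: "degree (A * B) > 0" by (simp add: degree_mult_eq)
    have "p dvd coeff (A * B - [:-1, 1:] ^ 0) (degree (A * B))"
      using 0(2) by (simp only: const_poly_dvd_iff)
    moreover have "coeff (A * B) (degree (A * B)) = 1"
      using assms(2) 0(1) by (simp add: lead_coeff_mult)
    ultimately have "p dvd 1" using d by (simp add: coeff_eq_0)
    thus False using assms(1) not_prime_unit by blast
  qed
next
  case (Suc M)
  have "[:p:] dvd A * B - [:-1, 1:] ^ Suc M" by (rule Suc.prems)
  then obtain E where E: "A * B - [:-1, 1:] ^ Suc M = [:p:] * E" by (elim dvdE)
  \<comment> \<open>Evaluation at 1 kills the power of X - 1, so \<open>p\<close> divides A(1) B(1)
    and hence B(1).\<close>
  have "poly (A * B - [:-1, 1:] ^ Suc M) 1 = poly ([:p:] * E) 1" using E by simp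
  hence "poly A 1 * poly B 1 = p * poly E 1" by simp
  hence "p dvd poly A 1 * poly B 1" by simp
  hence pB: "p dvd poly B 1" using assms(1,3) prime_dvd_mult_iff by blast
  \<comment> \<open>X - 1 is split off from \<open>B\<close>. The remainder B(1) vanishes modulo
    \<open>p\<close>, so one factor X - 1 cancels and the induction hypothesis applies to
    \<open>B'\<close>.\<close>
  define B' where "B' = synthetic_div B 1"
  have BB: "B = [:-1, 1:] * B' + [:poly B 1:]"
    using synthetic_div_correct'[of 1 B] by (simp add: B'_def)
  have "degree B \<noteq> 0"
  proof
    assume d: "degree B = 0"
    hence "poly B 1 = 1" using Suc.prems(1) by (metis degree_0_id poly_pCons poly_0 mult_zero_right add_0_right)
    thus False using pB assms(1) not_prime_unit by auto
  qed
  have B'0: "B' \<noteq> 0"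
  proof
    assume "B' = 0"
    hence "B = [:poly B 1:]" using BB by simp
    hence "degree B = 0" by (metis degree_pCons_0)
    thus False using \<open>degree B \<noteq> 0\<close> by simp
  qed
  have lB': "lead_coeff B' = 1"
  proof -
    have "degree ([:-1, 1:] * B') > degree [:poly B 1:]" using B'0 by (subst degree_mult_eq) auto
    hence "lead_coeff ([:-1, 1:] * B' + [:poly B 1:]) = lead_coeff ([:-1, 1:] * B')"
      by (metis lead_coeff_add_le add.commute)
    hence "lead_coeff B = lead_coeff ([:-1, 1:] * B')" by (simp only: BB[symmetric])
    also have "\<dots> = lead_coeff B'" by (subst lead_coeff_mult) simp
    finally show ?thesis using Suc.prems(1) by simp
  qed
  have pp: "prime_elem [:p:]" using assms(1) by (simp add: prime_elem_const_poly_iff prime_imp_prime_elem del: prime_elem_iff_prime_abs)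
  have ring_identity: "A * (U * V + c) - U * W - A * c = U * (A * V - W)" for U V W c :: "int poly"
    by (simp add: algebra_simps)
  have "[:p:] dvd A * [:poly B 1:]" using pB by (intro dvd_mult) (auto simp: const_poly_dvd_iff coeff_pCons split: nat.splits)
  hence "[:p:] dvd (A * B - [:-1, 1:] ^ Suc M) - A * [:poly B 1:]"
    using Suc.prems(2) by (rule dvd_diff[rotated])
  also have "(A * B - [:-1, 1:] ^ Suc M) - A * [:poly B 1:] = [:-1, 1:] * (A * B' - [:-1, 1:] ^ M)"
    by (subst BB) (simp only: power_Suc ring_identity)
  finally have "[:p:] dvd [:-1, 1:] * (A * B' - [:-1, 1:] ^ M)" .
  hence "[:p:] dvd [:-1, 1:] \<or> [:p:] dvd A * B' - [:-1, 1:] ^ M"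
    using pp prime_elem_dvd_mult_iff by blast
  moreover have "\<not> [:p:] dvd [:-1, 1:]"
  proof
    assume "[:p:] dvd [:-1, 1:]"
    hence "p dvd coeff [:-1, 1:] 1" unfolding const_poly_dvd_iff by blast
    thus False using assms(1) not_prime_unit by auto
  qed
  ultimately show ?case using Suc.IH lB' by blast
qed

text \<open>For positive \<open>l\<close> this is the cyclotomic polynomial of conductor
  \<open>p ^ l\<close>. At \<open>l = 0\<close> truncated subtraction yields 1 + X + ... + X ^ (p -
  1) instead of X - 1, so that case is treated apart below.\<close>

definition prime_power_cyclotomic :: "nat \<Rightarrow> nat \<Rightarrow> int poly" where
  "prime_power_cyclotomic p l = (\<Sum>i<p. monom 1 (i * p ^ (l - 1)))"

lemma prime_power_cyclotomic_mult:
  assumes "l \<ge> 1"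
  shows "prime_power_cyclotomic p l * (monom 1 (p ^ (l - 1)) - 1) = monom 1 (p ^ l) - 1"
proof -
  have "monom 1 (p ^ l) = (monom 1 (p ^ (l - 1)) :: int poly) ^ p"
    using assms by (cases l) (simp_all add: monom_power mult.commute)
  moreover have "prime_power_cyclotomic p l = (\<Sum>i<p. (monom 1 (p ^ (l - 1))) ^ i)"
    by (simp add: prime_power_cyclotomic_def monom_power mult.commute)
  ultimately show ?thesis by (simp only: power_diff_1_eq mult.commute)
qed

lemma monom_minus_one_monic:
  assumes "k > 0"
  shows "degree (monom 1 k - 1 :: int poly) = k" "lead_coeff (monom 1 k - 1 :: int poly) = 1"
proof -
  show d: "degree (monom 1 k - 1 :: int poly) = k"
    using assms degree_add_eq_left[of "-1" "monom (1::int) k"] by (simp add: degree_monom_eq)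
  show "lead_coeff (monom 1 k - 1 :: int poly) = 1"
    unfolding d using assms by simp
qed

lemma prime_power_cyclotomic_monic:
  assumes "prime p" "l \<ge> 1"
  shows "lead_coeff (prime_power_cyclotomic p l) = 1"
    and "degree (prime_power_cyclotomic p l) = p ^ l - p ^ (l - 1)"
proof -
  let ?C = "prime_power_cyclotomic p l" and ?Y = "monom 1 (p ^ (l - 1)) - 1 :: int poly"
  have pos: "p ^ l > 0" "p ^ (l - 1) > 0" using assms(1) prime_gt_0_nat by auto
  have "lead_coeff (?C * ?Y) = 1"
    using monom_minus_one_monic(2)[OF pos(1)] prime_power_cyclotomic_mult[OF assms(2)] by simp
  thus l1: "lead_coeff ?C = 1"
    using monom_minus_one_monic(2)[OF pos(2)] by (simp only: lead_coeff_mult)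
  hence nz: "?C \<noteq> 0" by auto
  have "degree (?C * ?Y) = p ^ l"
    using monom_minus_one_monic(1)[OF pos(1)] prime_power_cyclotomic_mult[OF assms(2)] by simp
  moreover have "?Y \<noteq> 0" using monom_minus_one_monic(2)[OF pos(2)] by (metis coeff_0 zero_neq_one)
  ultimately show "degree ?C = p ^ l - p ^ (l - 1)"
    using nz monom_minus_one_monic(1)[OF pos(2)] by (simp add: degree_mult_eq)
qed

lemma poly_prime_power_cyclotomic_1: "poly (prime_power_cyclotomic p l) 1 = int p"
  by (simp add: prime_power_cyclotomic_def poly_sum poly_monom)

section \<open>Roots of unity of prime power order\<close>

definition zeta :: "nat \<Rightarrow> nat \<Rightarrow> complex" where
  "zeta p l = cis (2 * pi / real (p ^ l))"

lemma zeta_0 [simp]: "zeta p 0 = 1"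
  by (simp add: zeta_def cis_multiple_2pi[of 1, simplified])

lemma zeta_power_eq_1_iff:
  assumes "p > 0"
  shows "zeta p l ^ k = 1 \<longleftrightarrow> p ^ l dvd k"
proof
  have P: "real (p ^ l) > 0" using assms by simp
  have e: "zeta p l ^ k = cis (2 * pi * real k / real (p ^ l))"
    by (simp add: zeta_def Complex.DeMoivre mult_ac)
  assume "zeta p l ^ k = 1"
  hence "cos (2 * pi * real k / real (p ^ l)) = 1" unfolding e by (metis cis.sel(1) one_complex.sel(1))
  then obtain j :: int where "2 * pi * real k / real (p ^ l) = real_of_int j * 2 * pi"
    using cos_one_2pi_int by auto
  hence "2 * pi * real k = 2 * pi * (real_of_int j * real (p ^ l))" using P by (simp add: field_simps del: of_nat_power)
  hence "real k = real_of_int j * real (p ^ l)" by simp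
  hence "int k = j * int (p ^ l)" by (metis of_int_eq_iff of_int_mult of_int_of_nat_eq)
  thus "p ^ l dvd k" by (metis dvd_triv_right int_dvd_int_iff)
next
  assume "p ^ l dvd k"
  then obtain j where j: "k = p ^ l * j" by (elim dvdE)
  have "zeta p l ^ (p ^ l) = cis (2 * pi)" using assms unfolding zeta_def Complex.DeMoivre by simp
  hence "zeta p l ^ (p ^ l) = 1" by (simp add: cis_multiple_2pi[of 1, simplified])
  thus "zeta p l ^ k = 1" unfolding j by (simp add: power_mult)
qed

lemma zeta_power_cong:
  assumes "p > 0" "[i = j] (mod p ^ l)"
  shows "zeta p l ^ i = zeta p l ^ j"
proof -
  have *: "zeta p l ^ i = zeta p l ^ j" if "i \<le> j" "[i = j] (mod p ^ l)" for i j
  proof -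
    have "p ^ l dvd j - i" using that by (metis cong_altdef_nat cong_sym)
    hence "zeta p l ^ (j - i) = 1" using zeta_power_eq_1_iff[OF assms(1)] by simp
    thus ?thesis using that(1) by (metis le_add_diff_inverse mult.right_neutral power_add)
  qed
  show ?thesis using *[of i j] *[of j i] assms(2) cong_sym by (metis nat_le_linear)
qed

lemma zeta_power_power:
  assumes "l \<le> k" "p > 0"
  shows "zeta p k ^ (p ^ (k - l)) = zeta p l"
proof -
  have "real (p ^ k) = real (p ^ (k - l)) * real (p ^ l)" using assms(1) by (simp flip: of_nat_mult power_add)
  thus ?thesis using assms(2) by (simp add: zeta_def Complex.DeMoivre field_simps)
qed

lemma map_poly_of_int_simps:
  fixes P Q :: "int poly"
  shows "map_poly of_int (P + Q) = (map_poly of_int P + map_poly of_int Q :: 'a :: comm_ring_1 poly)"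
    and "map_poly of_int (P - Q) = (map_poly of_int P - map_poly of_int Q :: 'a :: comm_ring_1 poly)"
    and "map_poly of_int (P * Q) = (map_poly of_int P * map_poly of_int Q :: 'a :: comm_ring_1 poly)"
    and "map_poly of_int (smult c P) = (smult (of_int c) (map_poly of_int P) :: 'a :: comm_ring_1 poly)"
  by (simp_all add: poly_eq_iff coeff_map_poly coeff_mult)

lemma map_poly_of_rat_simps:
  fixes P Q :: "rat poly"
  shows "map_poly of_rat (P + Q) = (map_poly of_rat P + map_poly of_rat Q :: 'a :: field_char_0 poly)"
    and "map_poly of_rat (P * Q) = (map_poly of_rat P * map_poly of_rat Q :: 'a :: field_char_0 poly)"
    and "map_poly of_rat (smult c P) = (smult (of_rat c) (map_poly of_rat P) :: 'a :: field_char_0 poly)"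
  by (simp_all add: poly_eq_iff coeff_map_poly coeff_mult of_rat_add of_rat_mult of_rat_sum)

lemma prime_power_cyclotomic_root:
  assumes "prime p" "l \<ge> 1" "\<not> p dvd u"
  shows "poly (map_poly of_int (prime_power_cyclotomic p l)) (zeta p l ^ u) = 0"
proof -
  let ?z = "zeta p l ^ u"
  have p0: "p > 0" using assms(1) prime_gt_0_nat by blast
  have "poly (map_poly of_int (prime_power_cyclotomic p l)) ?z * (?z ^ (p ^ (l - 1)) - 1)
      = poly (map_poly of_int (prime_power_cyclotomic p l * (monom 1 (p ^ (l - 1)) - 1))) ?z"
    by (simp add: map_poly_of_int_simps poly_monom map_poly_monom map_poly_1)
  also have "\<dots> = ?z ^ (p ^ l) - 1"
    unfolding prime_power_cyclotomic_mult[OF assms(2)] by (simp add: map_poly_of_int_simps poly_monom map_poly_monom map_poly_1)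
  also have "\<dots> = 0" using zeta_power_eq_1_iff[OF p0, of l "u * p ^ l"] by (simp add: power_mult)
  finally have *: "poly (map_poly of_int (prime_power_cyclotomic p l)) ?z = 0 \<or> ?z ^ (p ^ (l - 1)) = 1" by simp
  moreover have "?z ^ (p ^ (l - 1)) \<noteq> 1"
  proof
    assume "?z ^ (p ^ (l - 1)) = 1"
    hence "p ^ l dvd u * p ^ (l - 1)" using zeta_power_eq_1_iff[OF p0, of l "u * p ^ (l - 1)"] by (simp add: power_mult)
    moreover have "p ^ l = p * p ^ (l - 1)" using assms(2) by (simp flip: power_Suc)
    ultimately have "p dvd u" using p0 by simp
    thus False using assms(3) by simp
  qed
  ultimately show ?thesis by blast
qed

text \<open>Irreducibility in disguise. A least-degree annihilator, made primitive and monic, is a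
  factor \<open>P\<close> of the cyclotomic polynomial \<open>P * R\<close> over Z. As P(1) R(1) =
  p, only one factor can vanish at 1 modulo \<open>p\<close>, and
  \<open>degree_zero_if_coprime_at_one\<close> makes the other constant.\<close>

lemma zeta_annihilator_degree_aux:
  fixes q :: "int poly"
  assumes "prime p" "l \<ge> 1" "q \<noteq> 0" "odd p" "poly (map_poly of_int q) (zeta p l) = 0"
    and min: "\<And>q' :: int poly. q' \<noteq> 0 \<Longrightarrow> poly (map_poly of_int q') (zeta p l) = 0 \<Longrightarrow> degree q \<le> degree q'"
  shows "degree q = p ^ l - p ^ (l - 1)"
proof -
  let ?C = "prime_power_cyclotomic p l"
  have C1: "lead_coeff ?C = 1" and dC: "degree ?C = p ^ l - p ^ (l - 1)"
    using prime_power_cyclotomic_monic[OF assms(1,2)] by auto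
  have p1: "\<not> p dvd 1" using assms(1) not_prime_1 by fastforce
  have Cz: "poly (map_poly of_int ?C) (zeta p l) = 0"
    using prime_power_cyclotomic_root[OF assms(1,2) p1] by simp
  define q0 where "q0 = primitive_part q"
  have q0: "q0 \<noteq> 0" "content q0 = 1" "degree q0 = degree q"
    using assms(3) by (auto simp: q0_def)
  have "q = smult (content q) q0" by (simp add: q0_def)
  hence "poly (map_poly of_int (smult (content q) q0)) (zeta p l) = 0" using assms(5) by simp
  hence q0z: "poly (map_poly of_int q0) (zeta p l) = 0"
    using assms(3) by (simp add: map_poly_of_int_simps)
  \<comment> \<open>Pseudo-division stays over Z. The remainder annihilates the root of unity and
    has degree below that of \<open>q0\<close>, so it vanishes by minimality.\<close>
  obtain a h where ah: "a \<noteq> 0" "smult a ?C = q0 * h + pseudo_mod ?C q0"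
    using pseudo_mod(1)[OF q0(1), of ?C] by blast
  have "poly (map_poly of_int (smult a ?C)) (zeta p l) = 0" using Cz by (simp add: map_poly_of_int_simps)
  hence "poly (map_poly of_int (pseudo_mod ?C q0)) (zeta p l) = 0"
    unfolding ah(2) by (simp add: map_poly_of_int_simps q0z)
  hence "pseudo_mod ?C q0 = 0" using pseudo_mod(2)[OF q0(1), of ?C] min q0(3) by fastforce
  hence aq: "smult a ?C = q0 * h" using ah by simp
  \<comment> \<open>Gauss's lemma: both \<open>?C\<close> and \<open>q0\<close> are primitive, so
    \<open>h\<close> has content |a| and the factor \<open>a\<close> cancels.\<close>
  have "content ?C = 1" 
    using content_dvd_coeff[of ?C "degree ?C"] C1 by (simp add: zdvd1_eq) (metis abs_of_nonneg normalize_content normalize_int_def abs_ge_zero)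
  hence "normalize a = content h" using arg_cong[OF aq, of content] by (simp add: content_mult q0(2))
  hence hc: "content h = \<bar>a\<bar>" by simp
  define h' where "h' = smult (sgn a) (primitive_part h)"
  have "h = smult (content h) (primitive_part h)" by simp
  hence "h = smult a h'" using hc ah(1) by (metis h'_def abs_mult_sgn mult.commute smult_smult abs_sgn)
  hence "smult a ?C = smult a (q0 * h')" using aq by simp
  hence Ch: "?C = q0 * h'" by (metis ah(1) smult_cancel)
  \<comment> \<open>\<open>e\<close> and the leading coefficient of \<open>h'\<close> multiply to 1,
    so both equal the same sign; scaling by it makes both factors monic.\<close>
  define e where "e = lead_coeff q0"
  have e1: "e * lead_coeff h' = 1" using C1 unfolding Ch e_def by (simp add: lead_coeff_mult)
  hence ee: "e * e = 1" "lead_coeff h' = e" by (auto simp: zmult_eq_1_iff)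
  define P where "P = smult e q0" 
  define R where "R = smult e h'"
  have PR: "?C = P * R" unfolding Ch P_def R_def using ee(1) by (simp add: mult.assoc[symmetric])
  have lP: "lead_coeff P = 1" "lead_coeff R = 1" unfolding P_def R_def using ee by (auto simp: e_def)
  let ?Y = "monom 1 (p ^ (l - 1)) - 1 :: int poly"
  have Y1: "lead_coeff ?Y = 1" using monom_minus_one_monic(2)[of "p ^ (l - 1)"] assms(1) prime_gt_0_nat by simp
  have PRY: "P * R * ?Y = monom 1 (p ^ l) - 1" using prime_power_cyclotomic_mult[OF assms(2), of p] PR by simp
  have pp: "prime (int p)" using assms(1) by simp
  show ?thesis
  proof -
    have D: "[:int p:] dvd P * R * ?Y - [:-1, 1:] ^ (p ^ l)"
      unfolding PRY by (rule const_dvd_X_minus_one_power[OF assms(1) \<open>odd p\<close>])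
    have "poly P 1 * poly R 1 = int p" using poly_prime_power_cyclotomic_1[of p l] PR by simp
    hence PR1: "int p = poly P 1 * poly R 1" by simp
    have "\<not> (int p dvd poly P 1 \<and> int p dvd poly R 1)"
    proof
      assume "int p dvd poly P 1 \<and> int p dvd poly R 1"
      hence "int p * int p dvd int p" by (subst (3) PR1) (simp add: mult_dvd_mono)
      hence "is_unit (int p)" using prime_gt_0_nat[OF assms(1)] dvd_mult_cancel_left[of "int p" "int p" 1] by simp
      thus False using pp not_prime_unit by blast
    qed
    \<comment> \<open>A constant monic \<open>P\<close> would be 1, which annihilates nothing. Hence
      \<open>p\<close> divides P(1), and \<open>R\<close> is the factor that must be
      constant.\<close>
    moreover have "degree P \<noteq> 0"
    proof
      assume "degree P = 0"
      hence "P = 1" using lP(1) by (metis degree_0_id one_pCons)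
      hence "poly (map_poly of_int P) (zeta p l) = 1" by (simp add: map_poly_1)
      thus False using q0z by (simp add: P_def map_poly_of_int_simps)
    qed
    hence "int p dvd poly P 1"
      using degree_zero_if_coprime_at_one[OF pp lP(1), of "R * ?Y" "p ^ l"] D lP(2) Y1
      by (auto simp: mult.assoc lead_coeff_mult)
    ultimately have "\<not> int p dvd poly R 1" by blast
    hence "degree R = 0"
      using degree_zero_if_coprime_at_one[OF pp lP(2), of "P * ?Y" "p ^ l"] D lP(1) Y1
      by (auto simp: ac_simps lead_coeff_mult)
    moreover have "P \<noteq> 0" "R \<noteq> 0" using lP by auto
    ultimately have "degree ?C = degree P" unfolding PR by (simp add: degree_mult_eq)
    also have "degree P = degree q" using ee(1) q0(3) by (auto simp: P_def)
    finally show ?thesis using dC by simp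
  qed
qed


lemma zeta_annihilator_degree:
  fixes q :: "int poly"
  assumes "prime p" "odd p" "l \<ge> 1" "q \<noteq> 0" "poly (map_poly of_int q) (zeta p l) = 0"
  shows "p ^ l - p ^ (l - 1) \<le> degree q"
proof -
  define A where "A = (\<lambda>q :: int poly. q \<noteq> 0 \<and> poly (map_poly of_int q) (zeta p l) = 0)"
  obtain q' where q': "A q'" "\<And>q''. A q'' \<Longrightarrow> degree q' \<le> degree q''"
    using ex_has_least_nat[of A q degree] assms(4,5) unfolding A_def by blast
  have "degree q' = p ^ l - p ^ (l - 1)"
    using zeta_annihilator_degree_aux[OF assms(1,3) _ assms(2)] q' unfolding A_def by blast
  thus ?thesis using q'(2)[of q] assms(4,5) unfolding A_def by simp
qed

section \<open>Conjugation and degree over the rationals\<close>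

lemma rat_poly_clear_denominators:
  fixes q :: "rat poly"
  shows "\<exists>d Q. d \<noteq> 0 \<and> smult (of_int d) q = map_poly of_int (Q :: int poly)"
proof (induction q)
  case 0
  show ?case by (rule exI[of _ 1], rule exI[of _ 0]) simp
next
  case (pCons a q)
  then obtain d Q where dQ: "d \<noteq> 0" "smult (of_int d) q = map_poly of_int (Q :: int poly)" by blast
  obtain x y where xy: "quotient_of a = (x, y)" by fastforce
  hence y: "y > 0" "a = of_int x / of_int y" using quotient_of_denom_pos quotient_of_div by blast+
  have "smult (of_int (y * d)) (pCons a q) = map_poly of_int (pCons (d * x) (smult y Q))"
    using y dQ(2)[symmetric] by (simp add: map_poly_pCons map_poly_of_int_simps)
  moreover have "y * d \<noteq> 0" using y dQ by simp
  ultimately show ?case by blast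
qed

lemma poly_map_poly_of_rat_of_int:
  "map_poly of_rat (map_poly of_int Q) = (map_poly of_int Q :: 'a :: field_char_0 poly)"
  by (simp add: poly_eq_iff coeff_map_poly)

text \<open>The remainder modulo the cyclotomic polynomial is again an annihilator; if nonzero, it
  would after clearing denominators violate the bound
  \<open>zeta_annihilator_degree\<close>.\<close>

lemma zeta_annihilator_dvd:
  fixes q :: "rat poly"
  assumes "prime p" "odd p" "l \<ge> 1" "poly (map_poly of_rat q) (zeta p l) = 0"
  shows "map_poly of_int (prime_power_cyclotomic p l) dvd q"
proof -
  let ?C = "map_poly of_int (prime_power_cyclotomic p l) :: rat poly"
  define r where "r = q mod ?C"
  have p1: "\<not> p dvd 1" using assms(1) not_prime_1 by fastforce
  have Cz: "poly (map_poly of_rat ?C) (zeta p l) = 0"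
    using prime_power_cyclotomic_root[OF assms(1,3) p1] by (simp add: poly_map_poly_of_rat_of_int)
  have "q = ?C * (q div ?C) + r" by (simp add: r_def)
  hence "poly (map_poly of_rat (?C * (q div ?C) + r)) (zeta p l) = 0" using assms(4) by simp
  hence rz: "poly (map_poly of_rat r) (zeta p l) = 0" by (simp add: map_poly_of_rat_simps Cz)
  have "coeff ?C (degree (prime_power_cyclotomic p l)) = 1"
    using prime_power_cyclotomic_monic(1)[OF assms(1,3)] by (simp add: coeff_map_poly)
  hence C0: "?C \<noteq> 0" by (metis coeff_0 zero_neq_one)
  have "r = 0"
  proof (rule ccontr)
    assume r0: "r \<noteq> 0"
    obtain d Q where dQ: "d \<noteq> 0" "smult (of_int d) r = map_poly of_int (Q :: int poly)"
      using rat_poly_clear_denominators by blast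
    have "poly (map_poly of_rat (smult (of_int d) r)) (zeta p l) = 0" using rz by (simp add: map_poly_of_rat_simps)
    hence Qz: "poly (map_poly of_int Q) (zeta p l) = 0" unfolding dQ(2) poly_map_poly_of_rat_of_int .
    have "degree Q = degree (map_poly of_int Q :: rat poly)" by (simp add: degree_map_poly)
    hence dr: "degree Q = degree r" using dQ by (metis degree_smult_eq of_int_eq_0_iff)
    have "Q \<noteq> 0" using dQ r0 by auto
    hence "p ^ l - p ^ (l - 1) \<le> degree r" using zeta_annihilator_degree[OF assms(1-3) _ Qz] dr by simp
    moreover have "degree r < degree ?C" using degree_mod_less'[OF C0, of q] r0 by (simp add: r_def)
    moreover have "degree ?C = p ^ l - p ^ (l - 1)"
      using prime_power_cyclotomic_monic(2)[OF assms(1,3)] by (simp add: degree_map_poly)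
    ultimately show False by simp
  qed
  thus ?thesis by (simp add: r_def mod_eq_0_iff_dvd)
qed

text \<open>Stands in for the automorphism sending \<open>zeta p l\<close> to its
  \<open>u\<close>-th power: an annihilator is a multiple of the cyclotomic polynomial, which has
  the conjugate as a root too.\<close>

lemma zeta_conjugate:
  fixes q :: "rat poly"
  assumes "prime p" "odd p" "\<not> p dvd u" "poly (map_poly of_rat q) (zeta p l) = 0"
  shows "poly (map_poly of_rat q) (zeta p l ^ u) = 0"
proof (cases "l = 0")
  case True
  thus ?thesis using assms by simp
next
  case False
  hence l: "l \<ge> 1" by simp
  obtain h where h: "q = map_poly of_int (prime_power_cyclotomic p l) * h"
    using zeta_annihilator_dvd[OF assms(1,2) l assms(4)] by (elim dvdE)
  show ?thesis
    unfolding h map_poly_of_rat_simps poly_map_poly_of_rat_of_int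
    using prime_power_cyclotomic_root[OF assms(1) l assms(3)] by simp
qed

text \<open>Euler's totient of \<open>p ^ l\<close>; at \<open>l = 0\<close> truncated subtraction
  would give 0 instead of 1.\<close>

definition zeta_degree :: "nat \<Rightarrow> nat \<Rightarrow> nat" where
  "zeta_degree p l = (if l = 0 then 1 else p ^ l - p ^ (l - 1))"

lemma cyclotomic_field_carrier:
  "carrier (cyclotomic_field (p ^ l)) = {poly (map_poly of_rat q) (zeta p l) | q. True}"
  by (simp add: cyclotomic_field_def zeta_def)

text \<open>Reduction modulo the minimal polynomial. Spanning gives an upper bound on the dimension
  of the target, which is the direction that the surjectivity argument consumes.\<close>

lemma cyclotomic_field_span:
  assumes "prime p" "z \<in> carrier (cyclotomic_field (p ^ l))"
  shows "\<exists>c. z = (\<Sum>i<zeta_degree p l. of_rat (c i) * zeta p l ^ i)"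
proof -
  obtain q where q: "z = poly (map_poly of_rat q) (zeta p l)"
    using assms(2) by (auto simp: cyclotomic_field_carrier)
  define C where "C = (if l = 0 then [:-1, 1:] else map_poly of_int (prime_power_cyclotomic p l) :: rat poly)"
  have p1: "\<not> p dvd 1" using assms(1) not_prime_1 by fastforce
  have Cz: "poly (map_poly of_rat C) (zeta p l) = 0"
    using prime_power_cyclotomic_root[OF assms(1) _ p1]
    by (simp add: C_def poly_map_poly_of_rat_of_int map_poly_pCons)
  have dC: "degree C = zeta_degree p l"
    using prime_power_cyclotomic_monic(2)[OF assms(1)] by (simp add: C_def zeta_degree_def degree_map_poly)
  have "zeta_degree p l > 0"
    using prime_gt_1_nat[OF assms(1)] by (simp add: zeta_degree_def power_strict_increasing)
  hence C0: "C \<noteq> 0" using dC by auto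
  have "q = C * (q div C) + q mod C" by simp
  hence "z = poly (map_poly of_rat (C * (q div C) + q mod C)) (zeta p l)" using q by simp
  hence z: "z = poly (map_poly of_rat (q mod C)) (zeta p l)" by (simp only: map_poly_of_rat_simps poly_add poly_mult Cz) simp
  have d: "degree (q mod C) < zeta_degree p l"
    using degree_mod_less[OF C0, of q] dC \<open>zeta_degree p l > 0\<close> by auto
  have "z = (\<Sum>i\<le>degree (q mod C). of_rat (coeff (q mod C) i) * zeta p l ^ i)"
    unfolding z by (simp add: poly_altdef degree_map_poly coeff_map_poly)
  also have "\<dots> = (\<Sum>i<zeta_degree p l. of_rat (coeff (q mod C) i) * zeta p l ^ i)"
    using d by (intro sum.mono_neutral_left) (auto simp: coeff_eq_0)
  finally show ?thesis by blast
qed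

lemma zeta_rational_combination_conjugate:
  fixes f :: "'i \<Rightarrow> rat" and e :: "'i \<Rightarrow> nat"
  assumes "prime p" "odd p" "\<not> p dvd u" "finite I"
    and "(\<Sum>i\<in>I. of_rat (f i) * zeta p l ^ e i) = 0"
  shows "(\<Sum>i\<in>I. of_rat (f i) * zeta p l ^ (e i * u)) = 0"
proof -
  define q where "q = (\<Sum>i\<in>I. monom (f i) (e i))"
  have q: "poly (map_poly of_rat q) z = (\<Sum>i\<in>I. of_rat (f i) * z ^ e i)" for z :: complex
    using assms(4) unfolding q_def
    by (induction I rule: finite_induct) (simp_all add: map_poly_of_rat_simps map_poly_monom poly_monom)
  show ?thesis using zeta_conjugate[OF assms(1-3), of q l] assms(5)
    by (simp add: q power_mult[symmetric] mult.commute)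
qed

lemma cyclotomic_field_closed:
  shows "of_rat x \<in> carrier (cyclotomic_field d)"
    and "\<lbrakk>z \<in> carrier (cyclotomic_field d); w \<in> carrier (cyclotomic_field d)\<rbrakk> \<Longrightarrow> z + w \<in> carrier (cyclotomic_field d)"
    and "\<lbrakk>z \<in> carrier (cyclotomic_field d); w \<in> carrier (cyclotomic_field d)\<rbrakk> \<Longrightarrow> z * w \<in> carrier (cyclotomic_field d)"
proof -
  show "of_rat x \<in> carrier (cyclotomic_field d)"
    by (auto simp: cyclotomic_field_def intro!: exI[of _ "[:x:]"] simp: map_poly_pCons)
  show "z + w \<in> carrier (cyclotomic_field d)" "z * w \<in> carrier (cyclotomic_field d)"
    if "z \<in> carrier (cyclotomic_field d)" "w \<in> carrier (cyclotomic_field d)" for z w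
    using that by (auto simp: cyclotomic_field_def) (metis map_poly_of_rat_simps(1,2) poly_add poly_mult)+
qed

lemma zeta_in_cyclotomic_field: "zeta p l \<in> carrier (cyclotomic_field (p ^ l))"
  unfolding cyclotomic_field_carrier
  by (auto intro!: exI[of _ "[:0, 1:]"] simp: map_poly_pCons)

section \<open>Matrix rings over cyclotomic fields\<close>

lemma cyclotomic_field_simps [simp]:
  "x \<otimes>\<^bsub>cyclotomic_field d\<^esub> y = x * y" "x \<oplus>\<^bsub>cyclotomic_field d\<^esub> y = x + y"
  "\<zero>\<^bsub>cyclotomic_field d\<^esub> = 0" "\<one>\<^bsub>cyclotomic_field d\<^esub> = 1"
  by (simp_all add: cyclotomic_field_def)

lemma cyclotomic_field_0_1 [simp]: "0 \<in> carrier (cyclotomic_field d)" "1 \<in> carrier (cyclotomic_field d)"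
  using cyclotomic_field_closed(1)[of 0 d] cyclotomic_field_closed(1)[of 1 d] by simp_all

lemma cyclotomic_field_power:
  "z \<in> carrier (cyclotomic_field d) \<Longrightarrow> z ^ k \<in> carrier (cyclotomic_field d)"
  by (induction k) (auto intro: cyclotomic_field_closed)

lemma cyclotomic_field_sum:
  "(\<And>x. x \<in> A \<Longrightarrow> f x \<in> carrier (cyclotomic_field d)) \<Longrightarrow> sum f A \<in> carrier (cyclotomic_field d)"
  by (induction A rule: infinite_finite_induct) (auto intro: cyclotomic_field_closed)

lemma abelian_monoid_cyclotomic_field: "abelian_monoid (cyclotomic_field d)"
  by (rule abelian_monoidI) (auto intro: cyclotomic_field_closed)

lemma finsum_cyclotomic_field:
  assumes "finite A" "\<And>x. x \<in> A \<Longrightarrow> f x \<in> carrier (cyclotomic_field d)"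
  shows "finsum (cyclotomic_field d) f A = sum f A"
proof -
  interpret abelian_monoid "cyclotomic_field d" by (rule abelian_monoid_cyclotomic_field)
  show ?thesis using assms
    by (induction A rule: finite_induct) (auto simp: finsum_insert Pi_def)
qed

abbreviation cyclo_mat :: "nat \<Rightarrow> nat \<Rightarrow> (nat \<Rightarrow> nat \<Rightarrow> complex) ring" where
  "cyclo_mat q d \<equiv> matrix_ring q (cyclotomic_field d)"

lemma cyclo_mat_carrier:
  "A \<in> carrier (cyclo_mat q d) \<longleftrightarrow>
     (\<forall>i j. (i < q \<and> j < q \<longrightarrow> A i j \<in> carrier (cyclotomic_field d)) \<and> (\<not> (i < q \<and> j < q) \<longrightarrow> A i j = 0))"
  by (simp add: matrix_ring_def)

lemma cyclo_mat_entry: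
  "A \<in> carrier (cyclo_mat q d) \<Longrightarrow> A i j \<in> carrier (cyclotomic_field d)"
  by (cases "i < q \<and> j < q") (auto simp: cyclo_mat_carrier)

lemma cyclo_mat_mult:
  assumes "A \<in> carrier (cyclo_mat q d)" "B \<in> carrier (cyclo_mat q d)"
  shows "A \<otimes>\<^bsub>cyclo_mat q d\<^esub> B = (\<lambda>i j. if i < q \<and> j < q then \<Sum>k<q. A i k * B k j else 0)"
proof -
  have "(\<Oplus>\<^bsub>cyclotomic_field d\<^esub>k\<in>{..<q}. A i k * B k j) = (\<Sum>k<q. A i k * B k j)" for i j
    using assms by (intro finsum_cyclotomic_field) (auto intro!: cyclotomic_field_closed(3) intro: cyclo_mat_entry[of _ q])
  thus ?thesis by (simp add: matrix_ring_def fun_eq_iff)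
qed

definition scalar_mat :: "nat \<Rightarrow> complex \<Rightarrow> nat \<Rightarrow> nat \<Rightarrow> complex" where
  "scalar_mat q c = (\<lambda>i j. if i < q \<and> i = j then c else 0)"

lemma cyclo_mat_one: "\<one>\<^bsub>cyclo_mat q d\<^esub> = scalar_mat q 1"
  by (auto simp: matrix_ring_def scalar_mat_def fun_eq_iff)

lemma scalar_mat_carrier:
  "c \<in> carrier (cyclotomic_field d) \<Longrightarrow> scalar_mat q c \<in> carrier (cyclo_mat q d)"
  by (auto simp: cyclo_mat_carrier scalar_mat_def)

lemma scalar_mat_mult:
  assumes "A \<in> carrier (cyclo_mat q d)" "c \<in> carrier (cyclotomic_field d)"
  shows "scalar_mat q c \<otimes>\<^bsub>cyclo_mat q d\<^esub> A = (\<lambda>i j. c * A i j)"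
    and "A \<otimes>\<^bsub>cyclo_mat q d\<^esub> scalar_mat q c = (\<lambda>i j. c * A i j)"
proof -
  have 1: "(\<Sum>k<q. (if i < q \<and> i = k then c else 0) * A k j) = c * A i j" if "i < q" for i j
    using that by (simp add: if_distrib[of "\<lambda>x. x * _"] cong: if_cong)
  have 2: "(\<Sum>k<q. A i k * (if k < q \<and> k = j then c else 0)) = c * A i j" if "j < q" for i j
  proof -
    have "(\<Sum>k<q. A i k * (if k < q \<and> k = j then c else 0)) = (\<Sum>k<q. if k = j then A i k * c else 0)"
      by (intro sum.cong) auto
    thus ?thesis using that by simp
  qed
  show "scalar_mat q c \<otimes>\<^bsub>cyclo_mat q d\<^esub> A = (\<lambda>i j. c * A i j)"
    unfolding cyclo_mat_mult[OF scalar_mat_carrier[OF assms(2)] assms(1)]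
    using assms(1) 1 by (auto simp: scalar_mat_def fun_eq_iff cyclo_mat_carrier)
  show "A \<otimes>\<^bsub>cyclo_mat q d\<^esub> scalar_mat q c = (\<lambda>i j. c * A i j)"
    unfolding cyclo_mat_mult[OF assms(1) scalar_mat_carrier[OF assms(2)]]
    using assms(1) 2 by (auto simp: scalar_mat_def fun_eq_iff cyclo_mat_carrier)
qed

lemma monoid_cyclo_mat: "monoid (cyclo_mat q d)"
proof (rule monoidI)
  fix A B C assume A: "A \<in> carrier (cyclo_mat q d)" and B: "B \<in> carrier (cyclo_mat q d)"
    and C: "C \<in> carrier (cyclo_mat q d)"
  have cl: "A \<otimes>\<^bsub>cyclo_mat q d\<^esub> B \<in> carrier (cyclo_mat q d)"
    if "A \<in> carrier (cyclo_mat q d)" "B \<in> carrier (cyclo_mat q d)" for A B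
    unfolding cyclo_mat_mult[OF that] using that
    by (auto simp: cyclo_mat_carrier intro!: cyclotomic_field_sum cyclotomic_field_closed)
  show "A \<otimes>\<^bsub>cyclo_mat q d\<^esub> B \<in> carrier (cyclo_mat q d)" using cl A B by blast
  have "(\<Sum>k<q. (\<Sum>l<q. A i l * B l k) * C k j) = (\<Sum>l<q. A i l * (\<Sum>k<q. B l k * C k j))" for i j
    by (subst sum_distrib_right, subst sum.swap, simp add: sum_distrib_left mult.assoc)
  thus "A \<otimes>\<^bsub>cyclo_mat q d\<^esub> B \<otimes>\<^bsub>cyclo_mat q d\<^esub> C = A \<otimes>\<^bsub>cyclo_mat q d\<^esub> (B \<otimes>\<^bsub>cyclo_mat q d\<^esub> C)"
    unfolding cyclo_mat_mult[OF cl[OF A B] C] cyclo_mat_mult[OF A cl[OF B C]]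
    unfolding cyclo_mat_mult[OF A B] cyclo_mat_mult[OF B C] by (auto simp: fun_eq_iff)
qed (auto simp: cyclo_mat_one scalar_mat_mult scalar_mat_carrier)

lemma scalar_mat_power:
  assumes "c \<in> carrier (cyclotomic_field d)"
  shows "scalar_mat q c [^]\<^bsub>cyclo_mat q d\<^esub> (k :: nat) = scalar_mat q (c ^ k)"
proof -
  interpret monoid "cyclo_mat q d" by (rule monoid_cyclo_mat)
  have "scalar_mat q a \<otimes>\<^bsub>cyclo_mat q d\<^esub> scalar_mat q c = scalar_mat q (a * c)"
    if "a \<in> carrier (cyclotomic_field d)" for a
    using that assms by (simp add: scalar_mat_mult scalar_mat_carrier) (auto simp: scalar_mat_def fun_eq_iff)
  thus ?thesis
    using assms by (induction k) (simp_all add: cyclo_mat_one cyclotomic_field_power mult.commute)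
qed

definition mat_trace :: "nat \<Rightarrow> (nat \<Rightarrow> nat \<Rightarrow> complex) \<Rightarrow> complex" where
  "mat_trace q A = (\<Sum>i<q. A i i)"

lemma mat_trace_mult_commute:
  assumes "A \<in> carrier (cyclo_mat q d)" "B \<in> carrier (cyclo_mat q d)"
  shows "mat_trace q (A \<otimes>\<^bsub>cyclo_mat q d\<^esub> B) = mat_trace q (B \<otimes>\<^bsub>cyclo_mat q d\<^esub> A)"
  unfolding mat_trace_def cyclo_mat_mult[OF assms] cyclo_mat_mult[OF assms(2,1)]
  by (simp, subst sum.swap, simp add: mult.commute)

lemma mat_trace_scalar_mult:
  "mat_trace q (\<lambda>i j. c * A i j) = c * mat_trace q A"
  by (simp add: mat_trace_def sum_distrib_left)

lemma mat_trace_scalar_mat: "mat_trace q (scalar_mat q c) = of_nat q * c"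
  by (simp add: mat_trace_def scalar_mat_def)

section \<open>Lifting the exponent\<close>

text \<open>In x ^ p - 1 = (x - 1) (1 + x + ... + x ^ (p - 1)) the second factor is \<open>p\<close>
  modulo \<open>p ^ 2\<close>, so exactly one factor \<open>p\<close> is gained. To see this, expand
  each x ^ i to first order modulo \<open>p ^ 2\<close>.\<close>

lemma lift_exponent_prime:
  fixes x :: int
  assumes "prime p" "odd p" "e \<ge> 1" "x = 1 + int p ^ e * k" "\<not> int p dvd k"
  shows "\<exists>k'. x ^ p = 1 + int p ^ (e + 1) * k' \<and> \<not> int p dvd k'"
proof -
  let ?P = "int p"
  have p0: "?P > 0" using assms(1) prime_gt_0_nat by simp
  have e: "?P ^ e = ?P * ?P ^ (e - 1)" using assms(3) by (simp flip: power_Suc)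
  have "?P ^ 2 dvd x ^ i - (1 + int i * (?P ^ e * k))" for i
  proof (induction i)
    case 0
    show ?case by simp
  next
    case (Suc i)
    have "x ^ Suc i - (1 + int (Suc i) * (?P ^ e * k))
      = x * (x ^ i - (1 + int i * (?P ^ e * k))) + ?P ^ 2 * (int i * (?P ^ (e - 1) * k)^2)"
      unfolding assms(4) e by (simp add: algebra_simps power2_eq_square)
    thus ?case using Suc by simp
  qed
  hence "?P ^ 2 dvd (\<Sum>i<p. x ^ i - (1 + int i * (?P ^ e * k)))" by (intro dvd_sum) auto
  also have "(\<Sum>i<p. x ^ i - (1 + int i * (?P ^ e * k))) = (\<Sum>i<p. x ^ i) - (?P + (\<Sum>i<p. int i) * (?P ^ e * k))"
    by (simp add: sum_subtractf sum.distrib sum_distrib_right)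
  finally have 1: "?P ^ 2 dvd (\<Sum>i<p. x ^ i) - (?P + (\<Sum>i<p. int i) * (?P ^ e * k))" .
  \<comment> \<open>Oddness enters here: (p - 1) / 2 is an integer, so the sum of the indices is
    divisible by \<open>p\<close> and the linear term disappears modulo
    \<open>p ^ 2\<close>.\<close>
  have "2 * (\<Sum>i<q. int i) = int q * (int q - 1)" for q
    by (induction q) (auto simp: algebra_simps)
  hence "2 * (\<Sum>i<p. int i) = ?P * (?P - 1)" .
  moreover obtain c where "?P - 1 = 2 * c" using assms(2) by (elim oddE) simp
  ultimately have S: "(\<Sum>i<p. int i) = ?P * c" by simp
  have "?P ^ 2 dvd ?P ^ 2 * (c * ?P ^ (e - 1) * k)" by simp
  also have "?P ^ 2 * (c * ?P ^ (e - 1) * k) = (\<Sum>i<p. int i) * (?P ^ e * k)"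
    unfolding S e by (simp add: power2_eq_square)
  finally have "?P ^ 2 dvd ((\<Sum>i<p. x ^ i) - (?P + (\<Sum>i<p. int i) * (?P ^ e * k))) + (\<Sum>i<p. int i) * (?P ^ e * k)"
    using 1 by (rule dvd_add[rotated])
  hence "?P ^ 2 dvd (\<Sum>i<p. x ^ i) - ?P" by simp
  then obtain j where "(\<Sum>i<p. x ^ i) - ?P = ?P ^ 2 * j" by (elim dvdE)
  hence j: "(\<Sum>i<p. x ^ i) = ?P * (1 + ?P * j)" by (simp add: power2_eq_square algebra_simps)
  have "x ^ p - 1 = (x - 1) * (\<Sum>i<p. x ^ i)" by (rule power_diff_1_eq)
  hence "x ^ p = 1 + ?P ^ (e + 1) * (k * (1 + ?P * j))" unfolding j using assms(4) by (simp add: algebra_simps)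
  moreover have "\<not> ?P dvd k * (1 + ?P * j)"
  proof
    assume "?P dvd k * (1 + ?P * j)"
    hence "?P dvd 1 + ?P * j" using assms(1,5) by (simp add: prime_dvd_mult_iff)
    hence "?P dvd 1" using dvd_diff[of ?P "1 + ?P * j" "?P * j"] by simp
    thus False using assms(1) not_prime_unit[of ?P] by auto
  qed
  ultimately show ?thesis by blast
qed

lemma lift_exponent:
  fixes x :: int
  assumes "prime p" "odd p" "e \<ge> 1" "x = 1 + int p ^ e * k" "\<not> int p dvd k" "\<not> p dvd w"
  shows "\<exists>k'. x ^ (p ^ l * w) = 1 + int p ^ (e + l) * k' \<and> \<not> int p dvd k'"
proof -
  have "\<exists>k'. x ^ (p ^ l) = 1 + int p ^ (e + l) * k' \<and> \<not> int p dvd k'"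
  proof (induction l)
    case 0
    show ?case using assms by auto
  next
    case (Suc l)
    then obtain k' where k': "x ^ (p ^ l) = 1 + int p ^ (e + l) * k'" "\<not> int p dvd k'" by blast
    have "x ^ (p ^ Suc l) = (x ^ (p ^ l)) ^ p" by (simp add: power_mult[symmetric] mult.commute)
    thus ?case using lift_exponent_prime[OF assms(1,2) _ k'] assms(3) by simp
  qed
  then obtain k' where k': "x ^ (p ^ l) = 1 + int p ^ (e + l) * k'" "\<not> int p dvd k'" by blast
  \<comment> \<open>The part \<open>w\<close> of the exponent prime to \<open>p\<close> leaves the
    valuation unchanged: the cofactor 1 + y + ... + y ^ (w - 1) is \<open>w\<close> modulo
    \<open>p\<close>.\<close>
  define y where "y = x ^ (p ^ l)"
  have py: "int p dvd y - 1" using assms(3) k'(1) by (simp add: y_def)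
  have "int p dvd y ^ i - 1" for i using power_cong_dvd[OF py, of i] by simp
  hence "int p dvd (\<Sum>i<w. y ^ i - 1)" by (intro dvd_sum) auto
  hence 1: "int p dvd (\<Sum>i<w. y ^ i) - int w" by (simp add: sum_subtractf)
  have 2: "\<not> int p dvd (\<Sum>i<w. y ^ i)"
  proof
    assume "int p dvd (\<Sum>i<w. y ^ i)"
    hence "int p dvd (\<Sum>i<w. y ^ i) - ((\<Sum>i<w. y ^ i) - int w)" using 1 by (rule dvd_diff)
    thus False using assms(6) by simp
  qed
  have "y ^ w - 1 = (y - 1) * (\<Sum>i<w. y ^ i)" by (rule power_diff_1_eq)
  hence "x ^ (p ^ l * w) = 1 + int p ^ (e + l) * (k' * (\<Sum>i<w. y ^ i))"
    using k'(1) by (simp add: y_def power_mult)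
  moreover have "\<not> int p dvd k' * (\<Sum>i<w. y ^ i)"
    using assms(1) k'(2) 2 by (simp add: prime_dvd_mult_iff)
  ultimately show ?thesis by blast
qed

lemma nat_prime_decompose:
  assumes "prime p" "(w :: nat) > 0"
  obtains l w' where "w = p ^ l * w'" "\<not> p dvd w'"
  using multiplicity_decompose'[of w p] assms not_prime_unit by (metis neq0_conv)

text \<open>Frobenius gives x = 1 modulo \<open>p\<close> for the residue \<open>x\<close>. If x - 1
  has valuation \<open>e\<close>, then \<open>x ^ (p ^ l)\<close> is 1 modulo \<open>p ^ n\<close>
  exactly when \<open>n \<le> e + l\<close>; the least such \<open>l\<close> being \<open>s\<close>
  forces \<open>e = n - s\<close>.\<close>

lemma prime_power_order_exponent:
  fixes r :: int
  assumes "prime p" "odd p" "mult_order (int (p ^ n)) r = p ^ s" "1 \<le> s" "s \<le> n - 1" "coprime r (int (p ^ n))"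
  shows "\<exists>k. r mod int (p ^ n) = 1 + int p ^ (n - s) * k \<and> \<not> int p dvd k"
proof -
  let ?M = "int (p ^ n)"
  define x where "x = r mod ?M"
  have pp: "prime (int p)" using assms(1) by simp
  have p1: "p > 1" using assms(1) prime_gt_1_nat by blast
  have M1: "?M > 1" using p1 assms(4,5) by (simp add: one_less_power)
  have pM: "int p dvd ?M" using assms(4,5) by (cases n) auto
  let ?Q = "\<lambda>k. k > 0 \<and> r ^ k mod ?M = 1 mod ?M"
  have least: "(LEAST k. ?Q k) = p ^ s" using assms(3) by (simp add: mult_order_def)
  \<comment> \<open>\<open>mult_order\<close> is a \<open>LEAST\<close>, informative only once some
    exponent is known to qualify. The pigeonhole principle and coprimality supply one.\<close>
  have "\<exists>k. ?Q k"
  proof -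
    have "\<not> inj_on (\<lambda>k. r ^ k mod ?M) (UNIV :: nat set)"
    proof
      assume "inj_on (\<lambda>k. r ^ k mod ?M) (UNIV :: nat set)"
      moreover have "0 \<le> z mod ?M \<and> z mod ?M < ?M" for z
        using M1 pos_mod_sign[of ?M] pos_mod_bound[of ?M] by (metis less_trans zero_less_one)
      hence "(\<lambda>k. r ^ k mod ?M) ` (UNIV :: nat set) \<subseteq> {0..<?M}" by (intro image_subsetI) (simp only: atLeastLessThan_iff)
      ultimately have "finite (UNIV :: nat set)" by (metis finite_atLeastLessThan_int inj_on_finite)
      thus False by simp
    qed
    then obtain i j where ij: "i < j" "r ^ i mod ?M = r ^ j mod ?M"
      by (auto simp: inj_on_def) (metis nat_neq_iff)
    hence "[r ^ i * 1 = r ^ i * r ^ (j - i)] (mod ?M)" by (simp add: cong_def power_add[symmetric])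
    moreover have "coprime (r ^ i) ?M" using assms(6) by (rule coprime_power_left_iff[THEN iffD2, OF disjI1])
    ultimately have "[1 = r ^ (j - i)] (mod ?M)" using cong_mult_lcancel by blast
    thus ?thesis using ij by (intro exI[of _ "j - i"]) (auto simp: cong_def)
  qed
  hence ord: "?Q (p ^ s)" using LeastI_ex[of ?Q] least by simp
  have min: "\<not> ?Q k" if "k < p ^ s" for k using not_less_Least[of k ?Q] that least by simp
  have xr: "?M dvd x ^ k - 1 \<longleftrightarrow> r ^ k mod ?M = 1 mod ?M" for k
    by (metis mod_eq_dvd_iff power_mod x_def)
  have x0: "x \<ge> 0" unfolding x_def by (rule pos_mod_sign) (use M1 in linarith)
  have "int p dvd x ^ (p ^ s) - 1" using ord xr pM dvd_trans by blast
  moreover have "int p dvd (x ^ (p ^ s) - 1) - (x - 1) ^ (p ^ s)"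
  proof -
    obtain E where E: "(Polynomial.monom 1 (p ^ s) - 1) - [:-1, 1:] ^ (p ^ s) = [:int p:] * E"
      using const_dvd_X_minus_one_power[OF assms(1,2), of s] by (elim dvdE)
    have "poly ((Polynomial.monom 1 (p ^ s) - 1) - [:-1, 1:] ^ (p ^ s)) x = int p * poly E x"
      unfolding E by simp
    thus ?thesis by (simp add: poly_monom algebra_simps)
  qed
  ultimately have "int p dvd (x - 1) ^ (p ^ s)" by (metis dvd_diffD1 dvd_diff diff_diff_eq2 add_diff_cancel_left')
  hence px: "int p dvd x - 1" using prime_dvd_power pp by blast
  \<comment> \<open>Residue 1 would have order 1, but \<open>s\<close> is positive; so x - 1 is
    nonzero and has a valuation.\<close>
  have "x \<noteq> 1" 
  proof
    assume "x = 1"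
    hence "r ^ 1 mod ?M = 1 mod ?M" using M1 by (simp add: x_def)
    thus False using min[of 1] one_less_power[OF p1, of s] assms(4) by (auto simp del: of_nat_power)
  qed
  moreover have "x \<noteq> 0" using px p1 by auto
  ultimately have xm: "nat (x - 1) > 0" using x0 by simp
  obtain e c where ec: "nat (x - 1) = p ^ e * c" "\<not> p dvd c" using nat_prime_decompose[OF assms(1) xm] .
  have "int (nat (x - 1)) = x - 1" using xm by simp
  hence x: "x = 1 + int p ^ e * int c" using ec(1) by simp
  have nc: "\<not> int p dvd int c" using ec(2) by simp
  have e1: "e \<ge> 1"
  proof (rule ccontr)
    assume "\<not> e \<ge> 1"
    hence "e = 0" by simp
    hence "x - 1 = int c" using x by simp
    thus False using px nc by simp
  qed
  have np1: "\<not> p dvd 1" using p1 by auto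
  have val: "?M dvd x ^ (p ^ l) - 1 \<longleftrightarrow> n \<le> e + l" for l
  proof -
    obtain k' where k': "x ^ (p ^ l) = 1 + int p ^ (e + l) * k'" "\<not> int p dvd k'"
      using lift_exponent[OF assms(1,2) e1 x nc np1, of l] by auto
    show ?thesis
    proof
      assume "n \<le> e + l"
      hence "int p ^ n dvd int p ^ (e + l)" by (rule le_imp_power_dvd)
      thus "?M dvd x ^ (p ^ l) - 1" using k' by simp
    next
      assume d: "?M dvd x ^ (p ^ l) - 1"
      show "n \<le> e + l"
      proof (rule ccontr)
        assume "\<not> n \<le> e + l"
        hence "int p ^ Suc (e + l) dvd int p ^ n" by (intro le_imp_power_dvd) simp
        hence "int p ^ Suc (e + l) dvd int p ^ (e + l) * k'" using d k'(1) by (metis add_diff_cancel_left' dvd_trans of_nat_power)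
        hence "int p ^ (e + l) * int p dvd int p ^ (e + l) * k'" by (simp only: power_Suc mult.commute)
        moreover have "int p ^ (e + l) \<noteq> 0" using p1 by simp
        ultimately show False using k'(2) by (simp only: dvd_mult_cancel_left) simp
      qed
    qed
  qed
  have "n \<le> e + s" using val[of s] ord xr by blast
  moreover have "\<not> n \<le> e + (s - 1)"
    using val[of "s - 1"] min[of "p ^ (s - 1)"] xr[of "p ^ (s - 1)"] p1 assms(4) by (auto simp: power_strict_increasing)
  ultimately have "e = n - s" using assms(4) by linarith
  thus ?thesis using x nc unfolding x_def by blast
qed

section \<open>Split metacyclic groups\<close>

lemma (in monoid) twisted_power_commute:
  assumes "A \<in> carrier G" "B \<in> carrier G" "B \<otimes> A = A [^] (r :: nat) \<otimes> B"
  shows "B [^] (y :: nat) \<otimes> A [^] (x :: nat) = A [^] (x * r ^ y) \<otimes> B [^] y"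
proof -
  have 1: "B \<otimes> A [^] x = A [^] (x * r) \<otimes> B" for x :: nat
  proof (induction x)
    case 0
    show ?case using assms by simp
  next
    case (Suc x)
    have "B \<otimes> A [^] Suc x = (B \<otimes> A [^] x) \<otimes> A" using assms by (simp add: m_assoc)
    also have "\<dots> = A [^] (x * r) \<otimes> (B \<otimes> A)" using assms Suc by (simp add: m_assoc)
    also have "\<dots> = A [^] (Suc x * r) \<otimes> B"
      using assms by (simp add: m_assoc[symmetric] nat_pow_mult add.commute)
    finally show ?case .
  qed
  show ?thesis
  proof (induction y)
    case 0
    show ?case using assms by simp
  next
    case (Suc y)
    have "B [^] Suc y \<otimes> A [^] x = B \<otimes> B [^] y \<otimes> A [^] x" by (simp only: nat_pow_Suc2[OF assms(2)])
    also have "B \<otimes> B [^] y \<otimes> A [^] x = (B \<otimes> A [^] (x * r ^ y)) \<otimes> B [^] y" using assms Suc by (simp add: m_assoc)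
    also have "\<dots> = A [^] (x * r ^ Suc y) \<otimes> (B \<otimes> B [^] y)" using assms 1 by (simp add: m_assoc mult_ac)
    finally show ?case by (simp only: nat_pow_Suc2[OF assms(2), of y, symmetric])
  qed
qed

lemma (in monoid) twisted_normal_form_mult:
  assumes "A \<in> carrier G" "B \<in> carrier G" "B \<otimes> A = A [^] (r :: nat) \<otimes> B"
  shows "(A [^] (x :: nat) \<otimes> B [^] (y :: nat)) \<otimes> (A [^] (z :: nat) \<otimes> B [^] (w :: nat))
     = A [^] (x + z * r ^ y) \<otimes> B [^] (y + w)"
proof -
  have "(A [^] x \<otimes> B [^] y) \<otimes> (A [^] z \<otimes> B [^] w) = A [^] x \<otimes> (B [^] y \<otimes> A [^] z) \<otimes> B [^] w"
    using assms by (simp add: m_assoc)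
  also have "\<dots> = (A [^] x \<otimes> A [^] (z * r ^ y)) \<otimes> (B [^] y \<otimes> B [^] w)"
    unfolding twisted_power_commute[OF assms] using assms by (simp add: m_assoc)
  finally show ?thesis using assms by (simp add: nat_pow_mult)
qed

lemma (in monoid) nat_pow_mod:
  assumes "A \<in> carrier G" "A [^] (k :: nat) = \<one>"
  shows "A [^] (x mod k) = A [^] (x :: nat)"
proof -
  have "A [^] x = A [^] (k * (x div k) + x mod k)" by simp
  also have "\<dots> = (A [^] k) [^] (x div k) \<otimes> A [^] (x mod k)"
    using assms(1) by (simp only: nat_pow_mult[symmetric] nat_pow_pow)
  finally show ?thesis using assms by simp
qed

text \<open>The presentation is encoded by generators, relations and order: the relations alone
  allow at most \<open>p ^ (n + m)\<close> normal forms, so the cardinality makes them unique.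
  \<open>r\<close> is a natural number because the relation is also imposed in multiplicative
  monoids of matrices.\<close>

locale split_metacyclic = group G for G (structure) +
  fixes a b :: 'a and p n m r :: nat
  assumes p_prime: "prime p"
    and a_carrier [simp]: "a \<in> carrier G" and b_carrier [simp]: "b \<in> carrier G"
    and generated: "generate G {a, b} = carrier G"
    and a_power: "a [^] (p ^ n) = \<one>" and b_power: "b [^] (p ^ m) = \<one>"
    and relation: "b \<otimes> a = a [^] r \<otimes> b"
    and card_carrier: "card (carrier G) = p ^ (n + m)"
begin

definition el :: "nat \<Rightarrow> nat \<Rightarrow> 'a" where
  "el x y = a [^] x \<otimes> b [^] y"

lemma p_pos: "p > 0"
  using p_prime prime_gt_0_nat by blast

lemma el_carrier [simp]: "el x y \<in> carrier G"
  by (simp add: el_def)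

lemma el_mult: "el x y \<otimes> el z w = el (x + z * r ^ y) (y + w)"
  unfolding el_def by (rule twisted_normal_form_mult) (simp_all add: relation)

lemma el_mod: "el (x mod p ^ n) (y mod p ^ m) = el x y"
  by (simp add: el_def nat_pow_mod a_power b_power)

lemma el_0_0: "el 0 0 = \<one>"
  by (simp add: el_def)

lemma finite_carrier: "finite (carrier G)"
  using card_carrier p_pos by (metis card.infinite power_not_zero not_gr0)

lemma carrier_eq_el: "carrier G = (\<lambda>(x, y). el x y) ` ({..<p ^ n} \<times> {..<p ^ m})" (is "_ = ?S")
proof
  have mem: "el x y \<in> ?S" for x y
    using p_pos el_mod[of x y] by (intro image_eqI[of _ _ "(x mod p ^ n, y mod p ^ m)"]) auto
  have "g \<in> ?S" if "g \<in> generate G {a, b}" for g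
    using that
  proof (induction rule: generate.induct)
    case one
    show ?case using mem[of 0 0] by (simp add: el_0_0)
  next
    case (incl h)
    moreover have "el 1 0 = a" "el 0 1 = b" by (simp_all add: el_def)
    ultimately show ?case using mem[of 1 0] mem[of 0 1] by (metis insertE singletonD)
  next
    case (inv h)
    have "inv a = a [^] (p ^ n - 1)" "inv b = b [^] (p ^ m - 1)"
      using a_power b_power p_pos
      by (intro inv_equality; simp flip: nat_pow_Suc)+
    hence "inv a = el (p ^ n - 1) 0" "inv b = el 0 (p ^ m - 1)" by (simp_all add: el_def)
    thus ?case using mem inv by auto
  next
    case (eng h1 h2)
    thus ?case using mem by (auto simp: el_mult)
  qed
  thus "carrier G \<subseteq> ?S" using generated by blast
qed auto

lemma el_inj: "inj_on (\<lambda>(x, y). el x y) ({..<p ^ n} \<times> {..<p ^ m})"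
  by (rule eq_card_imp_inj_on) (simp_all flip: carrier_eq_el add: card_carrier power_add)

lemma sum_carrier: "(\<Sum>g\<in>carrier G. f g) = (\<Sum>x<p ^ n. \<Sum>y<p ^ m. f (el x y))"
  unfolding carrier_eq_el sum.cartesian_product
  by (subst sum.reindex[OF el_inj]) (simp add: case_prod_unfold)

text \<open>Von Dyck's theorem with a monoid as target: normal forms multiply by the same rule on
  both sides, and the power relations make the choice of exponents immaterial.\<close>

lemma extend_to_hom:
  assumes "monoid M" "A \<in> carrier M" "B \<in> carrier M"
    and "A [^]\<^bsub>M\<^esub> (p ^ n) = \<one>\<^bsub>M\<^esub>" "B [^]\<^bsub>M\<^esub> (p ^ m) = \<one>\<^bsub>M\<^esub>"
    and "B \<otimes>\<^bsub>M\<^esub> A = A [^]\<^bsub>M\<^esub> r \<otimes>\<^bsub>M\<^esub> B"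
  shows "\<exists>\<rho> \<in> hom G M. \<rho> \<one> = \<one>\<^bsub>M\<^esub> \<and> (\<forall>x y. \<rho> (el x y) = A [^]\<^bsub>M\<^esub> x \<otimes>\<^bsub>M\<^esub> B [^]\<^bsub>M\<^esub> y)"
proof -
  interpret M: monoid M by (rule assms(1))
  define co where "co = the_inv_into ({..<p ^ n} \<times> {..<p ^ m}) (\<lambda>(x, y). el x y)"
  define \<rho> where "\<rho> = (\<lambda>g. A [^]\<^bsub>M\<^esub> fst (co g) \<otimes>\<^bsub>M\<^esub> B [^]\<^bsub>M\<^esub> snd (co g))"
  have co: "co (el x y) = (x mod p ^ n, y mod p ^ m)" for x y
    using the_inv_into_f_f[OF el_inj, of "(x mod p ^ n, y mod p ^ m)"] p_pos
    by (simp add: co_def el_mod)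
  have \<rho>: "\<rho> (el x y) = A [^]\<^bsub>M\<^esub> x \<otimes>\<^bsub>M\<^esub> B [^]\<^bsub>M\<^esub> y" for x y
    by (simp add: \<rho>_def co M.nat_pow_mod assms)
  have "\<rho> \<in> hom G M"
  proof (rule homI)
    fix g h assume "g \<in> carrier G" "h \<in> carrier G"
    then obtain x y z w where gh: "g = el x y" "h = el z w" using carrier_eq_el by auto
    show "\<rho> (g \<otimes> h) = \<rho> g \<otimes>\<^bsub>M\<^esub> \<rho> h"
      unfolding gh el_mult \<rho> by (rule M.twisted_normal_form_mult[OF assms(2,3,6), symmetric])
  qed (simp add: \<rho>_def assms)
  moreover have "\<rho> \<one> = \<one>\<^bsub>M\<^esub>" using \<rho>[of 0 0] by (simp add: el_0_0)
  ultimately show ?thesis using \<rho> by blast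
qed

end

lemma lift_exponent_nat:
  assumes "prime p" "odd p" "N \<ge> 1" "r = 1 + p ^ N * k" "\<not> p dvd k" "\<not> p dvd w"
  shows "\<exists>K. r ^ (p ^ l * w) = 1 + p ^ (N + l) * K \<and> \<not> p dvd K"
proof -
  have "int r = 1 + int p ^ N * int k" using assms(4) by simp
  moreover have "\<not> int p dvd int k" using assms(5) by simp
  ultimately obtain K where K: "int r ^ (p ^ l * w) = 1 + int p ^ (N + l) * K" "\<not> int p dvd K"
    using lift_exponent[OF assms(1-3) _ _ assms(6)] by blast
  have p0: "int p ^ (N + l) > 0" using assms(1) prime_gt_0_nat by simp
  have "r > 0" using assms(4) by simp
  hence "int r ^ (p ^ l * w) \<ge> 1" by simp
  hence "int p ^ (N + l) * K \<ge> 0" using K(1) by linarith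
  hence "K \<ge> 0" using p0 by (simp add: zero_le_mult_iff)
  then obtain K' where K': "K = int K'" using nonneg_int_cases by blast
  have "int (r ^ (p ^ l * w)) = int (1 + p ^ (N + l) * K')" using K(1) K' by simp
  hence "r ^ (p ^ l * w) = 1 + p ^ (N + l) * K'" by (simp only: of_nat_eq_iff)
  moreover have "\<not> p dvd K'" using K(2) K' by simp
  ultimately show ?thesis by blast
qed

text \<open>The sum is (r ^ p ^ t - 1) / (r ^ p ^ c - 1), of valuation (N + t) - (N + c). It is the
  exponent of X in the norm of X, and \<open>u\<close> being prime to \<open>p\<close> is what makes
  the norm equations solvable.\<close>

lemma geometric_sum_exact:
  assumes "prime p" "odd p" "N \<ge> 1" "r = 1 + p ^ N * k" "\<not> p dvd k" "c \<le> t"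
  shows "\<exists>u. (\<Sum>l<p ^ (t - c). (r ^ p ^ c) ^ l) = p ^ (t - c) * u \<and> \<not> p dvd u"
proof -
  define S where "S = (\<Sum>l<p ^ (t - c). (r ^ p ^ c) ^ l)"
  have p0: "p > 0" using assms(1) prime_gt_0_nat by blast
  have np: "\<not> p dvd 1" using assms(1) not_prime_1 by fastforce
  obtain k1 where k1: "r ^ p ^ c = 1 + p ^ (N + c) * k1" "\<not> p dvd k1"
    using lift_exponent_nat[OF assms(1-5) np, of c] by auto
  obtain k2 where k2: "r ^ p ^ t = 1 + p ^ (N + t) * k2" "\<not> p dvd k2"
    using lift_exponent_nat[OF assms(1-5) np, of t] by auto
  have pt: "p ^ t = p ^ c * p ^ (t - c)" using assms(6) by (simp flip: power_add)
  have gs: "x ^ j = 1 + (x - 1) * (\<Sum>l<j. x ^ l)" if x: "x \<ge> 1" for x j :: nat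
  proof (induction j)
    case (Suc j)
    obtain y where "x = Suc y" using x by (cases x) auto
    thus ?case using Suc by (simp add: algebra_simps)
  qed simp
  have "r ^ p ^ t = (r ^ p ^ c) ^ p ^ (t - c)" by (simp add: pt power_mult)
  also have "\<dots> = 1 + (r ^ p ^ c - 1) * S" unfolding S_def by (rule gs) (simp add: k1(1))
  finally have "r ^ p ^ t = 1 + (r ^ p ^ c - 1) * S" .
  hence "p ^ (N + t) * k2 = p ^ (N + c) * k1 * S" unfolding k2(1) k1(1) by (simp only: add_left_cancel add_diff_cancel_left')
  moreover have "p ^ (N + t) = p ^ (N + c) * p ^ (t - c)" using assms(6) by (simp flip: power_add)
  ultimately have "p ^ (N + c) * (p ^ (t - c) * k2) = p ^ (N + c) * (k1 * S)" by (simp only: mult.assoc)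
  hence eq: "p ^ (t - c) * k2 = k1 * S" using p0 mult_left_cancel[of "p ^ (N + c)"] by (metis power_not_zero not_gr0)
  have "coprime (p ^ (t - c)) k1" using k1(2) assms(1) by (simp add: prime_imp_coprime)
  moreover have "p ^ (t - c) dvd k1 * S" using eq by (metis dvd_triv_left)
  ultimately have "p ^ (t - c) dvd S" using coprime_dvd_mult_right_iff by blast
  then obtain u where u: "S = p ^ (t - c) * u" by (elim dvdE)
  have "p ^ (t - c) * k2 = p ^ (t - c) * (k1 * u)" using eq u by (simp add: mult_ac)
  hence "k2 = k1 * u" using p0 by simp
  thus ?thesis using u k2(2) unfolding S_def by auto
qed

lemma root_of_unity_power_cong:
  fixes v :: "'a :: comm_monoid_mult"
  assumes "v ^ k = 1" "e = e' + k * x"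
  shows "v ^ e = v ^ e'"
  using assms by (simp add: power_add power_mult)

lemma power_one_add_mult:
  fixes x y j :: nat
  shows "\<exists>z. (1 + x * y) ^ j = 1 + x * z"
proof (induction j)
  case 0
  show ?case by (intro exI[of _ 0]) simp
next
  case (Suc j)
  then obtain z where "(1 + x * y) ^ j = 1 + x * z" by blast
  thus ?case by (intro exI[of _ "y + z + x * y * z"]) (simp add: algebra_simps)
qed

section \<open>Monomial representations\<close>

text \<open>The space is a sum of \<open>p\<^sup>c\<close> blocks \<open>F[X] / (X ^ q2 - v)\<close>, \<open>q2 = p\<^bsup>t-c\<^esup>\<close>, and \<open>E y z\<close> is the
  monomial \<open>X\<^sup>z\<close> in block \<open>y\<close>. The generator \<open>a\<close> multiplies block \<open>y\<close> by \<open>X ^ (r ^ y)\<close>; the generator \<open>b\<close>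
  moves block \<open>y\<close> to block \<open>y - 1\<close> and, on returning from block \<open>0\<close> to the last block, applies
  \<open>X \<mapsto> X ^ R\<close> and multiplies by \<open>\<tau> X ^ i0\<close>. The scalar \<open>b ^ p\<^sup>t\<close> is then the norm of \<open>\<tau> X ^ i0\<close>.\<close>
locale monomial_rep =
  fixes p N r k t c d i0 :: nat and v \<tau> :: complex
  assumes p_prime: "prime p" and p_odd: "odd p" and N1: "N \<ge> 1"
    and r_eq: "r = 1 + p ^ N * k" and k_nd: "\<not> p dvd k" and ct: "c \<le> t"
    and v_in: "v \<in> carrier (cyclotomic_field d)" and \<tau>_in: "\<tau> \<in> carrier (cyclotomic_field d)"
    and v_root: "v ^ p ^ (N + c) = 1"
begin

definition q1 where "q1 = p ^ c"
definition q2 where "q2 = p ^ (t - c)"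
definition q where "q = p ^ t"
definition R where "R = r ^ q1"

definition E :: "nat \<Rightarrow> nat \<Rightarrow> nat \<Rightarrow> complex" where
  "E y z = (\<lambda>j. if j = y * q2 + z mod q2 then v ^ (z div q2) else 0)"

definition matA :: "nat \<Rightarrow> nat \<Rightarrow> complex" where
  "matA = (\<lambda>i j. if i < q \<and> j < q then E (j div q2) (j mod q2 + r ^ (j div q2)) i else 0)"

definition matB :: "nat \<Rightarrow> nat \<Rightarrow> complex" where
  "matB = (\<lambda>i j. if i < q \<and> j < q then
      (if j div q2 > 0 then E (j div q2 - 1) (j mod q2) i
       else \<tau> * E (q1 - 1) (R * (j mod q2) + i0) i) else 0)"

definition app :: "(nat \<Rightarrow> nat \<Rightarrow> complex) \<Rightarrow> (nat \<Rightarrow> complex) \<Rightarrow> nat \<Rightarrow> complex" where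
  "app M w = (\<lambda>i. if i < q then \<Sum>j<q. M i j * w j else 0)"

lemma pos: "p > 0" "q1 > 0" "q2 > 0" "q > 0"
  using p_prime prime_gt_0_nat by (auto simp: q1_def q2_def q_def)

lemma q_eq: "q = q1 * q2"
  using ct by (simp add: q_def q1_def q2_def flip: power_add)

lemma index_less: "y < q1 \<Longrightarrow> y * q2 + z mod q2 < q"
proof -
  assume "y < q1"
  hence "Suc y * q2 \<le> q1 * q2" by (intro mult_le_mono1) simp
  moreover have "z mod q2 < q2" using pos by simp
  ultimately show ?thesis unfolding q_eq by simp
qed

lemma E_shift: "E y (z + q2 * x) = (\<lambda>j. v ^ x * E y z j)"
  using pos by (auto simp: E_def fun_eq_iff power_add)

lemma E_in: "E y z j \<in> carrier (cyclotomic_field d)"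
  by (simp add: E_def v_in cyclotomic_field_power)

lemma matA_in: "matA \<in> carrier (cyclo_mat q d)"
  by (auto simp: cyclo_mat_carrier matA_def E_in)

lemma matB_in: "matB \<in> carrier (cyclo_mat q d)"
  by (auto simp: cyclo_mat_carrier matB_def E_in \<tau>_in intro!: cyclotomic_field_closed)

lemma app_E:
  assumes "y < q1"
  shows "app M (E y z) = (\<lambda>i. if i < q then M i (y * q2 + z mod q2) * v ^ (z div q2) else 0)"
proof
  fix i
  have "(\<Sum>j<q. M i j * E y z j) = (\<Sum>j<q. if j = y * q2 + z mod q2 then M i j * v ^ (z div q2) else 0)"
    by (intro sum.cong) (auto simp: E_def)
  also have "\<dots> = M i (y * q2 + z mod q2) * v ^ (z div q2)" using index_less[OF assms] by simp
  finally show "app M (E y z) i = (if i < q then M i (y * q2 + z mod q2) * v ^ (z div q2) else 0)"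
    by (simp add: app_def)
qed

lemma E_outside: "y < q1 \<Longrightarrow> \<not> i < q \<Longrightarrow> E y z i = 0"
  using index_less by (auto simp: E_def)

lemma app_scale: "app M (\<lambda>i. x * w i) = (\<lambda>i. x * app M w i)"
  by (auto simp: app_def sum_distrib_left mult_ac fun_eq_iff intro!: sum.cong)

lemma app_mult:
  assumes "M \<in> carrier (cyclo_mat q d)" "M' \<in> carrier (cyclo_mat q d)"
  shows "app (M \<otimes>\<^bsub>cyclo_mat q d\<^esub> M') w = app M (app M' w)"
proof
  fix i
  have "(\<Sum>j<q. (\<Sum>l<q. M i l * M' l j) * w j) = (\<Sum>l<q. M i l * (\<Sum>j<q. M' l j * w j))"
    by (subst sum_distrib_right, subst sum.swap, simp add: sum_distrib_left mult.assoc)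
  thus "app (M \<otimes>\<^bsub>cyclo_mat q d\<^esub> M') w i = app M (app M' w) i"
    by (auto simp: app_def cyclo_mat_mult[OF assms] cong: if_cong)
qed

lemma app_one: "app \<one>\<^bsub>cyclo_mat q d\<^esub> (E y z) = E y z" if "y < q1"
  unfolding app_E[OF that] using index_less[OF that] by (auto simp: cyclo_mat_one scalar_mat_def fun_eq_iff E_def)

lemma app_scalar: "app (scalar_mat q x) (E y z) = (\<lambda>i. x * E y z i)" if "y < q1"
  unfolding app_E[OF that] using index_less[OF that] by (auto simp: scalar_mat_def fun_eq_iff E_def)

text \<open>The vectors \<open>E y z\<close> with \<open>z < q2\<close> are the standard basis, so
  matrix identities can be checked on monomials.\<close>

lemma mat_eqI:
  assumes "M \<in> carrier (cyclo_mat q d)" "M' \<in> carrier (cyclo_mat q d)"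
    and eq: "\<And>y z. y < q1 \<Longrightarrow> app M (E y z) = app M' (E y z)"
  shows "M = M'"
proof (intro ext)
  fix i j
  show "M i j = M' i j"
  proof (cases "i < q \<and> j < q")
    case True
    hence y: "j div q2 < q1" using pos by (simp add: q_eq less_mult_imp_div_less)
    show ?thesis using fun_cong[OF eq[OF y, of "j mod q2"], of i] True by (simp add: app_E[OF y])
  next
    case False
    thus ?thesis using assms by (auto simp: cyclo_mat_carrier)
  qed
qed

lemma app_A: "app matA (E y z) = E y (z + r ^ y)" if "y < q1"
proof -
  have "E y (z + r ^ y) = E y ((z mod q2 + r ^ y) + q2 * (z div q2))" by (simp add: algebra_simps)
  also have "\<dots> = (\<lambda>j. v ^ (z div q2) * E y (z mod q2 + r ^ y) j)" by (rule E_shift)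
  finally show ?thesis using that index_less[OF that] E_outside[OF that] pos
    by (auto simp: app_E matA_def fun_eq_iff)
qed

text \<open>Makes the substitution X -> X ^ R compatible with X ^ q2 = v: \<open>R\<close> is 1
  modulo \<open>p ^ (N + c)\<close>, a multiple of the order of \<open>v\<close>.\<close>

lemma v_R: "v ^ (R * x) = v ^ x"
proof -
  have np: "\<not> p dvd 1" using p_prime not_prime_1 by fastforce
  obtain K where "r ^ (p ^ c * 1) = 1 + p ^ (N + c) * K"
    using lift_exponent_nat[OF p_prime p_odd N1 r_eq k_nd np] by blast
  hence "R * x = x + p ^ (N + c) * (K * x)" by (simp add: R_def q1_def algebra_simps)
  thus ?thesis using root_of_unity_power_cong[OF v_root] by blast
qed

lemma app_B_0: "app matB (E 0 z) = (\<lambda>i. \<tau> * E (q1 - 1) (R * z + i0) i)"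
proof -
  have "R * z + i0 = (R * (z mod q2) + i0) + q2 * (R * (z div q2))"
    by (metis (no_types, lifting) add.assoc add.commute add_mult_distrib2 mod_mult_div_eq mult.left_commute)
  hence "E (q1 - 1) (R * z + i0) = (\<lambda>j. v ^ (R * (z div q2)) * E (q1 - 1) (R * (z mod q2) + i0) j)"
    by (simp only: E_shift)
  moreover have "0 < q1" "q1 - 1 < q1" using pos by auto
  ultimately show ?thesis using index_less[of 0 z] E_outside[of "q1 - 1"] pos
    by (auto simp: app_E matB_def v_R fun_eq_iff)
qed

lemma app_B: "app matB (E y z) = E (y - 1) z" if "y < q1" "y > 0"
proof -
  have "E (y - 1) z = E (y - 1) (z mod q2 + q2 * (z div q2))" by simp
  also have "\<dots> = (\<lambda>j. v ^ (z div q2) * E (y - 1) (z mod q2) j)" by (rule E_shift)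
  finally show ?thesis using that index_less[OF that(1)] E_outside[of "y - 1"] pos
    by (auto simp: app_E matB_def fun_eq_iff)
qed

sublocale monoid "cyclo_mat q d"
  by (rule monoid_cyclo_mat)

lemma app_A_power: "app (matA [^]\<^bsub>cyclo_mat q d\<^esub> (j :: nat)) (E y z) = E y (z + j * r ^ y)" if "y < q1"
proof (induction j arbitrary: z)
  case 0
  show ?case using app_one[OF that] by simp
next
  case (Suc j)
  thus ?case using that by (simp add: app_mult matA_in app_A add_ac)
qed

text \<open>On block \<open>y\<close> the power acts by v ^ (p ^ c * r ^ y). Since \<open>r\<close>
  is 1 modulo \<open>p ^ N\<close> and v ^ p ^ c has order dividing \<open>p ^ N\<close>, all blocks
  see the same scalar.\<close>

lemma A_power: "matA [^]\<^bsub>cyclo_mat q d\<^esub> (p ^ t) = scalar_mat q (v ^ p ^ c)"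
proof (rule mat_eqI)
  fix y z assume y: "y < q1"
  obtain w where "r ^ y = 1 + p ^ N * w" using power_one_add_mult[of "p ^ N" k y] r_eq by auto
  hence "q1 * r ^ y = p ^ c + p ^ (N + c) * w" by (simp add: q1_def algebra_simps power_add)
  hence "v ^ (q1 * r ^ y) = v ^ p ^ c" by (rule root_of_unity_power_cong[OF v_root])
  moreover have "p ^ t * r ^ y = q2 * (q1 * r ^ y)" using q_eq by (simp add: q_def mult_ac)
  ultimately show "app (matA [^]\<^bsub>cyclo_mat q d\<^esub> (p ^ t)) (E y z) = app (scalar_mat q (v ^ p ^ c)) (E y z)"
    unfolding app_A_power[OF y] app_scalar[OF y] by (simp only: E_shift)
qed (auto simp: matA_in scalar_mat_carrier cyclotomic_field_power v_in)

lemma relation: "matB \<otimes>\<^bsub>cyclo_mat q d\<^esub> matA = matA [^]\<^bsub>cyclo_mat q d\<^esub> r \<otimes>\<^bsub>cyclo_mat q d\<^esub> matB"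
proof (rule mat_eqI)
  fix y z assume y: "y < q1"
  show "app (matB \<otimes>\<^bsub>cyclo_mat q d\<^esub> matA) (E y z) = app (matA [^]\<^bsub>cyclo_mat q d\<^esub> r \<otimes>\<^bsub>cyclo_mat q d\<^esub> matB) (E y z)"
  proof (cases "y = 0")
    case True
    \<comment> \<open>At the wrap-around, X -> X ^ R turns multiplication by X in block 0 into X ^
      R, which is the action of the \<open>r\<close>-th power of \<open>matA\<close> on the last
      block.\<close>
    have "r * r ^ (q1 - 1) = R" using pos by (simp add: R_def flip: power_Suc)
    thus ?thesis using y pos True
      by (simp add: app_mult matA_in matB_in app_A app_B_0 app_scale app_A_power algebra_simps)
  next
    case False
    hence "r * r ^ (y - 1) = r ^ y" by (simp flip: power_Suc)
    thus ?thesis using y False by (simp add: app_mult matA_in matB_in app_A app_B app_A_power)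
  qed
qed (auto simp: matA_in matB_in)

lemma app_B_power_small: "app (matB [^]\<^bsub>cyclo_mat q d\<^esub> (j :: nat)) (E y z) = E (y - j) z" if "y < q1" "j \<le> y"
  using that
proof (induction j arbitrary: y)
  case 0
  thus ?case using app_one by simp
next
  case (Suc j)
  thus ?case by (simp add: app_mult matB_in app_B)
qed

lemma app_B_power_q1: "app (matB [^]\<^bsub>cyclo_mat q d\<^esub> q1) (E y z) = (\<lambda>i. \<tau> * E y (R * z + i0) i)" if y: "y < q1"
proof -
  \<comment> \<open>One full turn: \<open>y\<close> steps down to block 0, one wrap-around to the
    last block, and q1 - 1 - y steps back to block \<open>y\<close>.\<close>
  have "matB [^]\<^bsub>cyclo_mat q d\<^esub> q1 = matB [^]\<^bsub>cyclo_mat q d\<^esub> (q1 - 1 - y) \<otimes>\<^bsub>cyclo_mat q d\<^esub> (matB \<otimes>\<^bsub>cyclo_mat q d\<^esub> matB [^]\<^bsub>cyclo_mat q d\<^esub> y)"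
    using y by (simp only: matB_in nat_pow_closed nat_pow_mult flip: nat_pow_Suc2) simp
  thus ?thesis using y by (simp add: app_mult matB_in app_B_power_small app_B_0 app_scale)
qed

lemma app_B_power_q1_mult:
  assumes y: "y < q1"
  shows "app (matB [^]\<^bsub>cyclo_mat q d\<^esub> (q1 * l)) (E y z)
    = (\<lambda>i. \<tau> ^ l * E y (R ^ l * z + i0 * (\<Sum>j<l. R ^ j)) i)"
proof (induction l arbitrary: z)
  case 0
  show ?case using app_one[OF y] by simp
next
  case (Suc l)
  have "matB [^]\<^bsub>cyclo_mat q d\<^esub> (q1 * Suc l) = matB [^]\<^bsub>cyclo_mat q d\<^esub> (q1 * l) \<otimes>\<^bsub>cyclo_mat q d\<^esub> matB [^]\<^bsub>cyclo_mat q d\<^esub> q1"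
    by (simp add: matB_in nat_pow_mult add.commute)
  moreover have "(\<Sum>j<Suc l. R ^ j) = (\<Sum>j<l. R ^ j) + R ^ l" by simp
  ultimately show ?case
    by (simp only: app_mult matB_in nat_pow_closed app_B_power_q1[OF y] app_scale Suc) (simp add: algebra_simps)
qed

lemma B_power:
  assumes "(\<Sum>l<p ^ (t - c). (r ^ p ^ c) ^ l) = p ^ (t - c) * u"
  shows "matB [^]\<^bsub>cyclo_mat q d\<^esub> (p ^ t) = scalar_mat q (\<tau> ^ p ^ (t - c) * v ^ (i0 * u))"
proof (rule mat_eqI)
  fix y z assume y: "y < q1"
  have np: "\<not> p dvd 1" using p_prime not_prime_1 by fastforce
  obtain K where "r ^ (p ^ t * 1) = 1 + p ^ (N + t) * K"
    using lift_exponent_nat[OF p_prime p_odd N1 r_eq k_nd np] by blast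
  moreover have "R ^ q2 = r ^ p ^ t" using q_eq by (simp add: R_def q_def flip: power_mult)
  moreover have "p ^ (N + t) = q2 * p ^ (N + c)" using ct by (simp add: q2_def add.commute flip: power_add)
  moreover have "(\<Sum>j<q2. R ^ j) = q2 * u" using assms by (simp add: R_def q1_def q2_def)
  \<comment> \<open>After \<open>q2\<close> turns the substitution has become trivial: R ^ q2 = r ^
    p ^ t differs from 1 by a multiple of q2 * p ^ (N + c), which \<open>v\<close> does not
    see.\<close>
  ultimately have "R ^ q2 * z + i0 * (\<Sum>j<q2. R ^ j) = z + q2 * (i0 * u + p ^ (N + c) * (K * z))"
    by (simp add: algebra_simps)
  moreover have "v ^ (i0 * u + p ^ (N + c) * (K * z)) = v ^ (i0 * u)"
    by (rule root_of_unity_power_cong[OF v_root]) (rule refl)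
  moreover have "p ^ t = q1 * q2" using q_eq by (simp add: q_def)
  ultimately show "app (matB [^]\<^bsub>cyclo_mat q d\<^esub> (p ^ t)) (E y z) = app (scalar_mat q (\<tau> ^ p ^ (t - c) * v ^ (i0 * u))) (E y z)"
    unfolding app_scalar[OF y] by (simp only: app_B_power_q1_mult[OF y] E_shift) (simp add: q2_def mult_ac)
qed (auto simp: matB_in scalar_mat_carrier cyclotomic_field_power v_in \<tau>_in cyclotomic_field_closed)

end

section \<open>Irreducible characters and their fields\<close>

text \<open>\<open>i\<close> is \<open>J\<close> times the inverse of \<open>k\<close> modulo
  \<open>p ^ l\<close>. The last clause provides the exponents prime to \<open>p\<close> required in
  \<open>specs\<close>.\<close>

lemma zeta_power_solve:
  assumes "prime p" "\<not> p dvd k"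
  shows "\<exists>i<p ^ l. zeta p l ^ (i * k) = zeta p l ^ J \<and> (l \<ge> 1 \<longrightarrow> \<not> p dvd J \<longrightarrow> \<not> p dvd i)"
proof -
  have p0: "p > 0" using assms(1) prime_gt_0_nat by blast
  have "coprime k (p ^ l)" using assms prime_imp_coprime[of p k] by (simp add: coprime_commute)
  then obtain x where x: "[k * x = 1] (mod p ^ l)" using cong_solve_coprime_nat[of k "p ^ l"] by auto
  define i where "i = (x * J) mod p ^ l"
  have "[i * k = (x * J) * k] (mod p ^ l)" by (simp add: i_def cong_def mod_mult_left_eq)
  also have "(x * J) * k = (k * x) * J" by (simp add: mult_ac)
  also have "[(k * x) * J = 1 * J] (mod p ^ l)" by (intro cong_mult x cong_refl)
  finally have c: "[i * k = J] (mod p ^ l)" by simp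
  have "\<not> p dvd i" if "l \<ge> 1" "\<not> p dvd J"
  proof
    assume "p dvd i"
    hence "p dvd i * k" by simp
    moreover have "[i * k = J] (mod p)" using c that(1) by (meson cong_dvd_modulus_nat dvd_power le_trans not_one_le_zero neq0_conv less_le_trans zero_less_one)
    ultimately show False using that(2) cong_dvd_iff by blast
  qed
  moreover have "i < p ^ l" using p0 by (simp add: i_def)
  ultimately show ?thesis using zeta_power_cong[OF p0 c] by blast
qed

lemma zeta_power_lift:
  assumes "l' \<le> l" "p > 0"
  shows "zeta p l ^ (p ^ (l - l') * i) = zeta p l' ^ i"
  using zeta_power_power[OF assms] by (simp add: power_mult)

lemma zeta_power_primitive:
  assumes "prime p"
  shows "\<exists>l' \<le> l. \<exists>k'. \<not> p dvd k' \<and> zeta p l ^ k = zeta p l' ^ k'"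
proof (cases "p ^ l dvd k")
  case True
  have p0: "p > 0" using assms prime_gt_0_nat by blast
  have "\<not> p dvd 1" using assms not_prime_1 by fastforce
  moreover have "zeta p l ^ k = zeta p 0 ^ 1" using True zeta_power_eq_1_iff[OF p0] by simp
  ultimately show ?thesis by blast
next
  case False
  have p0: "p > 0" using assms prime_gt_0_nat by blast
  have "k > 0" using False by (cases k) auto
  then obtain i k' where k: "k = p ^ i * k'" "\<not> p dvd k'" using nat_prime_decompose[OF assms] by blast
  have "i < l"
  proof (rule ccontr)
    assume "\<not> i < l"
    hence "p ^ l dvd p ^ i" by (intro le_imp_power_dvd) simp
    thus False using False k by simp
  qed
  hence "zeta p l ^ k = zeta p (l - i) ^ k'"
    using zeta_power_lift[of "l - i" l p k'] p0 k by simp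
  thus ?thesis using k(2) by (intro exI[of _ "l - i"] conjI exI[of _ k']) auto
qed

lemma mult_pred_add: "x > 0 \<Longrightarrow> w * (x - 1) + w = x * (w :: nat)"
  by (cases x) auto

locale odd_split_metacyclic = split_metacyclic +
  fixes N s k :: nat
  assumes p_odd: "odd p" and N1: "N \<ge> 1" and n_eq: "n = N + s" and s_le: "s \<le> m"
    and r_eq: "r = 1 + p ^ N * k" and k_nd: "\<not> p dvd k"
begin

lemma one_nd: "\<not> p dvd 1"
  using p_prime not_prime_1 by fastforce

lemma trace_conj_B:
  assumes "A \<in> carrier (cyclo_mat q d)" "B \<in> carrier (cyclo_mat q d)"
    and rel: "B \<otimes>\<^bsub>cyclo_mat q d\<^esub> A = A [^]\<^bsub>cyclo_mat q d\<^esub> r \<otimes>\<^bsub>cyclo_mat q d\<^esub> B"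
    and Bm: "B [^]\<^bsub>cyclo_mat q d\<^esub> (p ^ m) = \<one>\<^bsub>cyclo_mat q d\<^esub>"
  shows "mat_trace q (A [^]\<^bsub>cyclo_mat q d\<^esub> x \<otimes>\<^bsub>cyclo_mat q d\<^esub> B [^]\<^bsub>cyclo_mat q d\<^esub> y)
     = mat_trace q (A [^]\<^bsub>cyclo_mat q d\<^esub> (x * r ^ w) \<otimes>\<^bsub>cyclo_mat q d\<^esub> B [^]\<^bsub>cyclo_mat q d\<^esub> (y :: nat))"
proof -
  interpret M: monoid "cyclo_mat q d" by (rule monoid_cyclo_mat)
  let ?M = "cyclo_mat q d"
  \<comment> \<open>Plays the part of y - w: as B ^ p ^ m is 1, adding \<open>w\<close> copies of
    \<open>p ^ m\<close> keeps the exponent natural.\<close>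
  define y' where "y' = y + w * (p ^ m - 1)"
  have yy: "y' + w = y + p ^ m * w" using p_pos mult_pred_add[of "p ^ m" w] by (simp add: y'_def)
  have By: "B [^]\<^bsub>?M\<^esub> (y' + w) = B [^]\<^bsub>?M\<^esub> y"
    using M.nat_pow_mod[OF assms(2) Bm, of "y + p ^ m * w"] M.nat_pow_mod[OF assms(2) Bm, of y] unfolding yy by simp
  have "mat_trace q (A [^]\<^bsub>?M\<^esub> x \<otimes>\<^bsub>?M\<^esub> B [^]\<^bsub>?M\<^esub> y) = mat_trace q ((A [^]\<^bsub>?M\<^esub> x \<otimes>\<^bsub>?M\<^esub> B [^]\<^bsub>?M\<^esub> y') \<otimes>\<^bsub>?M\<^esub> B [^]\<^bsub>?M\<^esub> w)"
    unfolding By[symmetric] using assms by (simp add: M.m_assoc M.nat_pow_mult)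
  also have "\<dots> = mat_trace q (B [^]\<^bsub>?M\<^esub> w \<otimes>\<^bsub>?M\<^esub> (A [^]\<^bsub>?M\<^esub> x \<otimes>\<^bsub>?M\<^esub> B [^]\<^bsub>?M\<^esub> y'))"
    using assms by (intro mat_trace_mult_commute) auto
  also have "B [^]\<^bsub>?M\<^esub> w \<otimes>\<^bsub>?M\<^esub> (A [^]\<^bsub>?M\<^esub> x \<otimes>\<^bsub>?M\<^esub> B [^]\<^bsub>?M\<^esub> y') = A [^]\<^bsub>?M\<^esub> (x * r ^ w) \<otimes>\<^bsub>?M\<^esub> (B [^]\<^bsub>?M\<^esub> w \<otimes>\<^bsub>?M\<^esub> B [^]\<^bsub>?M\<^esub> y')"
    using assms M.twisted_power_commute[OF assms(1-3), of w x] by (simp add: M.m_assoc[symmetric])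
  also have "B [^]\<^bsub>?M\<^esub> w \<otimes>\<^bsub>?M\<^esub> B [^]\<^bsub>?M\<^esub> y' = B [^]\<^bsub>?M\<^esub> y"
    using assms By by (simp add: M.nat_pow_mult add.commute)
  finally show ?thesis .
qed

lemma trace_conj_A:
  assumes "A \<in> carrier (cyclo_mat q d)" "B \<in> carrier (cyclo_mat q d)"
    and rel: "B \<otimes>\<^bsub>cyclo_mat q d\<^esub> A = A [^]\<^bsub>cyclo_mat q d\<^esub> r \<otimes>\<^bsub>cyclo_mat q d\<^esub> B"
    and An: "A [^]\<^bsub>cyclo_mat q d\<^esub> (p ^ n) = \<one>\<^bsub>cyclo_mat q d\<^esub>" and ry: "r ^ y = 1 + j"
  shows "mat_trace q (A [^]\<^bsub>cyclo_mat q d\<^esub> x \<otimes>\<^bsub>cyclo_mat q d\<^esub> B [^]\<^bsub>cyclo_mat q d\<^esub> y)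
     = mat_trace q (A [^]\<^bsub>cyclo_mat q d\<^esub> (x + w * j) \<otimes>\<^bsub>cyclo_mat q d\<^esub> B [^]\<^bsub>cyclo_mat q d\<^esub> (y :: nat))"
proof -
  interpret M: monoid "cyclo_mat q d" by (rule monoid_cyclo_mat)
  let ?M = "cyclo_mat q d"
  define x' where "x' = x + w * (p ^ n - 1)"
  have xx: "x' + w = x + p ^ n * w" using p_pos mult_pred_add[of "p ^ n" w] by (simp add: x'_def)
  have Ax: "A [^]\<^bsub>?M\<^esub> (x + e + p ^ n * w) = A [^]\<^bsub>?M\<^esub> (x + e)" for e
    using M.nat_pow_mod[OF assms(1) An, of "x + e + p ^ n * w"] M.nat_pow_mod[OF assms(1) An, of "x + e"] by simp
  have "A [^]\<^bsub>?M\<^esub> x = A [^]\<^bsub>?M\<^esub> (w + x')" using Ax[of 0] xx by (simp add: add.commute)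
  hence "mat_trace q (A [^]\<^bsub>?M\<^esub> x \<otimes>\<^bsub>?M\<^esub> B [^]\<^bsub>?M\<^esub> y) = mat_trace q (A [^]\<^bsub>?M\<^esub> w \<otimes>\<^bsub>?M\<^esub> (A [^]\<^bsub>?M\<^esub> x' \<otimes>\<^bsub>?M\<^esub> B [^]\<^bsub>?M\<^esub> y))"
    using assms by (simp add: M.m_assoc[symmetric] M.nat_pow_mult)
  also have "\<dots> = mat_trace q ((A [^]\<^bsub>?M\<^esub> x' \<otimes>\<^bsub>?M\<^esub> B [^]\<^bsub>?M\<^esub> y) \<otimes>\<^bsub>?M\<^esub> A [^]\<^bsub>?M\<^esub> w)"
    using assms by (intro mat_trace_mult_commute) auto
  also have "(A [^]\<^bsub>?M\<^esub> x' \<otimes>\<^bsub>?M\<^esub> B [^]\<^bsub>?M\<^esub> y) \<otimes>\<^bsub>?M\<^esub> A [^]\<^bsub>?M\<^esub> w = A [^]\<^bsub>?M\<^esub> (x' + w * r ^ y) \<otimes>\<^bsub>?M\<^esub> B [^]\<^bsub>?M\<^esub> y"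
    using assms M.twisted_power_commute[OF assms(1-3), of y w]
    by (simp add: M.m_assoc) (simp add: M.m_assoc[symmetric] M.nat_pow_mult)
  also have "x' + w * r ^ y = x + w * j + p ^ n * w" using xx by (simp add: ry algebra_simps)
  finally show ?thesis unfolding Ax .
qed

text \<open>Off the subgroup generated by the \<open>p\<^sup>t\<close>-th powers, a suitable conjugation multiplies
  \<open>A ^ x B ^ y\<close> by a nontrivial \<open>p\<close>-th root of unity, so the trace vanishes.\<close>
lemma trace_formula:
  assumes "A \<in> carrier (cyclo_mat (p ^ t) d)" "B \<in> carrier (cyclo_mat (p ^ t) d)"
    and rel: "B \<otimes>\<^bsub>cyclo_mat (p ^ t) d\<^esub> A = A [^]\<^bsub>cyclo_mat (p ^ t) d\<^esub> r \<otimes>\<^bsub>cyclo_mat (p ^ t) d\<^esub> B"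
    and An: "A [^]\<^bsub>cyclo_mat (p ^ t) d\<^esub> (p ^ n) = \<one>\<^bsub>cyclo_mat (p ^ t) d\<^esub>"
    and Bm: "B [^]\<^bsub>cyclo_mat (p ^ t) d\<^esub> (p ^ m) = \<one>\<^bsub>cyclo_mat (p ^ t) d\<^esub>"
    and \<omega>: "\<omega> \<in> carrier (cyclotomic_field d)" and \<eta>: "\<eta> \<in> carrier (cyclotomic_field d)"
    and At: "A [^]\<^bsub>cyclo_mat (p ^ t) d\<^esub> (p ^ t) = scalar_mat (p ^ t) \<omega>"
    and Bt: "B [^]\<^bsub>cyclo_mat (p ^ t) d\<^esub> (p ^ t) = scalar_mat (p ^ t) \<eta>"
    and prim: "\<And>j. t \<ge> 1 \<Longrightarrow> \<not> p dvd j \<Longrightarrow> \<omega> ^ (p ^ (N - 1) * j) \<noteq> 1"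
  shows "mat_trace (p ^ t) (A [^]\<^bsub>cyclo_mat (p ^ t) d\<^esub> x \<otimes>\<^bsub>cyclo_mat (p ^ t) d\<^esub> B [^]\<^bsub>cyclo_mat (p ^ t) d\<^esub> (y :: nat))
     = (if p ^ t dvd x \<and> p ^ t dvd y then of_nat (p ^ t) * \<omega> ^ (x div p ^ t) * \<eta> ^ (y div p ^ t) else 0)"
proof -
  let ?M = "cyclo_mat (p ^ t) d"
  interpret M: monoid ?M by (rule monoid_cyclo_mat)
  let ?T = "\<lambda>x y. mat_trace (p ^ t) (A [^]\<^bsub>?M\<^esub> (x :: nat) \<otimes>\<^bsub>?M\<^esub> B [^]\<^bsub>?M\<^esub> (y :: nat))"
  have shift: "?T (x + p ^ t * j) y = \<omega> ^ j * ?T x y" for x y j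
  proof -
    have "A [^]\<^bsub>?M\<^esub> (x + p ^ t * j) = A [^]\<^bsub>?M\<^esub> (p ^ t * j + x)" by (simp add: add.commute)
    also have "\<dots> = (A [^]\<^bsub>?M\<^esub> (p ^ t)) [^]\<^bsub>?M\<^esub> j \<otimes>\<^bsub>?M\<^esub> A [^]\<^bsub>?M\<^esub> x"
      using assms(1) by (simp only: M.nat_pow_mult M.nat_pow_pow M.nat_pow_closed)
    also have "\<dots> = scalar_mat (p ^ t) (\<omega> ^ j) \<otimes>\<^bsub>?M\<^esub> A [^]\<^bsub>?M\<^esub> x"
      using \<omega> by (simp add: At scalar_mat_power)
    finally have "A [^]\<^bsub>?M\<^esub> (x + p ^ t * j) \<otimes>\<^bsub>?M\<^esub> B [^]\<^bsub>?M\<^esub> y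
       = scalar_mat (p ^ t) (\<omega> ^ j) \<otimes>\<^bsub>?M\<^esub> (A [^]\<^bsub>?M\<^esub> x \<otimes>\<^bsub>?M\<^esub> B [^]\<^bsub>?M\<^esub> y)"
      using assms by (simp add: M.m_assoc scalar_mat_carrier cyclotomic_field_power)
    thus ?thesis using assms by (simp add: scalar_mat_mult cyclotomic_field_power mat_trace_scalar_mult)
  qed
  show ?thesis
  proof (cases "p ^ t dvd x")
    case False
    hence "x > 0" by (cases x) auto
    then obtain l x' where x: "x = p ^ l * x'" "\<not> p dvd x'" using nat_prime_decompose[OF p_prime] by blast
    have l: "l < t"
    proof (rule ccontr)
      assume "\<not> l < t"
      hence "p ^ t dvd p ^ l" by (intro le_imp_power_dvd) simp
      thus False using False x by simp
    qed
    \<comment> \<open>Conjugation by B ^ p ^ (t - 1 - l) is chosen so that \<open>x\<close> changes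
      by p ^ t * p ^ (N - 1) times a number prime to \<open>p\<close>: the smallest shift visible to
      \<omega>.\<close>
    obtain K where K: "r ^ (p ^ (t - 1 - l) * 1) = 1 + p ^ (N + (t - 1 - l)) * K" "\<not> p dvd K"
      using lift_exponent_nat[OF p_prime p_odd N1 r_eq k_nd one_nd] by blast
    have "p ^ l * p ^ (N + (t - 1 - l)) = p ^ t * p ^ (N - 1)" using l N1 by (simp add: add.commute flip: power_add)
    hence "x * r ^ (p ^ (t - 1 - l)) = x + p ^ t * (p ^ (N - 1) * (x' * K))"
      using K(1) x(1) by (simp add: algebra_simps)
    hence "?T x y = \<omega> ^ (p ^ (N - 1) * (x' * K)) * ?T x y"
      using trace_conj_B[OF assms(1-3) Bm, of x y "p ^ (t - 1 - l)"] shift by simp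
    moreover have "\<omega> ^ (p ^ (N - 1) * (x' * K)) \<noteq> 1"
      using l x(2) K(2) p_prime by (intro prim) (auto simp: prime_dvd_mult_iff)
    ultimately show ?thesis using False by simp
  next
    case xt: True
    show ?thesis
    proof (cases "p ^ t dvd y")
      case False
      hence "y > 0" by (cases y) auto
      then obtain l y' where y: "y = p ^ l * y'" "\<not> p dvd y'" using nat_prime_decompose[OF p_prime] by blast
      have l: "l < t"
      proof (rule ccontr)
        assume "\<not> l < t"
        hence "p ^ t dvd p ^ l" by (intro le_imp_power_dvd) simp
        thus False using False y by simp
      qed
      \<comment> \<open>Here \<open>B\<close> commutes with the scalars already, so conjugation by A
        ^ p ^ (t - 1 - l) is used; it shifts \<open>x\<close> by a multiple of r ^ y - 1, of
        valuation N + l.\<close>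
      obtain K where K: "r ^ y = 1 + p ^ (N + l) * K" "\<not> p dvd K"
        using lift_exponent_nat[OF p_prime p_odd N1 r_eq k_nd y(2)] y(1) by blast
      have "p ^ (t - 1 - l) * p ^ (N + l) = p ^ t * p ^ (N - 1)" using l N1 by (simp add: add.commute flip: power_add)
      hence e: "p ^ (t - 1 - l) * (p ^ (N + l) * K) = p ^ t * (p ^ (N - 1) * K)" by (simp only: mult.assoc[symmetric])
      have "?T x y = ?T (x + p ^ (t - 1 - l) * (p ^ (N + l) * K)) y"
        by (rule trace_conj_A[OF assms(1-3) An K(1)])
      also have "\<dots> = \<omega> ^ (p ^ (N - 1) * K) * ?T x y" unfolding e by (rule shift)
      finally have "?T x y = \<omega> ^ (p ^ (N - 1) * K) * ?T x y" .
      moreover have "\<omega> ^ (p ^ (N - 1) * K) \<noteq> 1" using l K(2) by (intro prim) auto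
      ultimately show ?thesis using False by simp
    next
      case yt: True
      obtain i j where ij: "x = p ^ t * i" "y = p ^ t * j" using xt yt by (auto elim!: dvdE)
      have "A [^]\<^bsub>?M\<^esub> x = scalar_mat (p ^ t) (\<omega> ^ i)" "B [^]\<^bsub>?M\<^esub> y = scalar_mat (p ^ t) (\<eta> ^ j)"
        using assms(1,2) \<omega> \<eta> by (simp_all add: ij At Bt scalar_mat_power flip: M.nat_pow_pow)
      hence "?T x y = mat_trace (p ^ t) (\<lambda>i' j'. \<omega> ^ i * scalar_mat (p ^ t) (\<eta> ^ j) i' j')"
        using \<omega> \<eta> by (simp add: scalar_mat_mult(1) scalar_mat_carrier cyclotomic_field_power)
      also have "\<dots> = \<omega> ^ i * (of_nat (p ^ t) * \<eta> ^ j)" by (simp only: mat_trace_scalar_mult mat_trace_scalar_mat)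
      finally show ?thesis using p_pos by (simp add: ij)
    qed
  qed
qed

text \<open>Only the scalars of the \<open>p ^ t\<close>-th powers are recorded; under the order and
  primitivity conditions of \<open>trace_formula\<close> they determine the whole character.\<close>

definition realizable :: "nat \<Rightarrow> nat \<Rightarrow> complex \<Rightarrow> complex \<Rightarrow> bool" where
  "realizable t d \<omega> \<eta> \<longleftrightarrow> (\<exists>A \<in> carrier (cyclo_mat (p ^ t) d). \<exists>B \<in> carrier (cyclo_mat (p ^ t) d).
     B \<otimes>\<^bsub>cyclo_mat (p ^ t) d\<^esub> A = A [^]\<^bsub>cyclo_mat (p ^ t) d\<^esub> r \<otimes>\<^bsub>cyclo_mat (p ^ t) d\<^esub> B \<and>
     A [^]\<^bsub>cyclo_mat (p ^ t) d\<^esub> (p ^ t) = scalar_mat (p ^ t) \<omega> \<and>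
     B [^]\<^bsub>cyclo_mat (p ^ t) d\<^esub> (p ^ t) = scalar_mat (p ^ t) \<eta>)"

lemma realizable_monomial:
  assumes "c \<le> t" "v \<in> carrier (cyclotomic_field d)" "\<tau> \<in> carrier (cyclotomic_field d)" "v ^ p ^ (N + c) = 1"
    and "(\<Sum>l<p ^ (t - c). (r ^ p ^ c) ^ l) = p ^ (t - c) * u"
  shows "realizable t d (v ^ p ^ c) (\<tau> ^ p ^ (t - c) * v ^ (i0 * u))"
proof -
  interpret R: monomial_rep p N r k t c d i0 v \<tau>
    by unfold_locales (use assms p_prime p_odd N1 r_eq k_nd in auto)
  show ?thesis unfolding realizable_def
    using R.matA_in R.matB_in R.relation R.A_power R.B_power[OF assms(5)] unfolding R.q_def by blast
qed

lemma realizable_linear: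
  assumes "\<omega> \<in> carrier (cyclotomic_field d)" "\<eta> \<in> carrier (cyclotomic_field d)" "\<omega> ^ p ^ N = 1"
  shows "realizable 0 d \<omega> \<eta>"
  using realizable_monomial[of 0 0 \<omega> d \<eta> 1 0] assms by simp

text \<open>A single block (c = 0) with v = zeta p N and \<tau> = 1: the norm of X ^ i is v ^ (i *
  u) with \<open>u\<close> prime to \<open>p\<close>, so every power of v is a norm.\<close>

lemma realizable_small:
  "realizable t (p ^ N) (zeta p N) (zeta p N ^ w)"
proof -
  obtain u where u: "(\<Sum>l<p ^ (t - 0). (r ^ p ^ 0) ^ l) = p ^ (t - 0) * u" "\<not> p dvd u"
    using geometric_sum_exact[OF p_prime p_odd N1 r_eq k_nd, of 0 t] by blast
  obtain i where "zeta p N ^ (i * u) = zeta p N ^ w" using zeta_power_solve[OF p_prime u(2)] by blast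
  moreover have "zeta p N ^ p ^ (N + 0) = 1" using zeta_power_eq_1_iff[OF p_pos] by simp
  ultimately show ?thesis
    using realizable_monomial[OF _ _ _ _ u(1), of "zeta p N" "p ^ N" 1 i] zeta_in_cyclotomic_field by simp
qed

text \<open>As \<open>\<eta> = zeta p l\<close> generates the field, there are \<open>p\<^bsup>l-N\<^esup>\<close> blocks, but at most \<open>p\<^sup>t\<close>. With fewer than
  \<open>p\<^sup>t\<close> of them \<open>\<eta>\<close> is a norm of a power of \<open>X\<close>; with \<open>p\<^sup>t\<close> the blocks are one-dimensional and \<open>\<tau> = \<eta>\<close>.\<close>
lemma realizable_large:
  assumes "l > N" "\<not> p dvd i"
  shows "realizable t (p ^ l) (zeta p l ^ (p ^ (l - N) * i)) (zeta p l)"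
proof (cases "l - N \<le> t")
  case True
  define c where "c = l - N"
  have l: "l = N + c" using assms(1) by (simp add: c_def)
  obtain u where u: "(\<Sum>l<p ^ (t - c). (r ^ p ^ c) ^ l) = p ^ (t - c) * u" "\<not> p dvd u"
    using geometric_sum_exact[OF p_prime p_odd N1 r_eq k_nd, of c t] True by (auto simp: c_def)
  have "\<not> p dvd i * u" using assms(2) u(2) p_prime by (simp add: prime_dvd_mult_iff)
  \<comment> \<open>\<open>j\<close> inverts i * u modulo \<open>p ^ l\<close>, so over v = zeta p l
    ^ i the norm of X ^ j is exactly zeta p l.\<close>
  then obtain j where "zeta p l ^ (j * (i * u)) = zeta p l ^ 1" using zeta_power_solve[OF p_prime] by blast
  hence 1: "(zeta p l ^ i) ^ (j * u) = zeta p l" by (simp add: mult_ac flip: power_mult)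
  have 2: "(zeta p l ^ i) ^ p ^ (N + c) = 1"
    using zeta_power_eq_1_iff[OF p_pos, of l "i * p ^ (N + c)"] by (simp add: l power_mult)
  have "realizable t (p ^ l) ((zeta p l ^ i) ^ p ^ c) (1 ^ p ^ (t - c) * (zeta p l ^ i) ^ (j * u))"
    by (rule realizable_monomial[OF _ _ _ 2 u(1)])
      (use True in \<open>auto simp: c_def intro!: cyclotomic_field_power zeta_in_cyclotomic_field\<close>)
  thus ?thesis unfolding 1 by (simp add: c_def mult.commute flip: power_mult)
next
  case False
  \<comment> \<open>As l - N exceeds \<open>t\<close>, the required scalar has a
    \<open>p ^ t\<close>-th root in the field itself.\<close>
  define v where "v = zeta p l ^ (p ^ (l - N - t) * i)"
  have "p ^ (l - N - t) * p ^ (N + t) = p ^ l" using False assms(1) by (simp flip: power_add)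
  hence "p ^ l dvd p ^ (l - N - t) * i * p ^ (N + t)" by (metis dvd_triv_left mult.assoc mult.commute)
  hence "v ^ p ^ (N + t) = 1" unfolding v_def power_mult[symmetric] by (subst zeta_power_eq_1_iff[OF p_pos])
  hence "realizable t (p ^ l) (v ^ p ^ t) (zeta p l ^ p ^ (t - t) * v ^ (0 * 1))"
    by (intro realizable_monomial) (auto simp: v_def intro!: cyclotomic_field_power zeta_in_cyclotomic_field)
  moreover have "p ^ (l - N) = p ^ (l - N - t) * p ^ t" using False by (simp flip: power_add)
  hence "v ^ p ^ t = zeta p l ^ (p ^ (l - N) * i)" unfolding v_def power_mult[symmetric] by (simp add: mult_ac)
  ultimately show ?thesis by simp
qed

definition chi :: "nat \<Rightarrow> complex \<Rightarrow> complex \<Rightarrow> nat \<Rightarrow> nat \<Rightarrow> complex" where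
  "chi t \<omega> \<eta> x y = (if p ^ t dvd x \<and> p ^ t dvd y then of_nat (p ^ t) * \<omega> ^ (x div p ^ t) * \<eta> ^ (y div p ^ t) else 0)"

lemma realizable_rep:
  assumes "realizable t d \<omega> \<eta>" "t \<le> s" "\<omega> \<in> carrier (cyclotomic_field d)" "\<eta> \<in> carrier (cyclotomic_field d)"
    and "\<omega> ^ p ^ N = 1" "\<eta> ^ p ^ (m - t) = 1"
    and "\<And>j. t \<ge> 1 \<Longrightarrow> \<not> p dvd j \<Longrightarrow> \<omega> ^ (p ^ (N - 1) * j) \<noteq> 1"
  shows "\<exists>\<rho> \<in> hom G (cyclo_mat (p ^ t) d). \<rho> \<one> = \<one>\<^bsub>cyclo_mat (p ^ t) d\<^esub> \<and>
    (\<forall>x y. mat_trace (p ^ t) (\<rho> (el x y)) = chi t \<omega> \<eta> x y)"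
proof -
  let ?M = "cyclo_mat (p ^ t) d"
  interpret M: monoid ?M by (rule monoid_cyclo_mat)
  obtain A B where AB: "A \<in> carrier ?M" "B \<in> carrier ?M"
    and rel: "B \<otimes>\<^bsub>?M\<^esub> A = A [^]\<^bsub>?M\<^esub> r \<otimes>\<^bsub>?M\<^esub> B"
    and At: "A [^]\<^bsub>?M\<^esub> (p ^ t) = scalar_mat (p ^ t) \<omega>" and Bt: "B [^]\<^bsub>?M\<^esub> (p ^ t) = scalar_mat (p ^ t) \<eta>"
    using assms(1) unfolding realizable_def by blast
  have "p ^ n = p ^ t * (p ^ N * p ^ (s - t))" using assms(2) by (simp add: n_eq flip: power_add)
  hence An: "A [^]\<^bsub>?M\<^esub> (p ^ n) = \<one>\<^bsub>?M\<^esub>"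
    using AB(1) assms(3,5) by (simp add: At scalar_mat_power cyclo_mat_one power_mult flip: M.nat_pow_pow)
  have "p ^ m = p ^ t * p ^ (m - t)" using assms(2) s_le by (simp flip: power_add)
  hence Bm: "B [^]\<^bsub>?M\<^esub> (p ^ m) = \<one>\<^bsub>?M\<^esub>"
    using AB(2) assms(4,6) by (simp add: Bt scalar_mat_power cyclo_mat_one flip: M.nat_pow_pow)
  obtain \<rho> where \<rho>: "\<rho> \<in> hom G ?M" "\<rho> \<one> = \<one>\<^bsub>?M\<^esub>" "\<And>x y. \<rho> (el x y) = A [^]\<^bsub>?M\<^esub> x \<otimes>\<^bsub>?M\<^esub> B [^]\<^bsub>?M\<^esub> y"
    using extend_to_hom[OF monoid_cyclo_mat AB An Bm rel] by blast
  show ?thesis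
    using \<rho>(1,2) by (intro bexI[of _ \<rho>] conjI) (simp_all add: \<rho>(3) chi_def trace_formula[OF AB rel An Bm assms(3,4) At Bt assms(7)])
qed

text \<open>An entry \<open>(u, w)\<close> of \<open>specs t l\<close> stands for the Galois class of the irreducible character
  of degree \<open>p ^ t\<close> with character field \<open>\<rat>(\<zeta>)\<close>, \<open>\<zeta> = zeta p l\<close>, on which \<open>a ^ p ^ t\<close> and \<open>b ^ p ^ t\<close> act
  as the scalars \<open>\<zeta> ^ u\<close> and \<open>\<zeta> ^ w\<close>. One of \<open>u\<close>, \<open>w\<close> is normalised to \<open>1\<close>.\<close>
definition specs :: "nat \<Rightarrow> nat \<Rightarrow> (nat \<times> nat) list" where
  "specs t l =
    (if t = 0 then
       (if l \<le> N then map (\<lambda>i. (1, p ^ (l - m) * i)) [0..<p ^ min l m] else []) @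
       (if 1 \<le> l \<and> l \<le> m then map (\<lambda>i. (p ^ (l - min N (l - 1)) * i, 1)) [0..<p ^ min N (l - 1)] else [])
     else if l = N then map (\<lambda>i. (1, p ^ (l - (m - t)) * i)) [0..<p ^ min l (m - t)]
     else map (\<lambda>i. (p ^ (l - N) * i, 1)) (filter (\<lambda>i. \<not> p dvd i) [0..<p ^ N]))"

text \<open>The degrees \<open>p ^ t\<close> and conductors \<open>p ^ l\<close> that occur. For
  positive \<open>t\<close>, \<omega> is a primitive \<open>p ^ N\<close>-th root of unity, so
  \<open>l\<close> starts at \<open>N\<close>; the order of \<eta> lets it grow to
  \<open>m - t\<close>.\<close>

definition spec_keys :: "(nat \<times> nat) set" where
  "spec_keys = {0} \<times> {..max N m} \<union> (SIGMA t:{1..s}. {N..max N (m - t)})"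

lemma zeta_power_power_1:
  assumes "l \<le> e + f"
  shows "(zeta p l ^ (p ^ e * i)) ^ p ^ f = 1"
proof -
  have "p ^ l dvd p ^ (e + f)" using assms by (rule le_imp_power_dvd)
  hence "p ^ l dvd p ^ e * i * p ^ f" by (simp add: power_add mult_ac)
  thus ?thesis using zeta_power_eq_1_iff[OF p_pos] by (simp flip: power_mult)
qed

lemma zeta_N_primitive:
  assumes "\<not> p dvd i" "\<not> p dvd j"
  shows "(zeta p N ^ i) ^ (p ^ (N - 1) * j) \<noteq> 1"
proof
  assume "(zeta p N ^ i) ^ (p ^ (N - 1) * j) = 1"
  hence "p ^ N dvd i * (p ^ (N - 1) * j)" using zeta_power_eq_1_iff[OF p_pos] by (simp flip: power_mult)
  moreover have "p ^ N = p ^ (N - 1) * p" using N1 by (simp flip: power_Suc2)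
  ultimately have "p ^ (N - 1) * p dvd p ^ (N - 1) * (i * j)" by (simp add: mult_ac)
  hence "p dvd i * j" using p_pos by simp
  thus False using assms p_prime by (simp add: prime_dvd_mult_iff)
qed

lemma specs_rep:
  assumes "(t, l) \<in> spec_keys" "(u, w) \<in> set (specs t l)"
  shows "\<exists>\<rho> \<in> hom G (cyclo_mat (p ^ t) (p ^ l)). \<rho> \<one> = \<one>\<^bsub>cyclo_mat (p ^ t) (p ^ l)\<^esub> \<and>
    (\<forall>x y. mat_trace (p ^ t) (\<rho> (el x y)) = chi t (zeta p l ^ u) (zeta p l ^ w) x y)"
proof -
  have z: "zeta p l ^ e \<in> carrier (cyclotomic_field (p ^ l))" for e
    by (intro cyclotomic_field_power zeta_in_cyclotomic_field)
  show ?thesis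
  proof (cases "t = 0")
    case True
    have *: "(zeta p l ^ u) ^ p ^ N = 1 \<and> (zeta p l ^ w) ^ p ^ m = 1"
      using assms(2) True zeta_power_power_1[of l 0 N 1] zeta_power_power_1[of l 0 m 1]
        zeta_power_power_1[of l "l - m" m] zeta_power_power_1[of l "l - min N (l - 1)" N]
      by (auto simp: specs_def split: if_splits)
    hence "realizable t (p ^ l) (zeta p l ^ u) (zeta p l ^ w)"
      using realizable_linear[OF z z] True by blast
    thus ?thesis by (rule realizable_rep) (use * True z in auto)
  next
    case False
    hence t: "1 \<le> t" "t \<le> s" "N \<le> l" "l \<le> max N (m - t)" using assms(1) by (auto simp: spec_keys_def)
    show ?thesis
    proof (cases "l = N")
      case True
      then obtain i where u: "u = 1" "w = p ^ (l - (m - t)) * i" using assms(2) False by (auto simp: specs_def)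
      have "realizable t (p ^ l) (zeta p l ^ u) (zeta p l ^ w)" using realizable_small True u by simp
      thus ?thesis
        by (rule realizable_rep)
          (use t z u zeta_power_power_1[of l 0 N 1] zeta_power_power_1[of l "l - (m - t)" "m - t" i] 
            zeta_N_primitive[OF one_nd] True zeta_in_cyclotomic_field in auto)
    next
      case l: False
      then obtain i where u: "w = 1" "u = p ^ (l - N) * i" "\<not> p dvd i" using assms(2) False by (auto simp: specs_def)
      have "l > N" "l \<le> m - t" using l t by auto
      hence "realizable t (p ^ l) (zeta p l ^ u) (zeta p l ^ w)" using realizable_large u by simp
      moreover have "zeta p l ^ u = zeta p N ^ i" unfolding u by (rule zeta_power_lift[OF t(3) p_pos])
      ultimately show ?thesis
        by (intro realizable_rep)
          (use t z u zeta_power_power_1[of l "l - N" N i] zeta_power_power_1[of l 0 "m - t" 1] 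
            zeta_N_primitive[OF u(3)] z[of "p ^ (l - N) * i"] zeta_in_cyclotomic_field[of p l] \<open>l \<le> m - t\<close> in auto)
    qed
  qed
qed

text \<open>\<open>e\<close> is the exponent of the Galois automorphism carrying the listed pair to
  the given one. It is dictated by the scalar of larger order, normalised to exponent 1; ties go to
  \<omega>.\<close>

lemma specs_cover:
  assumes "t \<le> s" "t \<ge> 1 \<longrightarrow> \<not> p dvd i"
  shows "\<exists>l u w e. (t, l) \<in> spec_keys \<and> (u, w) \<in> set (specs t l) \<and> \<not> p dvd e \<and>
    zeta p N ^ i = zeta p l ^ (u * e) \<and> zeta p (m - t) ^ j = zeta p l ^ (w * e)"
proof -
  have "\<exists>l1\<le>N. \<exists>k1. \<not> p dvd k1 \<and> zeta p N ^ i = zeta p l1 ^ k1 \<and> (t \<ge> 1 \<longrightarrow> l1 = N)"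
  proof (cases "t \<ge> 1")
    case True
    thus ?thesis using assms(2) by blast
  next
    case False
    thus ?thesis using zeta_power_primitive[OF p_prime, of N i] by blast
  qed
  then obtain l1 k1 where 1: "l1 \<le> N" "\<not> p dvd k1" "zeta p N ^ i = zeta p l1 ^ k1" "t \<ge> 1 \<longrightarrow> l1 = N" by blast
  obtain l2 k2 where 2: "l2 \<le> m - t" "\<not> p dvd k2" "zeta p (m - t) ^ j = zeta p l2 ^ k2"
    using zeta_power_primitive[OF p_prime, of "m - t" j] by blast
  show ?thesis
  proof (cases "l2 \<le> l1")
    case True
    define l' where "l' = min l1 (m - t)"
    have l': "l2 \<le> l'" "l' \<le> l1" using True 2 by (auto simp: l'_def)
    obtain x where x: "x < p ^ l'" "zeta p l' ^ (x * k1) = zeta p l' ^ (p ^ (l' - l2) * k2)"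
      using zeta_power_solve[OF p_prime 1(2)] by blast
    have "l1 - l' = l1 - (m - t)" by (auto simp: l'_def)
    hence mem: "(1, p ^ (l1 - (m - t)) * x) \<in> set (specs t l1)"
      using x(1) 1 by (auto simp: specs_def l'_def)
    have "zeta p l1 ^ (p ^ (l1 - (m - t)) * x * k1) = zeta p l' ^ (x * k1)"
      using zeta_power_lift[OF l'(2) p_pos, of "x * k1"] \<open>l1 - l' = l1 - (m - t)\<close> by (simp add: mult_ac)
    also have "\<dots> = zeta p (m - t) ^ j" unfolding x(2) zeta_power_lift[OF l'(1) p_pos] 2(3) ..
    finally have "zeta p (m - t) ^ j = zeta p l1 ^ (p ^ (l1 - (m - t)) * x * k1)" ..
    moreover have "(t, l1) \<in> spec_keys" using 1 assms by (auto simp: spec_keys_def)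
    moreover have "zeta p N ^ i = zeta p l1 ^ (1 * k1)" using 1(3) by simp
    ultimately show ?thesis using mem 1(2) by blast
  next
    case False
    \<comment> \<open>For linear characters \<omega> has order strictly below that of \<eta> here,
      hence \<open>l2 - 1\<close>; equal orders belong to the other list.\<close>
    define l' where "l' = (if t = 0 then min N (l2 - 1) else N)"
    have l': "l1 \<le> l'" "l' \<le> l2" using False 1 by (auto simp: l'_def)
    obtain x where x: "x < p ^ l'" "zeta p l' ^ (x * k2) = zeta p l' ^ (p ^ (l' - l1) * k1)"
      and nd: "l' \<ge> 1 \<longrightarrow> \<not> p dvd p ^ (l' - l1) * k1 \<longrightarrow> \<not> p dvd x"
      using zeta_power_solve[OF p_prime 2(2)] by blast
    have "\<not> p dvd x" if "t \<ge> 1" using that nd N1 1 by (simp add: l'_def)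
    hence mem: "(p ^ (l2 - l') * x, 1) \<in> set (specs t l2)"
      using x(1) 1 2 False by (auto simp: specs_def l'_def)
    have "zeta p l2 ^ (p ^ (l2 - l') * x * k2) = zeta p l' ^ (x * k2)"
      using zeta_power_lift[OF l'(2) p_pos, of "x * k2"] by (simp add: mult_ac)
    also have "\<dots> = zeta p N ^ i" unfolding x(2) zeta_power_lift[OF l'(1) p_pos] 1(3) ..
    finally have "zeta p N ^ i = zeta p l2 ^ (p ^ (l2 - l') * x * k2)" ..
    moreover have "(t, l2) \<in> spec_keys" using 1 2 assms False by (auto simp: spec_keys_def)
    moreover have "zeta p (m - t) ^ j = zeta p l2 ^ (1 * k2)" using 2(3) by simp
    ultimately show ?thesis using mem 2(2) by blast
  qed
qed

end

section \<open>An isomorphism criterion for rational group algebras\<close>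

lemma homogeneous_system_nontrivial:
  fixes M :: "'x \<Rightarrow> 'j \<Rightarrow> 'a :: field"
  assumes "finite J" "finite X" "card J < card X"
  shows "\<exists>c. (\<exists>x\<in>X. c x \<noteq> 0) \<and> (\<forall>j\<in>J. (\<Sum>x\<in>X. c x * M x j) = 0)"
  using assms
proof (induction J arbitrary: X M rule: finite_induct)
  case empty
  hence "X \<noteq> {}" by auto
  thus ?case by (intro exI[of _ "\<lambda>_. 1"]) auto
next
  case (insert j0 J)
  show ?case
  proof (cases "\<forall>x\<in>X. M x j0 = 0")
    case True
    obtain c where "\<exists>x\<in>X. c x \<noteq> 0" "\<forall>j\<in>J. (\<Sum>x\<in>X. c x * M x j) = 0"
      using insert.IH[of X M] insert.prems insert.hyps by auto
    thus ?thesis using True by (intro exI[of _ c]) auto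
  next
    case False
    then obtain x0 where x0: "x0 \<in> X" "M x0 j0 \<noteq> 0" by blast
    define X' where "X' = X - {x0}"
    have X': "finite X'" "X = insert x0 X'" "x0 \<notin> X'" using x0 insert.prems by (auto simp: X'_def)
    have "card J < card X'" using insert.prems insert.hyps X' by simp
    then obtain c where c: "\<exists>x\<in>X'. c x \<noteq> 0"
        "\<forall>j\<in>J. (\<Sum>x\<in>X'. c x * (M x j - M x j0 / M x0 j0 * M x0 j)) = 0"
      using insert.IH[OF X'(1), of "\<lambda>x j. M x j - M x j0 / M x0 j0 * M x0 j"] by blast
    \<comment> \<open>Gaussian elimination: \<open>x0\<close> is the pivot of equation
      \<open>j0\<close>, and its coefficient is fixed by solving that equation.\<close>
    define c' where "c' = c(x0 := - (\<Sum>x\<in>X'. c x * M x j0) / M x0 j0)"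
    have sum: "(\<Sum>x\<in>X. c' x * M x j) = (\<Sum>x\<in>X'. c x * (M x j - M x j0 / M x0 j0 * M x0 j))" for j
    proof -
      have "(\<Sum>x\<in>X. c' x * M x j) = c' x0 * M x0 j + (\<Sum>x\<in>X'. c' x * M x j)" using X' by simp
      also have "(\<Sum>x\<in>X'. c' x * M x j) = (\<Sum>x\<in>X'. c x * M x j)"
        using X'(3) by (intro sum.cong) (auto simp: c'_def)
      finally show ?thesis
        by (simp add: c'_def right_diff_distrib sum_subtractf sum_distrib_right sum_divide_distrib mult.assoc)
    qed
    have "(\<Sum>x\<in>X. c' x * M x j) = 0" if "j \<in> insert j0 J" for j
      unfolding sum using that c(2) x0(2) by auto
    moreover have "\<exists>x\<in>X. c' x \<noteq> 0" using c(1) X' by (auto simp: c'_def)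
    ultimately show ?thesis by blast
  qed
qed

text \<open>Surjectivity is linear algebra: any target element and the images of the group elements
  are more vectors than the dimension allows, and injectivity forces the target element to occur in
  the resulting relation.\<close>

lemma rat_group_algebra_iso:
  fixes G (structure) and L :: "(nat \<times> nat) list" and \<rho> :: "nat \<Rightarrow> 'a \<Rightarrow> nat \<Rightarrow> nat \<Rightarrow> complex"
  assumes "group G" "finite (carrier G)" "prime p"
    and hom: "\<And>i. i < length L \<Longrightarrow> \<rho> i \<in> hom G (cyclo_mat (fst (L ! i)) (p ^ snd (L ! i)))"
    and one: "\<And>i. i < length L \<Longrightarrow> \<rho> i \<one> = \<one>\<^bsub>cyclo_mat (fst (L ! i)) (p ^ snd (L ! i))\<^esub>"
    and ker: "\<And>f :: 'a \<Rightarrow> rat. (\<And>i j k. i < length L \<Longrightarrow> (\<Sum>g\<in>carrier G. of_rat (f g) * \<rho> i g j k) = 0) \<Longrightarrow> f \<one> = 0"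
    and dim: "(\<Sum>i<length L. fst (L ! i) ^ 2 * zeta_degree p (snd (L ! i))) \<le> card (carrier G)"
  shows "rat_group_algebra G \<simeq> ring_dsum (map (\<lambda>(q, l). cyclo_mat q (p ^ l)) L)"
proof -
  interpret group G by (rule assms(1))
  let ?T = "ring_dsum (map (\<lambda>(q, l). cyclo_mat q (p ^ l)) L)"
  let ?q = "\<lambda>i. fst (L ! i)" and ?l = "\<lambda>i. snd (L ! i)"
  let ?M = "\<lambda>i. cyclo_mat (?q i) (p ^ ?l i)"
  define ent where "ent = (\<lambda>(f :: 'a \<Rightarrow> rat) i j k. \<Sum>g\<in>carrier G. of_rat (f g) * \<rho> i g j k)"
  define \<Phi> where "\<Phi> = (\<lambda>f i. if i < length L then ent f i else undefined)"
  have \<rho>_in: "\<rho> i g \<in> carrier (?M i)" if "i < length L" "g \<in> carrier G" for i g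
    using hom[OF that(1)] that(2) by (auto simp: hom_def)
  have \<rho>_mult: "\<rho> i (g \<otimes> h) = \<rho> i g \<otimes>\<^bsub>?M i\<^esub> \<rho> i h" if "i < length L" "g \<in> carrier G" "h \<in> carrier G" for i g h
    using hom[OF that(1)] that by (auto simp: hom_def)
  have ent_in: "ent f i \<in> carrier (?M i)" if "i < length L" for f i
    using \<rho>_in[OF that] unfolding ent_def cyclo_mat_carrier
    by (auto intro!: cyclotomic_field_sum cyclotomic_field_closed sum.neutral)
  have \<rho>_mult_ent: "\<rho> i (g \<otimes> h) j k = (\<Sum>l<?q i. \<rho> i g j l * \<rho> i h l k)"
    if "i < length L" "g \<in> carrier G" "h \<in> carrier G" for i g h j k
  proof (cases "j < ?q i \<and> k < ?q i")
    case True
    thus ?thesis using that by (simp add: \<rho>_mult cyclo_mat_mult \<rho>_in)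
  next
    case False
    hence "\<rho> i g j l * \<rho> i h l k = 0" for l
      using \<rho>_in[OF that(1,2)] \<rho>_in[OF that(1,3)] by (auto simp: cyclo_mat_carrier)
    hence "(\<Sum>l<?q i. \<rho> i g j l * \<rho> i h l k) = 0" by (intro sum.neutral ballI)
    thus ?thesis using False that by (auto simp: \<rho>_mult cyclo_mat_mult \<rho>_in)
  qed
  have "\<Phi> \<in> ring_hom (rat_group_algebra G) ?T"
  proof (rule ring_hom_memI)
    fix f assume "f \<in> carrier (rat_group_algebra G)"
    show "\<Phi> f \<in> carrier ?T" using ent_in by (auto simp: ring_dsum_def \<Phi>_def case_prod_unfold)
  next
    fix f h assume "f \<in> carrier (rat_group_algebra G)" "h \<in> carrier (rat_group_algebra G)"
    have "ent (f \<otimes>\<^bsub>rat_group_algebra G\<^esub> h) i = ent f i \<otimes>\<^bsub>?M i\<^esub> ent h i" if i: "i < length L" for i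
    proof (intro ext)
      fix j k
      have "ent (f \<otimes>\<^bsub>rat_group_algebra G\<^esub> h) i j k
        = (\<Sum>x\<in>carrier G. \<Sum>y\<in>carrier G. of_rat (f y) * of_rat (h (inv y \<otimes> x)) * \<rho> i x j k)"
        by (simp add: ent_def rat_group_algebra_def of_rat_sum of_rat_mult sum_distrib_right)
      also have "\<dots> = (\<Sum>y\<in>carrier G. \<Sum>x\<in>carrier G. of_rat (f y) * of_rat (h (inv y \<otimes> x)) * \<rho> i x j k)"
        by (rule sum.swap)
      also have "\<dots> = (\<Sum>y\<in>carrier G. \<Sum>z\<in>carrier G. of_rat (f y) * of_rat (h z) * \<rho> i (y \<otimes> z) j k)"
      proof (rule sum.cong[OF refl])
        fix y assume y: "y \<in> carrier G"
        show "(\<Sum>x\<in>carrier G. of_rat (f y) * of_rat (h (inv y \<otimes> x)) * \<rho> i x j k)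
          = (\<Sum>z\<in>carrier G. of_rat (f y) * of_rat (h z) * \<rho> i (y \<otimes> z) j k)"
          by (rule sum.reindex_bij_witness[of _ "\<lambda>z. y \<otimes> z" "\<lambda>x. inv y \<otimes> x"])
            (use y in \<open>auto simp: m_assoc[symmetric]\<close>)
      qed
      also have "\<dots> = (\<Sum>y\<in>carrier G. \<Sum>z\<in>carrier G. \<Sum>l<?q i. (of_rat (f y) * \<rho> i y j l) * (of_rat (h z) * \<rho> i z l k))"
        by (intro sum.cong refl) (simp add: \<rho>_mult_ent[OF i] sum_distrib_left mult_ac)
      also have "\<dots> = (\<Sum>l<?q i. ent f i j l * ent h i l k)"
        unfolding ent_def sum_product
        by (simp only: sum.swap[of _ "{..<?q i}" "carrier G"])
      also have "\<dots> = (ent f i \<otimes>\<^bsub>?M i\<^esub> ent h i) j k"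
      proof (cases "j < ?q i \<and> k < ?q i")
        case False
        hence "ent f i j l * ent h i l k = 0" for l using ent_in[OF i] by (auto simp: cyclo_mat_carrier)
        hence "(\<Sum>l<?q i. ent f i j l * ent h i l k) = 0" by (intro sum.neutral ballI)
        thus ?thesis using False by (auto simp: cyclo_mat_mult[OF ent_in[OF i] ent_in[OF i]])
      qed (simp add: cyclo_mat_mult[OF ent_in[OF i] ent_in[OF i]])
      finally show "ent (f \<otimes>\<^bsub>rat_group_algebra G\<^esub> h) i j k = (ent f i \<otimes>\<^bsub>?M i\<^esub> ent h i) j k" .
    qed
    thus "\<Phi> (f \<otimes>\<^bsub>rat_group_algebra G\<^esub> h) = \<Phi> f \<otimes>\<^bsub>?T\<^esub> \<Phi> h"
      by (simp add: \<Phi>_def ring_dsum_def case_prod_unfold fun_eq_iff)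
    have "ent (f \<oplus>\<^bsub>rat_group_algebra G\<^esub> h) i = ent f i \<oplus>\<^bsub>?M i\<^esub> ent h i" if i: "i < length L" for i
    proof (intro ext)
      fix j k
      have "ent (f \<oplus>\<^bsub>rat_group_algebra G\<^esub> h) i j k = ent f i j k + ent h i j k"
        by (simp add: ent_def rat_group_algebra_def of_rat_add distrib_right sum.distrib)
      thus "ent (f \<oplus>\<^bsub>rat_group_algebra G\<^esub> h) i j k = (ent f i \<oplus>\<^bsub>?M i\<^esub> ent h i) j k"
        using ent_in[OF i] by (auto simp: matrix_ring_def)
    qed
    thus "\<Phi> (f \<oplus>\<^bsub>rat_group_algebra G\<^esub> h) = \<Phi> f \<oplus>\<^bsub>?T\<^esub> \<Phi> h"
      by (simp add: \<Phi>_def ring_dsum_def case_prod_unfold fun_eq_iff)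
  next
    have "ent \<one>\<^bsub>rat_group_algebra G\<^esub> i j k = \<rho> i \<one> j k" if "i < length L" for i j k
    proof -
      have "ent \<one>\<^bsub>rat_group_algebra G\<^esub> i j k = (\<Sum>g\<in>carrier G. if g = \<one> then \<rho> i \<one> j k else 0)"
        unfolding ent_def by (intro sum.cong) (auto simp: rat_group_algebra_def)
      thus ?thesis using assms(2) by simp
    qed
    thus "\<Phi> \<one>\<^bsub>rat_group_algebra G\<^esub> = \<one>\<^bsub>?T\<^esub>"
      by (simp add: \<Phi>_def ring_dsum_def case_prod_unfold fun_eq_iff one)
  qed
  \<comment> \<open>The kernel is stable under right translation, so the statement at the identity,
    applied to all translates, covers every coefficient.\<close>
  moreover have kernel: "f x = 0" if f: "\<And>i j k. i < length L \<Longrightarrow> ent f i j k = 0" and x: "x \<in> carrier G" for f x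
  proof -
    have "(\<Sum>g\<in>carrier G. of_rat (f (g \<otimes> x)) * \<rho> i g j k) = 0" if i: "i < length L" for i j k
    proof -
      have "(\<Sum>g\<in>carrier G. of_rat (f (g \<otimes> x)) * \<rho> i g j k) = (\<Sum>g\<in>carrier G. of_rat (f g) * \<rho> i (g \<otimes> inv x) j k)"
        by (rule sum.reindex_bij_witness[of _ "\<lambda>g. g \<otimes> inv x" "\<lambda>g. g \<otimes> x"]) (use x in \<open>auto simp: m_assoc\<close>)
      also have "\<dots> = (\<Sum>l<?q i. ent f i j l * \<rho> i (inv x) l k)"
        using x by (simp add: \<rho>_mult_ent[OF i] ent_def sum_distrib_left sum_distrib_right mult.assoc, subst sum.swap) (rule refl)
      finally show ?thesis using f[OF i] by simp
    qed
    hence "f (\<one> \<otimes> x) = 0" by (rule ker)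
    thus ?thesis using x by simp
  qed
  moreover have "inj_on \<Phi> (carrier (rat_group_algebra G))"
  proof (rule inj_onI)
    fix f h assume fh: "f \<in> carrier (rat_group_algebra G)" "h \<in> carrier (rat_group_algebra G)" "\<Phi> f = \<Phi> h"
    have "ent (\<lambda>x. f x - h x) i j k = 0" if "i < length L" for i j k
    proof -
      have "ent f i = ent h i" using fun_cong[OF fh(3), of i] that by (simp add: \<Phi>_def)
      moreover have "ent (\<lambda>x. f x - h x) i j k = ent f i j k - ent h i j k"
        by (simp add: ent_def of_rat_diff left_diff_distrib sum_subtractf)
      ultimately show ?thesis by simp
    qed
    hence "f x - h x = 0" if "x \<in> carrier G" for x using kernel that by blast
    thus "f = h" using fh by (intro extensionalityI[of f "carrier G"]) (auto simp: rat_group_algebra_def PiE_iff)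
  qed
  moreover have "carrier ?T \<subseteq> \<Phi> ` carrier (rat_group_algebra G)"
  proof
    fix T assume T: "T \<in> carrier ?T"
    \<comment> \<open>Coordinates with respect to the spanning powers, chosen arbitrarily: a
      relation between coordinates implies one between the values.\<close>
    define cf where "cf = (\<lambda>l z. SOME c. z = (\<Sum>e<zeta_degree p l. of_rat (c e) * zeta p l ^ e))"
    have cf: "z = (\<Sum>e<zeta_degree p l. of_rat (cf l z e) * zeta p l ^ e)"
      if "z \<in> carrier (cyclotomic_field (p ^ l))" for l z
      unfolding cf_def by (rule someI_ex[OF cyclotomic_field_span[OF assms(3) that]])
    have T_in: "T i \<in> carrier (?M i)" if "i < length L" for i
      using T that by (simp add: ring_dsum_def case_prod_unfold)
    define val where "val = (\<lambda>x i j k. case x of None \<Rightarrow> T i j k | Some g \<Rightarrow> \<rho> i g j k)"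
    define J where "J = (SIGMA i:{..<length L}. {..<?q i} \<times> {..<?q i} \<times> {..<zeta_degree p (?l i)})"
    \<comment> \<open>\<open>None\<close> stands for the target element \<open>T\<close>,
      \<open>Some g\<close> for the image of \<open>g\<close>.\<close>
    define X where "X = insert None (Some ` carrier G)"
    have val_in: "val x i \<in> carrier (?M i)" if "x \<in> X" "i < length L" for x i
      using that T_in \<rho>_in by (auto simp: X_def val_def)
    have "card J = (\<Sum>i<length L. ?q i ^ 2 * zeta_degree p (?l i))"
      unfolding J_def by (subst card_SigmaI) (auto simp: card_cartesian_product power2_eq_square mult.assoc)
    also have "\<dots> < card X"
      using dim assms(2) by (simp add: X_def card_image)
    finally have "card J < card X" .
    moreover have "finite J" "finite X" using assms(2) by (auto simp: J_def X_def)
    ultimately obtain c :: "'a option \<Rightarrow> rat" where c: "\<exists>x\<in>X. c x \<noteq> 0"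
        "\<And>i j k e. (i, j, k, e) \<in> J \<Longrightarrow> (\<Sum>x\<in>X. c x * (cf (?l i) (val x i j k) e)) = 0"
      using homogeneous_system_nontrivial[of J X "\<lambda>x (i, j, k, e). cf (?l i) (val x i j k) e"] by fastforce
    have rel: "(\<Sum>x\<in>X. of_rat (c x) * val x i j k) = 0" if i: "i < length L" for i j k
    proof (cases "j < ?q i \<and> k < ?q i")
      case True
      have "(\<Sum>x\<in>X. of_rat (c x) * val x i j k)
        = (\<Sum>x\<in>X. \<Sum>e<zeta_degree p (?l i). of_rat (c x) * (of_rat (cf (?l i) (val x i j k) e) * zeta p (?l i) ^ e))"
        by (intro sum.cong refl, subst cf[OF cyclo_mat_entry[OF val_in[OF _ i]]]) (auto simp: sum_distrib_left)
      also have "\<dots> = (\<Sum>e<zeta_degree p (?l i). of_rat (\<Sum>x\<in>X. c x * cf (?l i) (val x i j k) e) * zeta p (?l i) ^ e)"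
        by (subst sum.swap) (simp add: of_rat_sum of_rat_mult sum_distrib_right mult.assoc)
      also have "\<dots> = 0" using c(2) i True by (intro sum.neutral) (auto simp: J_def)
      finally show ?thesis .
    next
      case False
      hence "val x i j k = 0" if "x \<in> X" for x using val_in[OF that i] by (auto simp: cyclo_mat_carrier)
      thus ?thesis by simp
    qed
    have split: "(\<Sum>x\<in>X. of_rat (c x) * val x i j k) = of_rat (c None) * T i j k + ent (\<lambda>g. c (Some g)) i j k" for i j k
      using assms(2) unfolding X_def ent_def val_def by (simp add: sum.reindex)
    have c0: "c None \<noteq> 0"
    proof
      assume 0: "c None = 0"
      hence "ent (\<lambda>g. c (Some g)) i j k = 0" if "i < length L" for i j k using rel[OF that] split by simp
      hence "c (Some g) = 0" if "g \<in> carrier G" for g using kernel[of "\<lambda>g. c (Some g)"] that by blast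
      thus False using 0 c(1) by (auto simp: X_def)
    qed
    define f where "f = (\<lambda>g\<in>carrier G. - c (Some g) / c None)"
    have "ent f i = T i" if "i < length L" for i
    proof (intro ext)
      fix j k
      have "ent f i j k = - ent (\<lambda>g. c (Some g)) i j k / of_rat (c None)"
        by (simp add: ent_def f_def of_rat_divide of_rat_minus sum_divide_distrib sum_negf)
      also have "\<dots> = T i j k" using rel[OF that, of j k] split[of i j k] c0 by (simp add: field_simps add_eq_0_iff)
      finally show "ent f i j k = T i j k" .
    qed
    moreover have "T i = undefined" if "\<not> i < length L" for i using T that by (auto simp: ring_dsum_def)
    ultimately have "\<Phi> f = T" by (auto simp: \<Phi>_def)
    moreover have "f \<in> carrier (rat_group_algebra G)" by (auto simp: f_def rat_group_algebra_def)
    ultimately show "T \<in> \<Phi> ` carrier (rat_group_algebra G)" by blast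
  qed
  ultimately have "\<Phi> \<in> ring_iso (rat_group_algebra G) ?T"
    unfolding ring_iso_def bij_betw_def by (auto dest: ring_hom_closed)
  thus ?thesis by (auto simp: is_ring_iso_def)
qed

section \<open>Injectivity and dimension count\<close>

lemma multiples_below:
  assumes "(p :: nat) > 0"
  shows "{i. i < p * k \<and> p dvd i} = (\<lambda>i. p * i) ` {..<k}"
  using assms by (auto elim!: dvdE)

text \<open>The regular character of a cyclic group of order \<open>p ^ d\<close>, evaluated at the
  \<open>x\<close>-th power of a generator.\<close>

definition pow_ind :: "nat \<Rightarrow> nat \<Rightarrow> nat \<Rightarrow> complex" where
  "pow_ind p d x = (if p ^ d dvd x then of_nat (p ^ d) else 0)"

lemma sum_zeta_powers:
  assumes "p > 0"
  shows "(\<Sum>i<p ^ d. zeta p d ^ (i * x)) = pow_ind p d x"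
proof -
  let ?z = "zeta p d ^ x"
  have "(\<Sum>i<p ^ d. zeta p d ^ (i * x)) = (\<Sum>i<p ^ d. ?z ^ i)" by (simp add: mult.commute flip: power_mult)
  also have "\<dots> = pow_ind p d x"
  proof (cases "p ^ d dvd x")
    case True
    thus ?thesis using zeta_power_eq_1_iff[OF assms, of d x] by (simp add: pow_ind_def)
  next
    case False
    have "(?z - 1) * (\<Sum>i<p ^ d. ?z ^ i) = ?z ^ p ^ d - 1" by (rule power_diff_1_eq[symmetric])
    also have "\<dots> = 0" using zeta_power_eq_1_iff[OF assms, of d "x * p ^ d"] by (simp add: power_mult)
    finally show ?thesis using False zeta_power_eq_1_iff[OF assms, of d x] by (simp add: pow_ind_def)
  qed
  finally show ?thesis .
qed

text \<open>A Ramanujan sum: the indices divisible by \<open>p\<close> contribute the sum over all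
  \<open>p ^ (d - 1)\<close>-th roots of unity.\<close>

lemma sum_zeta_powers_primitive:
  assumes "p > 0" "d \<ge> 1"
  shows "(\<Sum>i | i < p ^ d \<and> \<not> p dvd i. zeta p d ^ (i * x)) = pow_ind p d x - pow_ind p (d - 1) x"
proof -
  have pd: "p ^ d = p * p ^ (d - 1)" using assms(2) by (simp flip: power_Suc)
  have "(\<Sum>i<p ^ d. zeta p d ^ (i * x)) = (\<Sum>i | i < p ^ d \<and> \<not> p dvd i. zeta p d ^ (i * x)) + (\<Sum>i | i < p ^ d \<and> p dvd i. zeta p d ^ (i * x))"
    by (subst sum.union_disjoint[symmetric]) (auto intro!: sum.cong)
  also have "(\<Sum>i | i < p ^ d \<and> p dvd i. zeta p d ^ (i * x)) = (\<Sum>i<p ^ (d - 1). zeta p (d - 1) ^ (i * x))"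
  proof -
    have "zeta p d ^ (p * i * x) = zeta p (d - 1) ^ (i * x)" for i
      using zeta_power_lift[of "d - 1" d p "i * x"] assms by (simp add: mult.assoc)
    thus ?thesis using assms(1) unfolding pd multiples_below[OF assms(1)]
      by (subst sum.reindex) (auto intro: inj_onI)
  qed
  finally show ?thesis unfolding sum_zeta_powers[OF assms(1)] by simp
qed

lemma card_non_multiples:
  assumes "p > 0" "d \<ge> 1"
  shows "card {i. i < p ^ d \<and> \<not> p dvd i} = p ^ d - p ^ (d - 1)"
proof -
  have pd: "p ^ d = p * p ^ (d - 1)" using assms(2) by (simp flip: power_Suc)
  have "{i. i < p ^ d \<and> \<not> p dvd i} = {..<p ^ d} - {i. i < p ^ d \<and> p dvd i}" by auto
  also have "card \<dots> = p ^ d - card {i. i < p ^ d \<and> p dvd i}" by (subst card_Diff_subset) auto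
  also have "card {i. i < p ^ d \<and> p dvd i} = p ^ (d - 1)"
    unfolding pd multiples_below[OF assms(1)] using assms(1) by (subst card_image) (auto intro: inj_onI)
  finally show ?thesis .
qed

context odd_split_metacyclic
begin

text \<open>The contribution of degree \<open>p\<^sup>t\<close> to the regular character.\<close>
definition char_sum :: "nat \<Rightarrow> nat \<Rightarrow> nat \<Rightarrow> complex" where
  "char_sum t x y = of_nat (p ^ t) * (\<Sum>i | i < p ^ N \<and> (t \<ge> 1 \<longrightarrow> \<not> p dvd i). \<Sum>j<p ^ (m - t).
     chi t (zeta p N ^ i) (zeta p (m - t) ^ j) x y)"

lemma char_sum_eq:
  assumes "t \<le> s"
  shows "char_sum t x y = (if p ^ m dvd y then
    of_nat (p ^ m) * (pow_ind p (N + t) x - (if t = 0 then 0 else pow_ind p (N + t - 1) x)) else 0)"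
proof -
  have pm: "p ^ m = p ^ t * p ^ (m - t)" using assms s_le by (simp flip: power_add)
  \<comment> \<open>There are two factors \<open>p ^ t\<close>, the degree weight and the value on
    scalars. One raises \<open>N\<close> to \<open>N + t\<close> in \<open>x\<close>, the other
    \<open>m - t\<close> to \<open>m\<close> in \<open>y\<close>.\<close>
  have shift: "of_nat (p ^ t) * pow_ind p d x' = pow_ind p (d + t) (p ^ t * x')" for d x'
    using p_pos by (auto simp: pow_ind_def power_add mult.commute)
  show ?thesis
  proof (cases "p ^ t dvd x \<and> p ^ t dvd y")
    case True
    then obtain x' y' where xy: "x = p ^ t * x'" "y = p ^ t * y'" by (auto elim!: dvdE)
    have y: "p ^ m dvd y \<longleftrightarrow> p ^ (m - t) dvd y'" using p_pos by (simp add: pm xy)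
    have I: "(\<Sum>i | i < p ^ N \<and> (t \<ge> 1 \<longrightarrow> \<not> p dvd i). zeta p N ^ (i * x'))
       = pow_ind p N x' - (if t = 0 then 0 else pow_ind p (N - 1) x')"
    proof (cases "t = 0")
      case True
      thus ?thesis using sum_zeta_powers[OF p_pos, of N x'] by (simp add: lessThan_def)
    next
      case False
      thus ?thesis using sum_zeta_powers_primitive[OF p_pos N1, of x'] by simp
    qed
    have "char_sum t x y = of_nat (p ^ t) * (of_nat (p ^ t) * 
       ((\<Sum>i | i < p ^ N \<and> (t \<ge> 1 \<longrightarrow> \<not> p dvd i). zeta p N ^ (i * x')) * (\<Sum>j<p ^ (m - t). zeta p (m - t) ^ (j * y'))))"
      using p_pos unfolding sum_product unfolding sum_distrib_left
      by (simp add: char_sum_def chi_def xy sum_distrib_left mult.assoc flip: power_mult)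
    also have "\<dots> = of_nat (p ^ t) * (of_nat (p ^ t) * pow_ind p N x' - (if t = 0 then 0 else of_nat (p ^ t) * pow_ind p (N - 1) x')) * pow_ind p (m - t) y'"
      unfolding I sum_zeta_powers[OF p_pos] by (simp add: algebra_simps)
    also have "\<dots> = (pow_ind p (N + t) x - (if t = 0 then 0 else pow_ind p (N + t - 1) x)) * (of_nat (p ^ t) * pow_ind p (m - t) y')"
      unfolding shift[of N x'] shift[of "N - 1" x'] xy(1)[symmetric] using N1 by simp
    also have "of_nat (p ^ t) * pow_ind p (m - t) y' = (if p ^ m dvd y then of_nat (p ^ m) else 0)"
      unfolding y by (simp add: pow_ind_def pm)
    finally show ?thesis by simp
  next
    case False
    have "\<not> p ^ t dvd x" if "p ^ m dvd y" using False that by (metis dvd_trans dvd_triv_left pm)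
    moreover have "\<not> p ^ (N + t) dvd x" if "\<not> p ^ t dvd x"
      using that by (meson dvd_trans le_add2 le_imp_power_dvd)
    moreover have "p ^ t dvd p ^ (N + t - 1)" using N1 by (intro le_imp_power_dvd) simp
    hence "\<not> p ^ (N + t - 1) dvd x" if "\<not> p ^ t dvd x" using that by (meson dvd_trans)
    ultimately show ?thesis using False by (auto simp: char_sum_def chi_def pow_ind_def)
  qed
qed

text \<open>The contributions telescope over \<open>t\<close> up to conductor exponent N + s = n,
  which leaves the regular character.\<close>

lemma char_sum_total:
  assumes "x < p ^ n" "y < p ^ m"
  shows "(\<Sum>t\<le>s. char_sum t x y) = (if x = 0 \<and> y = 0 then of_nat (p ^ (n + m)) else 0)"
proof -
  have tel: "(\<Sum>t\<le>s'. pow_ind p (N + t) x - (if t = 0 then 0 else pow_ind p (N + t - 1) x)) = pow_ind p (N + s') x" for s'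
    by (induction s') auto
  have "p ^ m dvd y \<longleftrightarrow> y = 0" "p ^ n dvd x \<longleftrightarrow> x = 0" using assms by (auto dest: dvd_imp_le)
  moreover have "(\<Sum>t\<le>s. char_sum t x y) = (if p ^ m dvd y then of_nat (p ^ m) *
      (\<Sum>t\<le>s. pow_ind p (N + t) x - (if t = 0 then 0 else pow_ind p (N + t - 1) x)) else 0)"
    unfolding sum_distrib_left by (simp add: char_sum_eq)
  hence "(\<Sum>t\<le>s. char_sum t x y) = (if p ^ m dvd y then of_nat (p ^ m) * pow_ind p (N + s) x else 0)"
    unfolding tel .
  ultimately show ?thesis by (simp add: pow_ind_def n_eq power_add mult_ac)
qed

text \<open>Both scalars are powers of one root of unity, so the sum is a rational combination of
  its powers and can be conjugated as a whole.\<close>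

lemma chi_conjugate:
  fixes f :: "nat \<Rightarrow> nat \<Rightarrow> rat"
  assumes "\<not> p dvd e" and "(\<Sum>x<p ^ n. \<Sum>y<p ^ m. of_rat (f x y) * chi t (zeta p l ^ u) (zeta p l ^ w) x y) = 0"
  shows "(\<Sum>x<p ^ n. \<Sum>y<p ^ m. of_rat (f x y) * chi t (zeta p l ^ (u * e)) (zeta p l ^ (w * e)) x y) = 0"
proof -
  define h where "h = (\<lambda>(x, y). if p ^ t dvd x \<and> p ^ t dvd y then f x y * of_nat (p ^ t) else 0)"
  define E where "E = (\<lambda>(x, y). u * (x div p ^ t) + w * (y div p ^ t))"
  have *: "(\<Sum>x<p ^ n. \<Sum>y<p ^ m. of_rat (f x y) * chi t (zeta p l ^ (u * e)) (zeta p l ^ (w * e)) x y)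
     = (\<Sum>z\<in>{..<p ^ n} \<times> {..<p ^ m}. of_rat (h z) * zeta p l ^ (E z * e))" for e
    unfolding sum.cartesian_product
    by (intro sum.cong refl)
      (auto simp: h_def E_def chi_def of_rat_mult of_rat_power power_add algebra_simps simp flip: power_mult)
  have "(\<Sum>z\<in>{..<p ^ n} \<times> {..<p ^ m}. of_rat (h z) * zeta p l ^ E z) = 0"
    using assms(2) *[of 1] by simp
  thus ?thesis
    unfolding * by (intro zeta_rational_combination_conjugate[OF p_prime p_odd assms(1)]) auto
qed

text \<open>Conjugation extends the vanishing from representatives to all pairs of scalars. Weighted
  summation then gives the regular character, which reads off \<open>f 0 0\<close>.\<close>

lemma kernel_trivial:
  fixes f :: "nat \<Rightarrow> nat \<Rightarrow> rat"
  assumes "\<And>t l u w. (t, l) \<in> spec_keys \<Longrightarrow> (u, w) \<in> set (specs t l) \<Longrightarrow>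
    (\<Sum>x<p ^ n. \<Sum>y<p ^ m. of_rat (f x y) * chi t (zeta p l ^ u) (zeta p l ^ w) x y) = 0"
  shows "f 0 0 = 0"
proof -
  have 0: "(\<Sum>x<p ^ n. \<Sum>y<p ^ m. of_rat (f x y) * chi t (zeta p N ^ i) (zeta p (m - t) ^ j) x y) = 0"
    if ti: "t \<le> s" "t \<ge> 1 \<longrightarrow> \<not> p dvd i" for t i j
  proof -
    obtain l u w e where "(t, l) \<in> spec_keys" "(u, w) \<in> set (specs t l)" and e: "\<not> p dvd e"
      and eq: "zeta p N ^ i = zeta p l ^ (u * e)" "zeta p (m - t) ^ j = zeta p l ^ (w * e)"
      using specs_cover[OF ti, of j] by blast
    hence "(\<Sum>x<p ^ n. \<Sum>y<p ^ m. of_rat (f x y) * chi t (zeta p l ^ u) (zeta p l ^ w) x y) = 0"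
      using assms by blast
    from chi_conjugate[OF e this] show ?thesis unfolding eq .
  qed
  have "(\<Sum>x<p ^ n. \<Sum>y<p ^ m. of_rat (f x y) * char_sum t x y) = 0" if "t \<le> s" for t
  proof -
    let ?I = "{i. i < p ^ N \<and> (t \<ge> 1 \<longrightarrow> \<not> p dvd i)}"
    have "(\<Sum>x<p ^ n. \<Sum>y<p ^ m. of_rat (f x y) * char_sum t x y)
      = (\<Sum>x<p ^ n. \<Sum>y<p ^ m. \<Sum>i\<in>?I. \<Sum>j<p ^ (m - t). of_nat (p ^ t) * (of_rat (f x y) * chi t (zeta p N ^ i) (zeta p (m - t) ^ j) x y))"
      unfolding char_sum_def by (simp add: sum_distrib_left mult_ac)
    also have "\<dots> = (\<Sum>i\<in>?I. \<Sum>j<p ^ (m - t). \<Sum>x<p ^ n. \<Sum>y<p ^ m. of_nat (p ^ t) * (of_rat (f x y) * chi t (zeta p N ^ i) (zeta p (m - t) ^ j) x y))"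
    proof -
      have 1: "(\<Sum>y\<in>B. \<Sum>i\<in>C. \<Sum>j\<in>D. F y i j) = (\<Sum>i\<in>C. \<Sum>j\<in>D. \<Sum>y\<in>B. F y i j)"
        for B C D :: "nat set" and F :: "nat \<Rightarrow> nat \<Rightarrow> nat \<Rightarrow> complex"
        by (rule trans[OF sum.swap], rule sum.cong[OF refl], rule sum.swap)
      have "(\<Sum>x\<in>A. \<Sum>y\<in>B. \<Sum>i\<in>C. \<Sum>j\<in>D. F x y i j) = (\<Sum>i\<in>C. \<Sum>j\<in>D. \<Sum>x\<in>A. \<Sum>y\<in>B. F x y i j)"
        for A B C D :: "nat set" and F :: "nat \<Rightarrow> nat \<Rightarrow> nat \<Rightarrow> nat \<Rightarrow> complex"
      proof -
        have "(\<Sum>x\<in>A. \<Sum>y\<in>B. \<Sum>i\<in>C. \<Sum>j\<in>D. F x y i j) = (\<Sum>x\<in>A. \<Sum>i\<in>C. \<Sum>j\<in>D. \<Sum>y\<in>B. F x y i j)"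
          by (rule sum.cong[OF refl], rule 1)
        also have "\<dots> = (\<Sum>i\<in>C. \<Sum>j\<in>D. \<Sum>x\<in>A. \<Sum>y\<in>B. F x y i j)" by (rule 1)
        finally show ?thesis .
      qed
      thus ?thesis .
    qed
    also have "\<dots> = (\<Sum>i\<in>?I. \<Sum>j<p ^ (m - t). of_nat (p ^ t) * (\<Sum>x<p ^ n. \<Sum>y<p ^ m. of_rat (f x y) * chi t (zeta p N ^ i) (zeta p (m - t) ^ j) x y))"
      by (simp only: sum_distrib_left)
    also have "\<dots> = 0" using 0[OF that] by (intro sum.neutral ballI) auto
    finally show ?thesis .
  qed
  hence "0 = (\<Sum>t\<le>s. \<Sum>x<p ^ n. \<Sum>y<p ^ m. of_rat (f x y) * char_sum t x y)" by simp
  also have "\<dots> = (\<Sum>x<p ^ n. \<Sum>y<p ^ m. of_rat (f x y) * (\<Sum>t\<le>s. char_sum t x y))"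
    unfolding sum_distrib_left
    by (simp only: sum.swap[of _ "{..<p ^ n}" "{..s}"] sum.swap[of _ "{..<p ^ m}" "{..s}"])
  also have "\<dots> = (\<Sum>x<p ^ n. \<Sum>y<p ^ m. if y = 0 then (if x = 0 then of_rat (f 0 0) * of_nat (p ^ (n + m)) else 0) else 0)"
    by (intro sum.cong refl) (auto simp: char_sum_total)
  also have "\<dots> = of_rat (f 0 0) * of_nat (p ^ (n + m))" using p_pos by simp
  finally show ?thesis using p_pos by simp
qed

section \<open>Dimension count over the rationals\<close>

lemma length_specs_linear:
  "length (specs 0 l) = (if l \<le> N then p ^ min l m else 0) + (if 1 \<le> l \<and> l \<le> m then p ^ min N (l - 1) else 0)"
  by (simp add: specs_def)

lemma length_specs_nonlinear:
  assumes "t \<ge> 1"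
  shows "length (specs t l) = (if l = N then p ^ min N (m - t) else p ^ N - p ^ (N - 1))"
proof -
  have "length (filter (\<lambda>i. \<not> p dvd i) [0..<p ^ N]) = card {i. i < p ^ N \<and> \<not> p dvd i}"
    by (simp add: length_filter_conv_card cong: conj_cong)
  thus ?thesis using assms card_non_multiples[OF p_pos N1] by (simp add: specs_def)
qed

lemma zeta_degree_Suc: "p ^ l + zeta_degree p (Suc l) = p ^ Suc l"
  using p_pos by (simp add: zeta_degree_def)

text \<open>The right side counts the pairs of scalars of linear characters with values in the
  \<open>p ^ M\<close>-th roots of unity. Passing to \<open>Suc M\<close> enlarges each of the two
  ranges only up to \<open>N\<close> and \<open>m\<close>, hence four cases.\<close>

lemma dim_linear:
  "(\<Sum>l\<le>M. length (specs 0 l) * zeta_degree p l) = p ^ (min M N + min M m)"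
proof (induction M)
  case 0
  show ?case by (simp add: length_specs_linear zeta_degree_def)
next
  case (Suc M)
  define \<phi> where "\<phi> = zeta_degree p (Suc M)"
  have \<phi>: "p ^ Suc M = p ^ M + \<phi>" using zeta_degree_Suc[of M] by (simp add: \<phi>_def)
  have "p ^ (min M N + min M m) + length (specs 0 (Suc M)) * \<phi> = p ^ (min (Suc M) N + min (Suc M) m)"
  proof (cases "Suc M \<le> N"; cases "Suc M \<le> m")
    assume "Suc M \<le> N" "Suc M \<le> m"
    moreover from this have "length (specs 0 (Suc M)) = p ^ Suc M + p ^ M" by (simp add: length_specs_linear min_def)
    moreover have "p ^ M * p ^ M + (p ^ Suc M + p ^ M) * \<phi> = p ^ Suc M * p ^ Suc M"
      unfolding \<phi> by (simp add: algebra_simps)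
    ultimately show ?thesis by (simp add: min_def power_add)
  next
    assume "Suc M \<le> N" "\<not> Suc M \<le> m"
    moreover from this have "length (specs 0 (Suc M)) = p ^ m" by (simp add: length_specs_linear min_def)
    moreover have "p ^ M * p ^ m + p ^ m * \<phi> = p ^ Suc M * p ^ m"
      unfolding \<phi> by (simp add: algebra_simps)
    ultimately show ?thesis by (cases "m = M") (auto simp: min_def power_add)
  next
    assume "\<not> Suc M \<le> N" "Suc M \<le> m"
    moreover from this have "length (specs 0 (Suc M)) = p ^ N" by (simp add: length_specs_linear min_def)
    moreover have "p ^ N * p ^ M + p ^ N * \<phi> = p ^ N * p ^ Suc M"
      unfolding \<phi> by (simp add: algebra_simps)
    ultimately show ?thesis by (cases "N = M") (auto simp: min_def power_add)
  next
    assume "\<not> Suc M \<le> N" "\<not> Suc M \<le> m"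
    thus ?thesis by (simp add: length_specs_linear min_absorb2)
  qed
  thus ?case using Suc by (simp add: \<phi>_def)
qed

text \<open>The right side counts the pairs of a primitive \<open>p ^ N\<close>-th and an arbitrary
  \<open>p ^ (m - t)\<close>-th root of unity.\<close>

lemma dim_nonlinear:
  assumes "t \<ge> 1"
  shows "(\<Sum>l\<in>{N..max N (m - t)}. length (specs t l) * zeta_degree p l) = p ^ (m - t) * zeta_degree p N"
proof -
  \<comment> \<open>The alternative \<open>j = 0\<close> takes care of \<open>m - t < N\<close>,
    where \<open>N\<close> is the only index.\<close>
  have "(\<Sum>l\<in>{N..N + j}. length (specs t l) * zeta_degree p l) = p ^ min (N + j) (m - t) * zeta_degree p N"
    if "j = 0 \<or> N + j \<le> m - t" for j
    using that
  proof (induction j)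
    case 0
    show ?case using assms by (simp add: length_specs_nonlinear)
  next
    case (Suc j)
    have "{N..N + Suc j} = insert (Suc (N + j)) {N..N + j}" by auto
    hence "(\<Sum>l\<in>{N..N + Suc j}. length (specs t l) * zeta_degree p l)
      = zeta_degree p N * zeta_degree p (Suc (N + j)) + p ^ (N + j) * zeta_degree p N"
      using Suc assms N1 by (simp add: length_specs_nonlinear min_def zeta_degree_def[of p N])
    also have "\<dots> = (p ^ (N + j) + zeta_degree p (Suc (N + j))) * zeta_degree p N" by (simp add: algebra_simps)
    also have "\<dots> = p ^ min (N + Suc j) (m - t) * zeta_degree p N" using Suc.prems by (simp add: zeta_degree_Suc min_def)
    finally show ?case .
  qed
  from this[of "max N (m - t) - N"] show ?thesis by (simp add: max_def min_def split: if_splits)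
qed

lemma dim_total:
  "(\<Sum>(t, l)\<in>spec_keys. length (specs t l) * ((p ^ t) ^ 2 * zeta_degree p l)) = p ^ (n + m)"
proof -
  have "(\<Sum>(t, l)\<in>spec_keys. length (specs t l) * ((p ^ t) ^ 2 * zeta_degree p l))
    = (\<Sum>l\<le>max N m. length (specs 0 l) * zeta_degree p l)
      + (\<Sum>t\<in>{1..s}. \<Sum>l\<in>{N..max N (m - t)}. length (specs t l) * ((p ^ t) ^ 2 * zeta_degree p l))"
    unfolding spec_keys_def
    by (subst sum.union_disjoint) (auto simp: sum.Sigma[symmetric] sum.cartesian_product[symmetric])
  also have "(\<Sum>l\<le>max N m. length (specs 0 l) * zeta_degree p l) = p ^ (N + m)"
    unfolding dim_linear by (simp add: min_def max_def)
  also have "(\<Sum>t\<in>{1..s}. \<Sum>l\<in>{N..max N (m - t)}. length (specs t l) * ((p ^ t) ^ 2 * zeta_degree p l))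
    = (\<Sum>t\<in>{1..s}. p ^ m * (p ^ t * zeta_degree p N))"
  proof (rule sum.cong[OF refl])
    fix t assume t: "t \<in> {1..s}"
    have "(\<Sum>l\<in>{N..max N (m - t)}. length (specs t l) * ((p ^ t) ^ 2 * zeta_degree p l))
      = (p ^ t) ^ 2 * (\<Sum>l\<in>{N..max N (m - t)}. length (specs t l) * zeta_degree p l)"
      by (simp add: sum_distrib_left mult_ac)
    also have "\<dots> = (p ^ t * p ^ (m - t)) * (p ^ t * zeta_degree p N)"
      using t dim_nonlinear[of t] by (simp add: power2_eq_square mult_ac)
    also have "p ^ t * p ^ (m - t) = p ^ m" using t s_le by (simp flip: power_add)
    finally show "(\<Sum>l\<in>{N..max N (m - t)}. length (specs t l) * ((p ^ t) ^ 2 * zeta_degree p l))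
      = p ^ m * (p ^ t * zeta_degree p N)" .
  qed
  \<comment> \<open>The terms telescope, as p ^ t * zeta_degree p N is p ^ (N + t) - p ^ (N + t -
    1); the upper limit is freed for the induction.\<close>
  also have "p ^ (N + m) + (\<Sum>t\<in>{1..s'}. p ^ m * (p ^ t * zeta_degree p N)) = p ^ (N + s' + m)" for s'
  proof (induction s')
    case (Suc s')
    have "p ^ Suc s' * zeta_degree p N + p ^ (N + s') = p ^ (N + Suc s')"
    proof -
      have "p ^ Suc s' * (p ^ (N - 1) + zeta_degree p N) = p ^ Suc s' * p ^ N"
        using zeta_degree_Suc[of "N - 1"] N1 by simp
      moreover have "Suc s' + (N - 1) = N + s'" using N1 by simp
      hence "p ^ Suc s' * p ^ (N - 1) = p ^ (N + s')" by (metis power_add)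
      ultimately show ?thesis by (metis add.commute distrib_left power_add)
    qed
    hence "p ^ m * (p ^ Suc s' * zeta_degree p N) + p ^ (N + s' + m) = p ^ (N + Suc s' + m)"
      by (metis add.commute distrib_left power_add)
    thus ?case using Suc by simp
  qed simp
  finally show ?thesis by (simp add: n_eq)
qed

text \<open>\<open>keys\<close> may be any enumeration because \<open>ring_dsum\<close> depends on
  the order of its summands, and each case lists them differently.\<close>

lemma rat_group_algebra_decomposition:
  assumes "distinct keys" "set keys = spec_keys"
  shows "rat_group_algebra G \<simeq> wedderburn_sum (map (\<lambda>(t, l). (length (specs t l), p ^ t, p ^ l)) keys)"
proof -
  \<comment> \<open>\<open>SL\<close> keeps the parameters that select a representation;
    \<open>L\<close> retains only matrix size and conductor exponent.\<close>
  define SL where "SL = concat (map (\<lambda>(t, l). map (\<lambda>(u, w). (t, l, u, w)) (specs t l)) keys)"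
  define L where "L = map (\<lambda>(t, l, u, w). (p ^ t, l)) SL"
  define P where "P = (\<lambda>(t, l, u, w) \<rho>. \<rho> \<in> hom G (cyclo_mat (p ^ t) (p ^ l)) \<and> \<rho> \<one> = \<one>\<^bsub>cyclo_mat (p ^ t) (p ^ l)\<^esub> \<and>
    (\<forall>x y. mat_trace (p ^ t) (\<rho> (el x y)) = chi t (zeta p l ^ u) (zeta p l ^ w) x y))"
  define \<rho> where "\<rho> = (\<lambda>i. SOME \<rho>. P (SL ! i) \<rho>)"
  have mem: "(t, l, u, w) \<in> set SL \<longleftrightarrow> (t, l) \<in> spec_keys \<and> (u, w) \<in> set (specs t l)" for t l u w
    using assms(2) by (auto simp: SL_def)
  have "\<exists>\<rho>. P z \<rho>" if "z \<in> set SL" for z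
  proof -
    obtain t l u w where z: "z = (t, l, u, w)" by (cases z) auto
    thus ?thesis using specs_rep[of t l u w] that mem[of t l u w] unfolding P_def z by auto
  qed
  hence \<rho>: "P (SL ! i) (\<rho> i)" if "i < length SL" for i
    unfolding \<rho>_def by (rule someI_ex) (use that in simp)
  have len: "length L = length SL" by (simp add: L_def)
  have "rat_group_algebra G \<simeq> ring_dsum (map (\<lambda>(q, l). cyclo_mat q (p ^ l)) L)"
  proof (rule rat_group_algebra_iso[OF is_group finite_carrier p_prime])
    show "\<rho> i \<in> hom G (cyclo_mat (fst (L ! i)) (p ^ snd (L ! i)))" if "i < length L" for i
      using \<rho>[of i] that by (simp add: L_def P_def case_prod_unfold)
    show "\<rho> i \<one> = \<one>\<^bsub>cyclo_mat (fst (L ! i)) (p ^ snd (L ! i))\<^esub>" if "i < length L" for i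
      using \<rho>[of i] that by (simp add: L_def P_def case_prod_unfold)
  next
    fix f :: "'a \<Rightarrow> rat"
    assume f: "\<And>i j k. i < length L \<Longrightarrow> (\<Sum>g\<in>carrier G. of_rat (f g) * \<rho> i g j k) = 0"
    have "f (el 0 0) = 0"
    proof (rule kernel_trivial[of "\<lambda>x y. f (el x y)"])
      fix t l u w assume "(t, l) \<in> spec_keys" "(u, w) \<in> set (specs t l)"
      hence "(t, l, u, w) \<in> set SL" by (simp add: mem)
      then obtain i where i: "i < length SL" "SL ! i = (t, l, u, w)" by (metis in_set_conv_nth)
      hence tr: "mat_trace (p ^ t) (\<rho> i (el x y)) = chi t (zeta p l ^ u) (zeta p l ^ w) x y" for x y
        using \<rho>[of i] by (simp add: P_def)
      have "0 = (\<Sum>j<p ^ t. \<Sum>g\<in>carrier G. of_rat (f g) * \<rho> i g j j)" using f i len by simp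
      also have "\<dots> = (\<Sum>g\<in>carrier G. of_rat (f g) * mat_trace (p ^ t) (\<rho> i g))"
        by (subst sum.swap) (simp add: mat_trace_def sum_distrib_left)
      also have "\<dots> = (\<Sum>x<p ^ n. \<Sum>y<p ^ m. of_rat (f (el x y)) * chi t (zeta p l ^ u) (zeta p l ^ w) x y)"
        unfolding sum_carrier tr ..
      finally show "(\<Sum>x<p ^ n. \<Sum>y<p ^ m. of_rat (f (el x y)) * chi t (zeta p l ^ u) (zeta p l ^ w) x y) = 0" ..
    qed
    thus "f \<one> = 0" by (simp add: el_0_0)
  next
    have "(\<Sum>i<length L. fst (L ! i) ^ 2 * zeta_degree p (snd (L ! i))) = sum_list (map (\<lambda>(q, l). q ^ 2 * zeta_degree p l) L)"
      by (simp add: sum_list_sum_nth case_prod_unfold atLeast0LessThan)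
    also have "\<dots> = sum_list (map (\<lambda>(t, l). length (specs t l) * ((p ^ t) ^ 2 * zeta_degree p l)) keys)"
      unfolding L_def SL_def
      by (induction keys) (auto simp: case_prod_unfold comp_def sum_list_triv)
    also have "\<dots> = p ^ (n + m)"
      using dim_total assms by (simp add: sum_list_distinct_conv_sum_set)
    finally show "(\<Sum>i<length L. fst (L ! i) ^ 2 * zeta_degree p (snd (L ! i))) \<le> card (carrier G)"
      by (simp add: card_carrier)
  qed
  moreover have "map (\<lambda>(q, l). cyclo_mat q (p ^ l)) L
    = concat (map (\<lambda>(c, q, d). replicate c (cyclo_mat q d)) (map (\<lambda>(t, l). (length (specs t l), p ^ t, p ^ l)) keys))"
    unfolding L_def SL_def
    by (induction keys) (auto simp: case_prod_unfold comp_def map_replicate_const)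
  ultimately show ?thesis by (simp add: wedderburn_sum_def)
qed

end

section \<open>The three stated lists as enumerations of \<open>spec_keys\<close>\<close>

lemma distinct_concat_Pair:
  "distinct ts \<Longrightarrow> (\<And>t. distinct (f t)) \<Longrightarrow> distinct (concat (map (\<lambda>t. map (Pair t) (f t)) ts))"
  by (induction ts) (auto simp: distinct_map inj_on_def)

context odd_split_metacyclic
begin

text \<open>Here \<open>m - t\<close> never exceeds \<open>N\<close>, so each positive
  \<open>t\<close> contributes only the conductor \<open>p ^ N\<close>.\<close>

lemma decomposition_case1:
  assumes "m \<le> N"
  shows "rat_group_algebra G \<simeq> wedderburn_sum (decomp_case1 p n m s)"
proof -
  define keys where "keys = [(0, 0)] @ map (Pair 0) [1..<m + 1] @ map (Pair 0) [m + 1..<N + 1]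
    @ map (\<lambda>t. (t, N)) [1..<s + 1]"
  have "decomp_case1 p n m s = map (\<lambda>(t, l). (length (specs t l), p ^ t, p ^ l)) keys"
    using assms N1 unfolding decomp_case1_def keys_def
    by (auto simp: n_eq length_specs_linear length_specs_nonlinear min_def simp del: upt_Suc)
  moreover have "distinct keys" by (auto simp: keys_def distinct_map inj_on_def simp del: upt_Suc)
  moreover have "(t, l) \<in> set keys \<longleftrightarrow> (t, l) \<in> spec_keys" for t l
    using assms by (auto simp: keys_def spec_keys_def image_iff simp del: upt_Suc)
  hence "set keys = spec_keys" by auto
  ultimately show ?thesis using rat_group_algebra_decomposition by simp
qed

text \<open>Conductors above \<open>p ^ N\<close> occur in nonlinear degrees exactly for
  \<open>t < m - N\<close>. From \<open>t = m - N\<close> on, only \<open>p ^ N\<close> remains,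
  with multiplicity \<open>p ^ (m - t)\<close>.\<close>

lemma decomposition_case2a:
  assumes "N < m" "m - N \<le> s"
  shows "rat_group_algebra G \<simeq> wedderburn_sum (decomp_case2a p n m s (m - N))"
proof -
  define keys where "keys = [(0, 0)] @ map (Pair 0) [1..<N + 1] @ map (Pair 0) [N + 1..<m + 1]
    @ map (\<lambda>t. (t, N)) [1..<m - N] @ concat (map (\<lambda>t. map (Pair t) [N + 1..<m - t + 1]) [1..<m - N])
    @ map (\<lambda>t. (t, N)) [m - N..<s + 1]"
  have "concat (map (\<lambda>t. map (\<lambda>l. (p ^ N - p ^ (N - 1), p ^ t, p ^ l)) [N + 1..<m - t + 1]) [1..<m - N])
    = map (\<lambda>(t, l). (length (specs t l), p ^ t, p ^ l)) (concat (map (\<lambda>t. map (Pair t) [N + 1..<m - t + 1]) [1..<m - N]))"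
    unfolding map_concat map_map
    by (intro arg_cong[of _ _ concat] map_cong refl) (auto simp: length_specs_nonlinear simp del: upt_Suc)
  hence "decomp_case2a p n m s (m - N) = map (\<lambda>(t, l). (length (specs t l), p ^ t, p ^ l)) keys"
    using assms N1 unfolding decomp_case2a_def keys_def
    by (auto simp: n_eq length_specs_linear length_specs_nonlinear min_def simp del: upt_Suc)
      (rule arg_cong[of _ _ "(^) p"], linarith)
  moreover have "distinct (concat (map (\<lambda>t. map (Pair t) [N + 1..<m - t + 1]) [1..<m - N]))"
    by (rule distinct_concat_Pair) auto
  hence "distinct keys" using assms by (auto simp: keys_def distinct_map inj_on_def simp del: upt_Suc)
  moreover have "(t, l) \<in> set keys \<longleftrightarrow> (t, l) \<in> spec_keys" for t l
    using assms by (auto simp: keys_def spec_keys_def image_iff simp del: upt_Suc)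
  hence "set keys = spec_keys" by auto
  ultimately show ?thesis using rat_group_algebra_decomposition by simp
qed

text \<open>Since \<open>s < m - N\<close>, every degree up to \<open>p ^ s\<close> still has
  conductors above \<open>p ^ N\<close>.\<close>

lemma decomposition_case2b:
  assumes "N < m" "s < m - N"
  shows "rat_group_algebra G \<simeq> wedderburn_sum (decomp_case2b p n m s)"
proof -
  define keys where "keys = [(0, 0)] @ map (Pair 0) [1..<N + 1] @ map (Pair 0) [N + 1..<m + 1]
    @ map (\<lambda>t. (t, N)) [1..<s + 1] @ concat (map (\<lambda>t. map (Pair t) [N + 1..<m - t + 1]) [1..<s + 1])"
  have "concat (map (\<lambda>t. map (\<lambda>l. (p ^ N - p ^ (N - 1), p ^ t, p ^ l)) [N + 1..<m - t + 1]) [1..<s + 1])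
    = map (\<lambda>(t, l). (length (specs t l), p ^ t, p ^ l)) (concat (map (\<lambda>t. map (Pair t) [N + 1..<m - t + 1]) [1..<s + 1]))"
    unfolding map_concat map_map
    by (intro arg_cong[of _ _ concat] map_cong refl) (auto simp: length_specs_nonlinear simp del: upt_Suc)
  hence "decomp_case2b p n m s = map (\<lambda>(t, l). (length (specs t l), p ^ t, p ^ l)) keys"
    using assms N1 unfolding decomp_case2b_def keys_def
    by (auto simp: n_eq length_specs_linear length_specs_nonlinear min_def simp del: upt_Suc)
  moreover have "distinct (concat (map (\<lambda>t. map (Pair t) [N + 1..<m - t + 1]) [1..<s + 1]))"
    by (rule distinct_concat_Pair) auto
  hence "distinct keys" using assms by (auto simp: keys_def distinct_map inj_on_def simp del: upt_Suc)
  moreover have "(t, l) \<in> set keys \<longleftrightarrow> (t, l) \<in> spec_keys" for t l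
    using assms by (auto simp: keys_def spec_keys_def image_iff simp del: upt_Suc)
  hence "set keys = spec_keys" by auto
  ultimately show ?thesis using rat_group_algebra_decomposition by simp
qed

end

theorem theorem1p1:
  fixes G :: "('g, 'b) monoid_scheme" and a b :: 'g
    and p n m s :: nat and r :: int
  assumes "prime p" and "odd p"
    and "n \<ge> 2" and "m \<ge> 1"
    and "coprime r (int (p ^ n))"
    and "mult_order (int (p ^ n)) r = p ^ s"
    and "1 \<le> s" and "s \<le> min (n - 1) m"
    and "group G"
    and "a \<in> carrier G" and "b \<in> carrier G"
    and "generate G {a, b} = carrier G"
    and "a [^]\<^bsub>G\<^esub> (p ^ n) = \<one>\<^bsub>G\<^esub>" and "b [^]\<^bsub>G\<^esub> (p ^ m) = \<one>\<^bsub>G\<^esub>"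
    and "b \<otimes>\<^bsub>G\<^esub> a \<otimes>\<^bsub>G\<^esub> inv\<^bsub>G\<^esub> b = a [^]\<^bsub>G\<^esub> r"
    and "card (carrier G) = p ^ (n + m)"
  shows "(n - s \<ge> m \<longrightarrow> rat_group_algebra G \<simeq> wedderburn_sum (decomp_case1 p n m s))
       \<and> (\<forall>k. n - s < m \<and> m = (n - s) + k \<and> k \<le> s \<longrightarrow>
              rat_group_algebra G \<simeq> wedderburn_sum (decomp_case2a p n m s k))
       \<and> (\<forall>k. n - s < m \<and> m = (n - s) + k \<and> k > s \<longrightarrow>
              rat_group_algebra G \<simeq> wedderburn_sum (decomp_case2b p n m s))"
proof -
  interpret G: group G by (rule assms(9))
  have s: "s \<le> n - 1" "s \<le> m" using assms(8) by auto
  have p0: "p > 0" using assms(1) prime_gt_0_nat by blast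
  obtain k where k: "r mod int (p ^ n) = 1 + int p ^ (n - s) * k" "\<not> int p dvd k"
    using prime_power_order_exponent[OF assms(1,2,6,7) s(1) assms(5)] by blast
  \<comment> \<open>The integer \<open>r\<close> is replaced by its least nonnegative residue, a
    natural exponent with the same power of \<open>a\<close>.\<close>
  define R where "R = nat (r mod int (p ^ n))"
  have rge: "r mod int (p ^ n) \<ge> 0" using p0 by simp
  \<comment> \<open>A negative \<open>k\<close> would make the residue negative, because p ^ (n - s)
    exceeds 1.\<close>
  have "k \<ge> 0"
  proof (rule ccontr)
    assume "\<not> k \<ge> 0"
    hence "int p ^ (n - s) * k \<le> int p ^ (n - s) * (-1)" using p0 by (intro mult_left_mono) auto
    moreover have "int p ^ (n - s) > 1" using prime_gt_1_nat[OF assms(1)] s assms(3,7) by (intro one_less_power) auto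
    ultimately show False using k(1) rge by linarith
  qed
  then obtain k' where k': "k = int k'" using nonneg_int_cases by blast
  have "int R = int (1 + p ^ (n - s) * k')" unfolding R_def using rge k(1) k' by simp
  hence R: "R = 1 + p ^ (n - s) * k'" by (simp only: of_nat_eq_iff)
  have aR: "a [^]\<^bsub>G\<^esub> r = a [^]\<^bsub>G\<^esub> R"
  proof -
    have "r = int (p ^ n) * (r div int (p ^ n)) + int R" unfolding R_def using rge by simp
    hence "a [^]\<^bsub>G\<^esub> r = a [^]\<^bsub>G\<^esub> (int (p ^ n) * (r div int (p ^ n)) + int R)" by simp
    also have "\<dots> = (a [^]\<^bsub>G\<^esub> int (p ^ n)) [^]\<^bsub>G\<^esub> (r div int (p ^ n)) \<otimes>\<^bsub>G\<^esub> a [^]\<^bsub>G\<^esub> int R"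
      using assms(10) by (simp only: G.int_pow_mult G.int_pow_pow)
    also have "a [^]\<^bsub>G\<^esub> int (p ^ n) = \<one>\<^bsub>G\<^esub>" using assms(13) by (simp only: int_pow_int)
    finally show ?thesis using assms(10) by (simp add: int_pow_int)
  qed
  have rel: "b \<otimes>\<^bsub>G\<^esub> a = a [^]\<^bsub>G\<^esub> R \<otimes>\<^bsub>G\<^esub> b"
    using assms(10,11) by (simp add: aR[symmetric] assms(15)[symmetric] G.m_assoc)
  interpret odd_split_metacyclic G a b p n m R "n - s" s k'
    by unfold_locales (use assms s R rel k(2) k' in auto)
  show ?thesis using decomposition_case1 decomposition_case2a decomposition_case2b by auto
qed

end
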